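(* Let $\mathcal A$ be an indexing collection of finite dimension on $\mathcal T$ and $m$ a reference measure, let $X$ be an $L^2$ set-indexed Lévy process with Lévy–Khintchine triplet $(b,\sigma^2,\nu)$ given by $X_A=b\,m(A)+\sigma B_A+N_A$, let $f:\mathcal T\to\mathbb R$ be a locally $X$-integrable function and $Y_A=\int_Af\,dX$ for $A\in\mathcal A$ (all as in the context). Then the process $Y$ may be written as a sum of three independent set-indexed processes: $$\forall A\in\mathcal A,\qquad Y_A=b\int_Af\,dm+\sigma\int_Af\,dB+\int_Af\,dN\quad\text{a.s.},$$ where $\int_{\cdot}f\,dN=\lim_{\varepsilon\to0^+}\int_{\cdot}f\,dN^\varepsilon$, and the limit as $\varepsilon\to0^+$ holds almost surely uniformly on $\{A'\in\mathcal A:A'\subseteq A\}$ for all $A\in\mathcal A$.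
   Context: Indexing collection. $\mathcal T$ is a non-empty set. $\mathcal A\subseteq\mathcal P(\mathcal T)$ is an indexing collection on $\mathcal T$ if: (1) $\varnothing\in\mathcal A$, and $\mathcal A$ and $\mathcal A\setminus\{\varnothing\}$ are closed under countable intersections; (2) there is an increasing sequence of finite subcollections $\mathcal A_n\subseteq\mathcal A$ ($n\in\mathbb N$), each closed under intersections, such that with $g_n(A)=\bigcap\{A'\in\mathcal A_n\cup\{\mathcal T\}:A\subseteq A'\}$ one has $A=\bigcap_n g_n(A)$ for all $A\in\mathcal A$; (3) (SHAPE) if $A,A_1,\dots,A_n\in\mathcal A$ and $A\subseteq\bigcup_{i\le n}A_i$ then $A\subseteq A_j$ for some $j$; (4) (TIP) the map $t\mapsto A(t)=\bigcap_nA_n(t)$, with $A_n(t)=\bigcap\{A\in\mathcal A_n\cup\{\mathcal T\}:t\in A\}$, is a bijection from $\mathcal T$ onto $\mathcal A\setminus\{\varnothing\}$. The sequence $(\mathcal A_n)$ is fixed, and $\varnothing$ and $\varnothing'=\bigcap_{A\in\mathcal A,A\ne\varnothing}A$ are assumed to belong to every $\mathcal A_n$. $\mathcal B=\sigma(\mathcal A)$. $\mathcal C_k=\{A_0\setminus\bigcup_{i=1}^{k+1}A_i:A_0,\dots,A_{k+1}\in\mathcal A\}$. $\mathcal C^\ell(\mathcal A_n)$ is the collection of sets $A\setminus\bigcup_{A'\in\mathcal A_n,A'\subsetneq A}A'$, $A\in\mathcal A_n$; $\mathcal C^\ell=\bigcup_n\mathcal C^\ell(\mathcal A_n)$. Finite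 dimension: there is $p\in\mathbb N^*$ such that every $(\mathcal A_n,\subseteq)$ admits an order embedding into $\mathbb N^p$ (componentwise order) and $\mathcal C^\ell\subseteq\mathcal C_{p-1}$. A pseudo-metric $d$ on $\mathcal A$, transported to $\mathcal T$ by $d_{\mathcal T}(s,t)=d(A(s),A(t))$, is compatible if: (i) $d(A\cap A'',A'\cap A'')\le d(A,A')$; (ii) $d(A_n,\bigcap_kA_k)\to0$ for every non-increasing sequence $(A_n)$ in $\mathcal A$; (iii) $\max_{C\in\mathcal C^\ell(\mathcal A_n)}\sup_{s,s'\in C}d_{\mathcal T}(s,s')\to0$ as $n\to\infty$; (iv) for $A\subseteq A'$ in $\mathcal A$ there is $A''\in\mathcal A$ with $A\subseteq A''\subseteq A'$ and $d(A,A'')=d(A'',A')=d(A,A')/2$. The reference measure $m$ is a measure on $(\mathcal T,\mathcal B)$, finite on $\mathcal A$, such that $d_m(A,A')=m(A\triangle A')$ is compatible. The process $X$. $(\Omega,\mathcal F,\mathbf P)$ is a complete probability space; $b\in\mathbb R$, $\sigma\ge0$, $\nu$ is a Borel measure on $\mathbb R$ with $\nu(\{0\})=0$ and $\int x^2\nu(dx)<\infty$. $B=\{B_A:A\in\mathcal A\}$ is a centered Gaussian process with $\mathbf E[B_{A_1}B_{A_2}]=m(A_1\cap A_2)$. $\widetilde\Pi$ is a Poisson random set on $\mathcal T\times\mathbb R$ of intensity $m\otimes\nu$, independent of $B$. For measurable $g:\mathcal T\to\mathbb R$, $$\int_Ag\,dN^\varepsilon=\sum_{(t,J)\in\widetilde\Pi,\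 t\in A,\ |J|\ge\varepsilon}g(t)J-\int_Ag\,dm\int_{\varepsilon\le|x|\le1}x\,\nu(dx).$$ $N^\varepsilon_A=\int_A1\,dN^\varepsilon$, and $N_A=\lim_{\varepsilon\to0^+}N^\varepsilon_A$ (it is known that this limit exists almost surely, uniformly in $A\subseteq A_{\max}$ for every $A_{\max}\in\mathcal A$). $X_A=b\,m(A)+\sigma B_A+N_A$; its law on $A$ has characteristic exponent $m(A)\psi(\xi)$, $\psi(\xi)=ib\xi-\frac12\sigma^2\xi^2+\int(e^{i\xi x}-1-i\xi x\mathbf 1_{|x|\le1})\nu(dx)$. The integral. $L(X)$ is the space of ($m$-a.e. classes of) measurable $g:\mathcal T\to\mathbb R$ with $\|g\|_{L(X)}^2=(b+\int_{|x|>1}x\,\nu(dx))^2\|g\|_{L^1(m)}^2+(\sigma^2+\int x^2\nu(dx))\|g\|_{L^2(m)}^2<\infty$ ($0\times\infty=0$). $g\mapsto\int_{\mathcal T}g\,dX$ is the unique continuous linear map $L(X)\to L^2(\Omega)$ with $\int_{\mathcal T}\mathbf 1_A\,dX=X_A$ for all $A\in\mathcal A$; $\int_Af\,dX=\int_{\mathcal T}f\mathbf 1_A\,dX$, and $\int_Af\,dB$ is the same construction with $B$ in place of $X$ (the Wiener integral). $f$ is locally $X$-integrable if $f\mathbf 1_A\in L(X)$ for all $A\in\mathcal A$. *)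

theory Defs
  imports "HOL-Probability.Probability"
begin

section \<open>Indexing collections\<close>

definition outer_approx :: "'a set \<Rightarrow> 'a set set \<Rightarrow> 'a set \<Rightarrow> 'a set" where
  "outer_approx T \<A>n A = \<Inter>{A' \<in> \<A>n \<union> {T}. A \<subseteq> A'}"

definition tip_approx :: "'a set \<Rightarrow> 'a set set \<Rightarrow> 'a \<Rightarrow> 'a set" where
  "tip_approx T \<A>n t = \<Inter>{A \<in> \<A>n \<union> {T}. t \<in> A}"

definition tip_set :: "'a set \<Rightarrow> (nat \<Rightarrow> 'a set set) \<Rightarrow> 'a \<Rightarrow> 'a set" where
  "tip_set T \<A>s t = (\<Inter>n. tip_approx T (\<A>s n) t)"

text \<open>The approximating sequence \<open>\<A>s\<close> is fixed together with the collection, and the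
  normalisation that the empty set and the least non-empty set lie in every \<open>\<A>s n\<close> is part of
  the definition.\<close>

definition indexing_collection :: "'a set \<Rightarrow> 'a set set \<Rightarrow> (nat \<Rightarrow> 'a set set) \<Rightarrow> bool" where
  "indexing_collection T \<A> \<A>s \<longleftrightarrow>
     T \<noteq> {} \<and> \<A> \<subseteq> Pow T \<and>
     {} \<in> \<A> \<and>
     (\<forall>F :: nat \<Rightarrow> 'a set. range F \<subseteq> \<A> \<longrightarrow> (\<Inter>k. F k) \<in> \<A>) \<and>
     (\<forall>F :: nat \<Rightarrow> 'a set. range F \<subseteq> \<A> - {{}} \<longrightarrow> (\<Inter>k. F k) \<in> \<A> - {{}}) \<and>
     incseq \<A>s \<and>
     (\<forall>n. finite (\<A>s n) \<and> \<A>s n \<subseteq> \<A> \<and> (\<forall>A\<in>\<A>s n. \<forall>A'\<in>\<A>s n. A \<inter> A' \<in> \<A>s n)) \<and>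
     (\<forall>A\<in>\<A>. A = (\<Inter>n. outer_approx T (\<A>s n) A)) \<and>
     (\<forall>A\<in>\<A>. \<forall>F. finite F \<and> F \<noteq> {} \<and> F \<subseteq> \<A> \<and> A \<subseteq> \<Union>F \<longrightarrow> (\<exists>A'\<in>F. A \<subseteq> A')) \<and>
     bij_betw (tip_set T \<A>s) T (\<A> - {{}}) \<and>
     (\<forall>n. {} \<in> \<A>s n \<and> \<Inter>(\<A> - {{}}) \<in> \<A>s n)"

definition increment_class :: "'a set set \<Rightarrow> nat \<Rightarrow> 'a set set" where
  "increment_class \<A> k = {A 0 - (\<Union>i\<in>{1..k+1}. A i) | A. \<forall>i\<le>k+1. A i \<in> \<A>}"

definition left_nbhds :: "'a set set \<Rightarrow> 'a set set" where
  "left_nbhds \<A>n = (\<lambda>A. A - \<Union>{A' \<in> \<A>n. A' \<subset> A}) ` \<A>n"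

text \<open>Elements of $\mathbb{N}^p$ are functions on \<open>nat\<close>, compared on the coordinates below \<open>p\<close>.
  Injectivity of \<open>\<phi>\<close> follows from the equivalence, inclusion being antisymmetric.\<close>

definition finite_dimensional :: "'a set set \<Rightarrow> (nat \<Rightarrow> 'a set set) \<Rightarrow> bool" where
  "finite_dimensional \<A> \<A>s \<longleftrightarrow>
     (\<exists>p\<ge>1.
        (\<forall>n. \<exists>\<phi> :: 'a set \<Rightarrow> nat \<Rightarrow> nat.
           \<forall>A\<in>\<A>s n. \<forall>A'\<in>\<A>s n. A \<subseteq> A' \<longleftrightarrow> (\<forall>i<p. \<phi> A i \<le> \<phi> A' i)) \<and>
        (\<Union>n. left_nbhds (\<A>s n)) \<subseteq> increment_class \<A> (p - 1))"


section \<open>Compatible pseudo-metrics and reference measures\<close>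

definition pseudo_metric_on :: "'b set \<Rightarrow> ('b \<Rightarrow> 'b \<Rightarrow> real) \<Rightarrow> bool" where
  "pseudo_metric_on S d \<longleftrightarrow>
     (\<forall>x\<in>S. d x x = 0) \<and>
     (\<forall>x\<in>S. \<forall>y\<in>S. 0 \<le> d x y \<and> d x y = d y x) \<and>
     (\<forall>x\<in>S. \<forall>y\<in>S. \<forall>z\<in>S. d x z \<le> d x y + d y z)"

text \<open>The suprema of diameters are taken in \<open>ennreal\<close>, so that they are meaningful when
  unbounded, and are \<open>0\<close> over the empty set.\<close>

definition compatible_metric ::
    "'a set \<Rightarrow> 'a set set \<Rightarrow> (nat \<Rightarrow> 'a set set) \<Rightarrow> ('a set \<Rightarrow> 'a set \<Rightarrow> real) \<Rightarrow> bool" where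
  "compatible_metric T \<A> \<A>s d \<longleftrightarrow>
     pseudo_metric_on \<A> d \<and>
     (\<forall>A\<in>\<A>. \<forall>A'\<in>\<A>. \<forall>A''\<in>\<A>. d (A \<inter> A'') (A' \<inter> A'') \<le> d A A') \<and>
     (\<forall>F :: nat \<Rightarrow> 'a set. range F \<subseteq> \<A> \<and> decseq F \<longrightarrow>
        (\<lambda>n. d (F n) (\<Inter>k. F k)) \<longlonglongrightarrow> 0) \<and>
     (\<lambda>n. SUP C\<in>left_nbhds (\<A>s n). SUP s\<in>C. SUP s'\<in>C.
        ennreal (d (tip_set T \<A>s s) (tip_set T \<A>s s'))) \<longlonglongrightarrow> 0 \<and>
     (\<forall>A\<in>\<A>. \<forall>A'\<in>\<A>. A \<subseteq> A' \<longrightarrow>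
        (\<exists>A''\<in>\<A>. A \<subseteq> A'' \<and> A'' \<subseteq> A' \<and> d A A'' = d A A' / 2 \<and> d A'' A' = d A A' / 2))"

definition reference_measure ::
    "'a set \<Rightarrow> 'a set set \<Rightarrow> (nat \<Rightarrow> 'a set set) \<Rightarrow> 'a measure \<Rightarrow> bool" where
  "reference_measure T \<A> \<A>s m \<longleftrightarrow>
     space m = T \<and> sets m = sigma_sets T \<A> \<and>
     (\<forall>A\<in>\<A>. emeasure m A < \<infinity>) \<and>
     compatible_metric T \<A> \<A>s (\<lambda>A A'. measure m (sym_diff A A'))"


section \<open>Gaussian processes and Poisson random sets\<close>

definition centered_gaussian_var :: "'w measure \<Rightarrow> ('w \<Rightarrow> real) \<Rightarrow> bool" where
  "centered_gaussian_var P Z \<longleftrightarrow>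
     Z \<in> borel_measurable P \<and>
     ((AE \<omega> in P. Z \<omega> = 0) \<or>
      (\<exists>s>0. distributed P lborel Z (\<lambda>x. ennreal (normal_density 0 s x))))"

definition centered_gaussian_process ::
    "'w measure \<Rightarrow> 'i set \<Rightarrow> ('i \<Rightarrow> 'w \<Rightarrow> real) \<Rightarrow> bool" where
  "centered_gaussian_process P I B \<longleftrightarrow>
     (\<forall>F c. finite F \<and> F \<subseteq> I \<longrightarrow> centered_gaussian_var P (\<lambda>\<omega>. \<Sum>i\<in>F. c i * B i \<omega>))"

definition point_count :: "('w \<Rightarrow> 'b set) \<Rightarrow> 'b set \<Rightarrow> 'w \<Rightarrow> ennreal" where
  "point_count \<Xi> D \<omega> = emeasure (count_space UNIV) (\<Xi> \<omega> \<inter> D)"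

text \<open>The Poisson law with parameter \<open>\<infinity>\<close> is the Dirac mass at \<open>\<infinity>\<close>.\<close>

definition poisson_var :: "'w measure \<Rightarrow> ('w \<Rightarrow> ennreal) \<Rightarrow> ennreal \<Rightarrow> bool" where
  "poisson_var P Z r \<longleftrightarrow>
     Z \<in> borel_measurable P \<and>
     (if r = \<infinity> then (AE \<omega> in P. Z \<omega> = \<infinity>)
      else (\<forall>k::nat. measure P {\<omega> \<in> space P. Z \<omega> = of_nat k}
              = exp (- enn2real r) * enn2real r ^ k / fact k))"

definition poisson_random_set :: "'w measure \<Rightarrow> 'b measure \<Rightarrow> ('w \<Rightarrow> 'b set) \<Rightarrow> bool" where
  "poisson_random_set P \<mu> \<Xi> \<longleftrightarrow>
     (\<forall>\<omega>\<in>space P. \<Xi> \<omega> \<subseteq> space \<mu> \<and> countable (\<Xi> \<omega>)) \<and>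
     (\<forall>D\<in>sets \<mu>. poisson_var P (point_count \<Xi> D) (emeasure \<mu> D)) \<and>
     (\<forall>n (D :: nat \<Rightarrow> 'b set). D ` {..<n} \<subseteq> sets \<mu> \<and> disjoint_family_on D {..<n} \<longrightarrow>
        prob_space.indep_vars P (\<lambda>_. borel) (\<lambda>i. point_count \<Xi> (D i)) {..<n})"

definition process_sigma ::
    "'w measure \<Rightarrow> 'i set \<Rightarrow> ('i \<Rightarrow> 'w \<Rightarrow> 'c::topological_space) \<Rightarrow> 'w set set" where
  "process_sigma P I Z =
     sets (vimage_algebra (space P) (\<lambda>\<omega>. \<lambda>i\<in>I. Z i \<omega>) (PiM I (\<lambda>_. borel)))"


section \<open>The set-indexed Levy process and its stochastic integral\<close>

text \<open>The random sum is almost surely finite when \<open>A\<close> has finite measure and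
  $\int x^2\,\nu(dx) < \infty$, since then \<open>emeasure m A * emeasure \<nu> {x. \<bar>x\<bar> \<ge> \<epsilon>} < \<infinity>\<close>.\<close>

definition jump_integral_eps ::
    "'a measure \<Rightarrow> real measure \<Rightarrow> ('w \<Rightarrow> ('a \<times> real) set) \<Rightarrow> ('a \<Rightarrow> real) \<Rightarrow> real
      \<Rightarrow> 'a set \<Rightarrow> 'w \<Rightarrow> real" where
  "jump_integral_eps m \<nu> \<Xi> g \<epsilon> A \<omega> =
     (\<Sum>(t, J)\<in>{(t, J) \<in> \<Xi> \<omega>. t \<in> A \<and> \<epsilon> \<le> \<bar>J\<bar>}. g t * J)
     - (LINT t:A|m. g t) * (LINT x:{x. \<epsilon> \<le> \<bar>x\<bar> \<and> \<bar>x\<bar> \<le> 1}|\<nu>. x)"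

definition jump_integral ::
    "'a measure \<Rightarrow> real measure \<Rightarrow> ('w \<Rightarrow> ('a \<times> real) set) \<Rightarrow> ('a \<Rightarrow> real)
      \<Rightarrow> 'a set \<Rightarrow> 'w \<Rightarrow> real" where
  "jump_integral m \<nu> \<Xi> g A \<omega> = Lim (at_right 0) (\<lambda>\<epsilon>. jump_integral_eps m \<nu> \<Xi> g \<epsilon> A \<omega>)"

definition levy_process ::
    "'a measure \<Rightarrow> real \<Rightarrow> real \<Rightarrow> real measure \<Rightarrow> ('a set \<Rightarrow> 'w \<Rightarrow> real)
      \<Rightarrow> ('w \<Rightarrow> ('a \<times> real) set) \<Rightarrow> 'a set \<Rightarrow> 'w \<Rightarrow> real" where
  "levy_process m b \<sigma> \<nu> B \<Xi> A \<omega> =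
     b * measure m A + \<sigma> * B A \<omega> + jump_integral m \<nu> \<Xi> (\<lambda>_. 1) A \<omega>"

definition LX_norm_sq ::
    "'a measure \<Rightarrow> real \<Rightarrow> real \<Rightarrow> real measure \<Rightarrow> ('a \<Rightarrow> real) \<Rightarrow> ennreal" where
  "LX_norm_sq m b \<sigma> \<nu> g =
     ennreal ((b + (LINT x:{x. \<bar>x\<bar> > 1}|\<nu>. x))\<^sup>2) * (\<integral>\<^sup>+t. ennreal \<bar>g t\<bar> \<partial>m)\<^sup>2
     + ennreal (\<sigma>\<^sup>2 + (LINT x|\<nu>. x\<^sup>2)) * (\<integral>\<^sup>+t. ennreal ((g t)\<^sup>2) \<partial>m)"

definition LX_space ::
    "'a measure \<Rightarrow> real \<Rightarrow> real \<Rightarrow> real measure \<Rightarrow> ('a \<Rightarrow> real) set" where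
  "LX_space m b \<sigma> \<nu> = {g \<in> borel_measurable m. LX_norm_sq m b \<sigma> \<nu> g < \<infinity>}"

text \<open>\<open>\<Phi>\<close> is a version of the continuous linear map from $L(X)$ to $L^2(P)$ extending
  \<open>indicator A \<mapsto> X A\<close>. It acts on representatives; by linearity and continuity, functions that
  agree \<open>m\<close>-almost everywhere have almost surely equal images, and any two such maps agree
  almost surely at each point of $L(X)$.\<close>

definition stochastic_integral ::
    "'w measure \<Rightarrow> 'a measure \<Rightarrow> 'a set set \<Rightarrow> real \<Rightarrow> real \<Rightarrow> real measure
      \<Rightarrow> ('a set \<Rightarrow> 'w \<Rightarrow> real) \<Rightarrow> (('a \<Rightarrow> real) \<Rightarrow> 'w \<Rightarrow> real) \<Rightarrow> bool" where
  "stochastic_integral P m \<A> b \<sigma> \<nu> X \<Phi> \<longleftrightarrow>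
     (\<forall>g\<in>LX_space m b \<sigma> \<nu>. \<Phi> g \<in> borel_measurable P \<and> integrable P (\<lambda>\<omega>. (\<Phi> g \<omega>)\<^sup>2)) \<and>
     (\<forall>g\<in>LX_space m b \<sigma> \<nu>. \<forall>h\<in>LX_space m b \<sigma> \<nu>. \<forall>a c.
        AE \<omega> in P. \<Phi> (\<lambda>t. a * g t + c * h t) \<omega> = a * \<Phi> g \<omega> + c * \<Phi> h \<omega>) \<and>
     (\<forall>g\<in>LX_space m b \<sigma> \<nu>. \<forall>G :: nat \<Rightarrow> 'a \<Rightarrow> real. range G \<subseteq> LX_space m b \<sigma> \<nu> \<and>
        (\<lambda>n. LX_norm_sq m b \<sigma> \<nu> (\<lambda>t. G n t - g t)) \<longlonglongrightarrow> 0 \<longrightarrow>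
        (\<lambda>n. LINT \<omega>|P. (\<Phi> (G n) \<omega> - \<Phi> g \<omega>)\<^sup>2) \<longlonglongrightarrow> 0) \<and>
     (\<forall>A\<in>\<A>. AE \<omega> in P. \<Phi> (indicator A) \<omega> = X A \<omega>)"

definition locally_integrable ::
    "'a measure \<Rightarrow> 'a set set \<Rightarrow> real \<Rightarrow> real \<Rightarrow> real measure \<Rightarrow> ('a \<Rightarrow> real) \<Rightarrow> bool" where
  "locally_integrable m \<A> b \<sigma> \<nu> f \<longleftrightarrow>
     (\<forall>A\<in>\<A>. (\<lambda>t. f t * indicator A t) \<in> LX_space m b \<sigma> \<nu>)"

end

theory Submission
  imports Defs
begin

text \<open>The tips of \<open>\<A>s n\<close> give each point of \<open>T\<close> a position in $\mathbb{N}^p$ such that every set of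
  \<open>\<A>s n\<close> is a lower orthant. The jump size is one further coordinate, so compensated jump sums
  over the sets of \<open>\<A>s n\<close> and jump sizes in a band are partial sums, over lower orthants, of
  independent centred variables. Applying Ottaviani's inequality to each coordinate in turn bounds
  their maximum by the total variance, with a constant depending only on \<open>p\<close>. Outer approximation
  in \<open>\<A>\<close> and rational jump sizes then turn this into a uniform Cauchy property in the
  truncation level.

  The same bound shows that the jump integral is continuous in probability as a function of the
  integrand. Both sides of the decomposition are therefore linear and continuous, and they agree on
  indicators of sets in the \<open>\<pi>\<close>-system \<open>\<A>\<close>. The Wiener part is measurable for the completion of the
  \<open>\<sigma>\<close>-algebra of \<open>B\<close> and the jump part for that of the point counts, and independence passes to
  completions.\<close>

section \<open>Moments of Poisson variables\<close>

text \<open>The uniformity over \<open>{A'\<in>\<A>. A' \<subseteq> A}\<close> is the obstacle: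
  inclusion is a partial order, so one-parameter inequalities do not apply, and a union bound
  degrades because the number of sets in \<open>\<A>s n\<close> may grow with \<open>n\<close>. The
  bound obtained here has the factor \<open>2 ^ Suc p\<close> at every level \<open>n\<close>, which
  is why it survives the passage to all of \<A>. The truncated integral compensates only jumps of
  size at most 1. Over a band of sizes below 1 it is centred; over a whole tail it becomes centred
  after subtracting the mean of the jumps larger than 1, which is finite because \<nu> has a second
  moment. Every variance bound needs f to be square integrable on A. Membership in L(X) yields this
  unless both \<sigma> and the second moment of \<nu> vanish. In that case X is almost surely the
  deterministic drift, and f is locally integrable or, for b = 0, merely locally measurable. Hence
  the case distinction in the final proof. Completions are forced by the form of the objects: the
  jump integral is a pathwise \<open>Lim\<close> that exists only almost surely, and stochastic
  integrals are determined only up to null sets.\<close>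

lemma poisson_sums:
  fixes r :: real
  shows "(\<lambda>k. r ^ k / fact k) sums exp r"
    and "(\<lambda>k. real k * (r ^ k / fact k)) sums (r * exp r)"
    and "(\<lambda>k. (real k)\<^sup>2 * (r ^ k / fact k)) sums ((r\<^sup>2 + r) * exp r)"
proof -
  show 0: "(\<lambda>k. r ^ k / fact k) sums exp r"
    using exp_converges[of r] by (simp add: field_simps)
  \<comment> \<open>Cancelling one factor of the factorial turns each moment series, shifted by one
    index, into the preceding ones.\<close>
  have eq1: "real (Suc k) * (r ^ Suc k / fact (Suc k)) = r * (r ^ k / fact k)" for k
    by (simp add: fact_Suc del: of_nat_Suc)
  show 1: "(\<lambda>k. real k * (r ^ k / fact k)) sums (r * exp r)"
    using sums_mult[OF 0, of r] sums_Suc_iff[of "\<lambda>k. real k * (r ^ k / fact k)" "r * exp r"]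
    by (simp only: eq1) simp
  have "(real (Suc k))\<^sup>2 * (r ^ Suc k / fact (Suc k))
      = r * (real k * (r ^ k / fact k)) + r * (r ^ k / fact k)" for k
    using eq1[of k] by (simp only: power2_eq_square mult.assoc) (simp add: field_simps)
  then have "(\<lambda>k. (real (Suc k))\<^sup>2 * (r ^ Suc k / fact (Suc k))) sums (r * (r * exp r) + r * exp r)"
    using sums_add[OF sums_mult[OF 1, of r] sums_mult[OF 0, of r]] by simp
  then show "(\<lambda>k. (real k)\<^sup>2 * (r ^ k / fact k)) sums ((r\<^sup>2 + r) * exp r)"
    by (subst (asm) sums_Suc_iff) (simp add: algebra_simps power2_eq_square)
qed

context prob_space
begin

text \<open>For a finite parameter \<open>poisson_var\<close> prescribes only the probabilities of
  the integers. These add up to one, so no mass is left for infinity or for non-integers.\<close>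

lemma poisson_var_AE_nat:
  assumes Z: "poisson_var M Z r" and r: "r < \<infinity>"
  shows "AE \<omega> in M. \<exists>k::nat. Z \<omega> = of_nat k"
proof -
  have [measurable]: "Z \<in> borel_measurable M" using Z by (simp add: poisson_var_def)
  define E where "E k = {\<omega> \<in> space M. Z \<omega> = of_nat k}" for k :: nat
  have E[measurable]: "E k \<in> sets M" for k unfolding E_def by measurable
  have pE: "prob (E k) = exp (- enn2real r) * (enn2real r ^ k / fact k)" for k
    using Z r by (simp add: poisson_var_def E_def less_top split: if_splits)
  have "disjoint_family E" by (auto simp: disjoint_family_on_def E_def)
  then have "(\<lambda>k. prob (E k)) sums prob (\<Union>k. E k)"
    by (intro finite_measure_UNION) auto
  moreover have "(\<lambda>k. prob (E k)) sums (exp (- enn2real r) * exp (enn2real r))"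
    unfolding pE by (intro sums_mult poisson_sums)
  ultimately have "prob (\<Union>k. E k) = 1"
    by (metis sums_unique2 exp_minus_inverse mult.commute)
  then have "AE \<omega> in M. \<omega> \<in> (\<Union>k. E k)" by (simp add: prob_eq_1)
  then show ?thesis by eventually_elim (auto simp: E_def)
qed

text \<open>The variable is almost surely an integer, so the expectation is a series over its atoms.
  Asking for the sum with the factor \<open>exp (enn2real r)\<close> left in lets
  \<open>poisson_sums\<close> be used as they stand. The functions \<open>h\<close> and
  \<open>g\<close> are the same function on integers and on reals.\<close>

lemma nn_integral_poisson_var:
  assumes Z: "poisson_var M Z r" and r: "r < \<infinity>" and h: "\<And>k. 0 \<le> h k"
    and s: "(\<lambda>k. h k * (enn2real r ^ k / fact k)) sums (c * exp (enn2real r))"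
    and hg: "\<And>k::nat. h k = g (real k)"
  shows "(\<integral>\<^sup>+\<omega>. ennreal (g (enn2real (Z \<omega>))) \<partial>M) = ennreal c"
proof -
  have [measurable]: "Z \<in> borel_measurable M" using Z by (simp add: poisson_var_def)
  define E where "E k = {\<omega> \<in> space M. Z \<omega> = of_nat k}" for k :: nat
  have E[measurable]: "E k \<in> sets M" for k unfolding E_def by measurable
  have pE: "prob (E k) = exp (- enn2real r) * (enn2real r ^ k / fact k)" for k
    using Z r by (simp add: poisson_var_def E_def less_top split: if_splits)
  have "AE \<omega> in M. ennreal (g (enn2real (Z \<omega>))) = (\<Sum>k. ennreal (h k) * indicator (E k) \<omega>)"
    using poisson_var_AE_nat[OF Z r] AE_space
  proof eventually_elim
    case (elim \<omega>)
    then obtain k where k: "Z \<omega> = of_nat k" by blast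
    have "(\<Sum>j. ennreal (h j) * indicator (E j) \<omega>) = (\<Sum>j\<in>{k}. ennreal (h j) * indicator (E j) \<omega>)"
      by (rule suminf_finite) (auto simp: E_def k)
    then show ?case using k elim by (simp add: E_def hg)
  qed
  then have "(\<integral>\<^sup>+\<omega>. ennreal (g (enn2real (Z \<omega>))) \<partial>M)
      = (\<integral>\<^sup>+\<omega>. (\<Sum>k. ennreal (h k) * indicator (E k) \<omega>) \<partial>M)"
    by (rule nn_integral_cong_AE)
  also have "\<dots> = (\<Sum>k. ennreal (h k) * emeasure M (E k))"
    by (subst nn_integral_suminf) (auto simp: nn_integral_cmult_indicator)
  also have "\<dots> = (\<Sum>k. ennreal (h k * prob (E k)))"
    using h by (simp add: emeasure_eq_measure ennreal_mult')
  also have "\<dots> = ennreal c"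
  proof (rule suminf_ennreal_eq)
    have "(\<lambda>k. exp (- enn2real r) * (h k * (enn2real r ^ k / fact k))) sums
        (exp (- enn2real r) * (c * exp (enn2real r)))"
      by (intro sums_mult s)
    also have "exp (- enn2real r) * (c * exp (enn2real r)) = c"
      by (simp add: exp_minus)
    finally show "(\<lambda>k. h k * prob (E k)) sums c" by (simp add: pE mult_ac)
  qed (use h in auto)
  finally show ?thesis .
qed

lemma poisson_var_moments:
  assumes Z: "poisson_var M Z r" and r: "r < \<infinity>"
  defines "Y \<equiv> \<lambda>\<omega>. enn2real (Z \<omega>) - enn2real r"
  shows "integrable M Y" and "expectation Y = 0"
    and "integrable M (\<lambda>\<omega>. (Y \<omega>)\<^sup>2)" and "expectation (\<lambda>\<omega>. (Y \<omega>)\<^sup>2) = enn2real r"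
proof -
  define q where "q = enn2real r"
  have q: "q \<ge> 0" by (simp add: q_def)
  have [measurable]: "Z \<in> borel_measurable M" using Z by (simp add: poisson_var_def)
  have 1: "(\<integral>\<^sup>+\<omega>. ennreal (enn2real (Z \<omega>)) \<partial>M) = ennreal q"
    by (rule nn_integral_poisson_var[OF Z r, where h = real])
       (use poisson_sums(2)[of q] in \<open>auto simp: q_def\<close>)
  have i1: "integrable M (\<lambda>\<omega>. enn2real (Z \<omega>))"
    by (rule integrableI_nn_integral_finite[OF _ _ 1]) auto
  have e1: "expectation (\<lambda>\<omega>. enn2real (Z \<omega>)) = q"
    using 1 q by (subst integral_eq_nn_integral) auto
  show "integrable M Y" unfolding Y_def using i1 by simp
  show "expectation Y = 0" unfolding Y_def using i1 e1 by (simp add: prob_space q_def)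
  have s: "(\<lambda>k. (real k - q)\<^sup>2 * (q ^ k / fact k)) sums (q * exp q)"
  proof -
    have "(\<lambda>k. (real k)\<^sup>2 * (q ^ k / fact k) - 2 * q * (real k * (q ^ k / fact k)) + q\<^sup>2 * (q ^ k / fact k))
       sums ((q\<^sup>2 + q) * exp q - 2 * q * (q * exp q) + q\<^sup>2 * exp q)"
      by (intro sums_add sums_diff sums_mult poisson_sums)
    also have "(q\<^sup>2 + q) * exp q - 2 * q * (q * exp q) + q\<^sup>2 * exp q = q * exp q"
      by (simp add: algebra_simps power2_eq_square)
    finally show ?thesis by (simp add: algebra_simps power2_eq_square diff_divide_distrib add_divide_distrib)
  qed
  have 2: "(\<integral>\<^sup>+\<omega>. ennreal ((enn2real (Z \<omega>) - q)\<^sup>2) \<partial>M) = ennreal q"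
    by (rule nn_integral_poisson_var[OF Z r, where h = "\<lambda>k. (real k - q)\<^sup>2" and g = "\<lambda>x. (x - q)\<^sup>2"])
       (use s in \<open>auto simp: q_def\<close>)
  show i2: "integrable M (\<lambda>\<omega>. (Y \<omega>)\<^sup>2)"
    unfolding Y_def q_def[symmetric]
    by (rule integrableI_nn_integral_finite[OF _ _ 2]) auto
  show "expectation (\<lambda>\<omega>. (Y \<omega>)\<^sup>2) = enn2real r"
    unfolding Y_def q_def[symmetric] using 2 q by (subst integral_eq_nn_integral) auto
qed

text \<open>Mixed terms vanish, because a new summand is independent of the sum of the others and
  both are centred. This additivity is what turns the later bounds into an integral of the squared
  integrand, with no factor counting the cells of a partition.\<close>

lemma sum_indep_centered:
  fixes Z :: "'i \<Rightarrow> 'a \<Rightarrow> real"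
  assumes fin: "finite X" and ind: "indep_vars (\<lambda>_. borel) Z X"
    and sq: "\<And>x. x \<in> X \<Longrightarrow> integrable M (\<lambda>\<omega>. (Z x \<omega>)\<^sup>2)"
    and ce: "\<And>x. x \<in> X \<Longrightarrow> expectation (Z x) = 0"
  shows "integrable M (\<lambda>\<omega>. (\<Sum>x\<in>X. Z x \<omega>)\<^sup>2)"
    and "expectation (\<lambda>\<omega>. \<Sum>x\<in>X. Z x \<omega>) = 0"
    and "expectation (\<lambda>\<omega>. (\<Sum>x\<in>X. Z x \<omega>)\<^sup>2) = (\<Sum>x\<in>X. expectation (\<lambda>\<omega>. (Z x \<omega>)\<^sup>2))"
proof -
  have me: "Z x \<in> borel_measurable M" if "x \<in> X" for x
    using ind that by (auto simp: indep_vars_def2)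
  have i1: "integrable M (Z x)" if "x \<in> X" for x
    using me[OF that] sq[OF that] by (rule square_integrable_imp_integrable)
  show "expectation (\<lambda>\<omega>. \<Sum>x\<in>X. Z x \<omega>) = 0"
    using i1 ce by (subst Bochner_Integration.integral_sum) auto
  have "integrable M (\<lambda>\<omega>. (\<Sum>x\<in>X. Z x \<omega>)\<^sup>2) \<and>
    expectation (\<lambda>\<omega>. (\<Sum>x\<in>X. Z x \<omega>)\<^sup>2) = (\<Sum>x\<in>X. expectation (\<lambda>\<omega>. (Z x \<omega>)\<^sup>2))"
    using fin ind sq ce i1
  proof (induction X)
    case (insert y X)
    define S where "S = (\<lambda>\<omega>. \<Sum>x\<in>X. Z x \<omega>)"
    have ind': "indep_vars (\<lambda>_. borel) Z X"
      by (rule indep_vars_subset[OF insert.prems(1)]) auto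
    have IH: "integrable M (\<lambda>\<omega>. (S \<omega>)\<^sup>2)"
       "expectation (\<lambda>\<omega>. (S \<omega>)\<^sup>2) = (\<Sum>x\<in>X. expectation (\<lambda>\<omega>. (Z x \<omega>)\<^sup>2))"
      using insert.IH[OF ind'] insert.prems by (auto simp: S_def)
    have iy: "indep_var borel (Z y) borel S"
      unfolding S_def by (rule indep_vars_sum) (use insert in auto)
    have iS: "integrable M S" unfolding S_def using insert.prems(4) by auto
    have ip: "integrable M (\<lambda>\<omega>. Z y \<omega> * S \<omega>)"
      by (rule indep_var_integrable[OF iy]) (use insert.prems(4) iS in auto)
    have ep: "expectation (\<lambda>\<omega>. Z y \<omega> * S \<omega>) = 0"
      by (subst indep_var_lebesgue_integral[OF iy]) (use insert.prems(3,4) iS in auto)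
    have eq: "(\<Sum>x\<in>insert y X. Z x \<omega>)\<^sup>2 = (Z y \<omega>)\<^sup>2 + 2 * (Z y \<omega> * S \<omega>) + (S \<omega>)\<^sup>2" for \<omega>
      using insert.hyps by (simp add: S_def power2_sum)
    show ?case unfolding eq using insert.hyps insert.prems(2)[of y] IH ip ep by simp
  qed (simp)
  then show "integrable M (\<lambda>\<omega>. (\<Sum>x\<in>X. Z x \<omega>)\<^sup>2)"
    "expectation (\<lambda>\<omega>. (\<Sum>x\<in>X. Z x \<omega>)\<^sup>2) = (\<Sum>x\<in>X. expectation (\<lambda>\<omega>. (Z x \<omega>)\<^sup>2))" by auto
qed

end

section \<open>Ottaviani's inequality with several orders\<close>

context prob_space
begin

text \<open>Restrictions of an independent family to disjoint index blocks are independent random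
  vectors. Predicates on such vectors are the form in which the first-passage event and the event
  about the remaining increment occur in Ottaviani's inequality.\<close>

lemma indep_vars_events:
  fixes Z :: "'i \<Rightarrow> 'a \<Rightarrow> real"
  assumes ind: "indep_vars (\<lambda>_. borel) Z X" and AB: "A \<inter> C = {}" "A \<subseteq> X" "C \<subseteq> X"
    and p: "Measurable.pred (PiM A (\<lambda>_. borel)) p" and q: "Measurable.pred (PiM C (\<lambda>_. borel)) q"
  shows "prob {\<omega> \<in> space M. p (\<lambda>i\<in>A. Z i \<omega>) \<and> q (\<lambda>i\<in>C. Z i \<omega>)}
      = prob {\<omega> \<in> space M. p (\<lambda>i\<in>A. Z i \<omega>)} * prob {\<omega> \<in> space M. q (\<lambda>i\<in>C. Z i \<omega>)}"
proof -
  let ?SA = "{x \<in> space (PiM A (\<lambda>_. borel)). p x}" and ?SC = "{x \<in> space (PiM C (\<lambda>_. borel)). q x}"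
  have "prob ((\<lambda>\<omega>. (\<lambda>i\<in>A. Z i \<omega>, \<lambda>i\<in>C. Z i \<omega>)) -` (?SA \<times> ?SC) \<inter> space M)
     = prob ((\<lambda>\<omega>. \<lambda>i\<in>A. Z i \<omega>) -` ?SA \<inter> space M) * prob ((\<lambda>\<omega>. \<lambda>i\<in>C. Z i \<omega>) -` ?SC \<inter> space M)"
    by (rule indep_varD[OF indep_var_restrict[OF ind AB]]) (use p q in measurable)
  moreover have "(\<lambda>\<omega>. (\<lambda>i\<in>A. Z i \<omega>, \<lambda>i\<in>C. Z i \<omega>)) -` (?SA \<times> ?SC) \<inter> space M
      = {\<omega> \<in> space M. p (\<lambda>i\<in>A. Z i \<omega>) \<and> q (\<lambda>i\<in>C. Z i \<omega>)}"
    by (auto simp: space_PiM)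
  moreover have "(\<lambda>\<omega>. \<lambda>i\<in>A. Z i \<omega>) -` ?SA \<inter> space M = {\<omega> \<in> space M. p (\<lambda>i\<in>A. Z i \<omega>)}"
    "(\<lambda>\<omega>. \<lambda>i\<in>C. Z i \<omega>) -` ?SC \<inter> space M = {\<omega> \<in> space M. q (\<lambda>i\<in>C. Z i \<omega>)}"
    by (auto simp: space_PiM)
  ultimately show ?thesis by simp
qed

text \<open>The induction on the number \<open>d\<close> of orders applies Ottaviani's inequality to the partial sums
  with respect to the last order, viewed as vectors indexed by the thresholds for the other
  orders.\<close>

lemma ottaviani_multiparameter:
  fixes Z :: "'i \<Rightarrow> 'a \<Rightarrow> real" and \<phi> :: "'i \<Rightarrow> nat \<Rightarrow> nat" and K :: "(nat \<Rightarrow> nat) set"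
  assumes fin: "finite X" "finite K" and ind: "indep_vars (\<lambda>_. borel) Z X"
    and sq: "\<And>x. x \<in> X \<Longrightarrow> integrable M (\<lambda>\<omega>. (Z x \<omega>)\<^sup>2)"
    and ce: "\<And>x. x \<in> X \<Longrightarrow> expectation (Z x) = 0" and l: "l > 0"
  shows "prob {\<omega> \<in> space M. \<exists>k\<in>K. \<bar>\<Sum>x\<in>{x\<in>X. \<forall>i<d. \<phi> x i \<le> k i}. Z x \<omega>\<bar> > 2 ^ d * l}
     \<le> 2 ^ d * (\<Sum>x\<in>X. expectation (\<lambda>\<omega>. (Z x \<omega>)\<^sup>2)) / l\<^sup>2"
  using fin(1) ind sq ce
proof (induction d arbitrary: X)
  case 0
  have [measurable]: "Z x \<in> borel_measurable M" if "x \<in> X" for x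
    using 0(2) that by (auto simp: indep_vars_def2)
  note S = sum_indep_centered[OF 0(1,2,3,4)]
  \<comment> \<open>With no order left the sum does not depend on \<open>k\<close>, so Chebyshev's
    inequality suffices. Each further order doubles both the threshold and the bound.\<close>
  have "prob {\<omega> \<in> space M. \<exists>k\<in>K. \<bar>\<Sum>x\<in>{x\<in>X. \<forall>i<0. \<phi> x i \<le> k i}. Z x \<omega>\<bar> > 2 ^ 0 * l}
    \<le> prob {\<omega> \<in> space M. \<bar>(\<Sum>x\<in>X. Z x \<omega>) - expectation (\<lambda>\<omega>. \<Sum>x\<in>X. Z x \<omega>)\<bar> \<ge> l}"
    by (rule finite_measure_mono) (auto simp: S(2))
  also have "\<dots> \<le> variance (\<lambda>\<omega>. \<Sum>x\<in>X. Z x \<omega>) / l\<^sup>2"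
    by (rule Chebyshev_inequality) (use S l in auto)
  finally show ?case using S by simp
next
  case (Suc d)
  let ?E = "{\<omega> \<in> space M. \<exists>k\<in>K. \<bar>\<Sum>x\<in>{x\<in>X. \<forall>i<Suc d. \<phi> x i \<le> k i}. Z x \<omega>\<bar> > 2 ^ Suc d * l}"
  define L where "L = 2 ^ d * l"
  define v where "v Y = (\<Sum>x\<in>Y. expectation (\<lambda>\<omega>. (Z x \<omega>)\<^sup>2))" for Y
  define q where "q = 2 ^ d * v X / l\<^sup>2"
  define S where "S Y k \<omega> = (\<Sum>x\<in>{x\<in>Y. \<forall>i<d. \<phi> x i \<le> k i}. Z x \<omega>)" for Y k \<omega>
  define Xl where "Xl j = {x\<in>X. \<phi> x d \<le> j}" for j
  have Zm[measurable]: "Z x \<in> borel_measurable M" if "x \<in> X" for x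
    using Suc.prems(2) that by (auto simp: indep_vars_def2)
  have Sm[measurable]: "S Y k \<in> borel_measurable M" if "Y \<subseteq> X" for Y k
    unfolding S_def using that by (intro borel_measurable_sum) auto
  have K[simp]: "countable K" using fin(2) by (rule countable_finite)
  have IH: "prob {\<omega> \<in> space M. \<exists>k\<in>K. \<bar>S Y k \<omega>\<bar> > L} \<le> 2 ^ d * v Y / l\<^sup>2" if "Y \<subseteq> X" for Y
    unfolding S_def L_def v_def using that finite_subset[OF that Suc.prems(1)] Suc.prems
    by (intro Suc.IH indep_vars_subset[OF Suc.prems(2)]) auto
  have IH': "prob {\<omega> \<in> space M. \<exists>k\<in>K. \<bar>S Y k \<omega>\<bar> > L} \<le> q" if "Y \<subseteq> X" for Y
  proof -
    have "v Y \<le> v X" unfolding v_def using that Suc.prems(1) by (intro sum_mono2) auto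
    then have "2 ^ d * v Y / l\<^sup>2 \<le> q" unfolding q_def
      by (intro divide_right_mono mult_left_mono) auto
    then show ?thesis using IH[OF that] by simp
  qed
  obtain N where N: "k d < N" if "k \<in> K" for k
  proof -
    have "finite ((\<lambda>k. k d) ` K)" using fin(2) by simp
    then obtain N where "\<forall>y\<in>(\<lambda>k. k d) ` K. y < N" using finite_nat_set_iff_bounded by blast
    then show ?thesis using that by auto
  qed
  \<comment> \<open>\<open>V j\<close> is the event that the vector of sums up to level
    \<open>j\<close> of the last order has an entry beyond \<open>2 * L\<close> for the first time
    at \<open>j\<close>, \<open>W j\<close> that some sum over the levels above \<open>j\<close>
    exceeds \<open>L\<close>, and \<open>F\<close> that some complete sum exceeds \<open>L\<close>.
    On \<open>V j - W j\<close> the triangle inequality forces \<open>F\<close>.\<close>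
  define U where "U j \<omega> \<longleftrightarrow> (\<exists>k\<in>K. \<bar>S (Xl j) k \<omega>\<bar> > 2 * L)" for j \<omega>
  define V where "V j = {\<omega>\<in>space M. U j \<omega> \<and> (\<forall>i<j. \<not> U i \<omega>)}" for j
  define W where "W j = {\<omega>\<in>space M. \<exists>k\<in>K. \<bar>S (X - Xl j) k \<omega>\<bar> > L}" for j
  define F where "F = {\<omega>\<in>space M. \<exists>k\<in>K. \<bar>S X k \<omega>\<bar> > L}"
  have XlX[simp]: "Xl j \<subseteq> X" for j by (auto simp: Xl_def)
  have Um[measurable]: "Measurable.pred M (U j)" for j
    unfolding U_def by measurable
  have Vm[measurable]: "V j \<in> sets M" for j unfolding V_def by measurable
  have Wm[measurable]: "W j \<in> sets M" for j unfolding W_def by measurable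
  have Fm[measurable]: "F \<in> sets M" unfolding F_def by measurable
  have VW: "prob (V j \<inter> W j) = prob (V j) * prob (W j)" for j
  proof -
    \<comment> \<open>First passage and remainder written as functions of the variables inside and
      outside \<open>Xl j\<close>. The sets \<open>Xl n\<close> increase with \<open>n\<close>, so
      the sums at earlier levels read only the block \<open>Xl j\<close>.\<close>
    define p where "p z \<longleftrightarrow> (\<exists>k\<in>K. \<bar>\<Sum>x\<in>{x\<in>Xl j. \<forall>i<d. \<phi> x i \<le> k i}. z x\<bar> > 2 * L) \<and>
       (\<forall>n<j. \<not> (\<exists>k\<in>K. \<bar>\<Sum>x\<in>{x\<in>Xl n. \<forall>i<d. \<phi> x i \<le> k i}. z x\<bar> > 2 * L))" for z :: "'i \<Rightarrow> real"
    define r where "r z \<longleftrightarrow> (\<exists>k\<in>K. \<bar>\<Sum>x\<in>{x\<in>X - Xl j. \<forall>i<d. \<phi> x i \<le> k i}. z x\<bar> > L)" for z :: "'i \<Rightarrow> real"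
    have mono: "Xl n \<subseteq> Xl j" if "n \<le> j" for n using that by (auto simp: Xl_def)
    have sm: "(\<lambda>z :: 'i \<Rightarrow> real. \<Sum>x\<in>{x\<in>Y. \<forall>i<d. \<phi> x i \<le> k i}. z x) \<in> borel_measurable (PiM Y' (\<lambda>_. borel))"
      if "Y \<subseteq> Y'" for Y Y' :: "'i set" and k
    proof (rule borel_measurable_sum)
      fix x assume "x \<in> {x\<in>Y. \<forall>i<d. \<phi> x i \<le> k i}"
      then show "(\<lambda>z :: 'i \<Rightarrow> real. z x) \<in> borel_measurable (PiM Y' (\<lambda>_. borel :: real measure))"
        using that measurable_component_singleton[of x Y' "\<lambda>_. borel :: real measure"] by auto
    qed
    note [measurable] = sm[OF subset_refl] sm[OF mono[OF less_imp_le]]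
    have pm: "Measurable.pred (PiM (Xl j) (\<lambda>_. borel)) p"
      unfolding p_def by measurable
    have rm: "Measurable.pred (PiM (X - Xl j) (\<lambda>_. borel)) r"
      unfolding r_def by measurable
    have pV: "p (\<lambda>i\<in>Xl j. Z i \<omega>) \<longleftrightarrow> U j \<omega> \<and> (\<forall>i<j. \<not> U i \<omega>)" for \<omega>
    proof -
      have "(\<Sum>x\<in>{x\<in>Xl n. \<forall>i<d. \<phi> x i \<le> k i}. (\<lambda>i\<in>Xl j. Z i \<omega>) x) = S (Xl n) k \<omega>"
        if "n \<le> j" for n k
        unfolding S_def using mono[OF that] by (intro sum.cong) auto
      then show ?thesis unfolding p_def U_def by (simp del: restrict_apply)
    qed
    have rW: "r (\<lambda>i\<in>X - Xl j. Z i \<omega>) \<longleftrightarrow> (\<exists>k\<in>K. \<bar>S (X - Xl j) k \<omega>\<bar> > L)" for \<omega>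
    proof -
      have "(\<Sum>x\<in>{x\<in>X - Xl j. \<forall>i<d. \<phi> x i \<le> k i}. (\<lambda>i\<in>X - Xl j. Z i \<omega>) x) = S (X - Xl j) k \<omega>" for k
        unfolding S_def by (intro sum.cong) auto
      then show ?thesis unfolding r_def by (simp del: restrict_apply)
    qed
    have "V j \<inter> W j = {\<omega> \<in> space M. p (\<lambda>i\<in>Xl j. Z i \<omega>) \<and> r (\<lambda>i\<in>X - Xl j. Z i \<omega>)}"
      "V j = {\<omega> \<in> space M. p (\<lambda>i\<in>Xl j. Z i \<omega>)}" "W j = {\<omega> \<in> space M. r (\<lambda>i\<in>X - Xl j. Z i \<omega>)}"
      unfolding pV rW V_def W_def by auto
    then show ?thesis
      using indep_vars_events[OF Suc.prems(2) _ XlX _ pm rm] by auto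
  qed
  have split: "S X k \<omega> = S (Xl j) k \<omega> + S (X - Xl j) k \<omega>" for k \<omega> j
  proof -
    have "{x\<in>X. \<forall>i<d. \<phi> x i \<le> k i} = {x\<in>Xl j. \<forall>i<d. \<phi> x i \<le> k i} \<union> {x\<in>X - Xl j. \<forall>i<d. \<phi> x i \<le> k i}"
      by (auto simp: Xl_def)
    then show ?thesis unfolding S_def
      using Suc.prems(1) finite_subset[OF XlX Suc.prems(1)]
      by (simp only:) (rule sum.union_disjoint, auto)
  qed
  have VWF: "V j - W j \<subseteq> F" for j
  proof
    fix \<omega> assume w: "\<omega> \<in> V j - W j"
    then obtain k where k: "k \<in> K" "\<bar>S (Xl j) k \<omega>\<bar> > 2 * L" by (auto simp: V_def U_def)
    then have "\<bar>S (X - Xl j) k \<omega>\<bar> \<le> L" using w by (auto simp: W_def V_def not_less)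
    then have "\<bar>S X k \<omega>\<bar> > L" using k split[of k \<omega> j] by linarith
    then show "\<omega> \<in> F" using k w by (auto simp: F_def V_def)
  qed
  have disj: "disjoint_family_on (\<lambda>j. V j - W j) {..<N}" "disjoint_family_on V {..<N}"
    by (auto simp: disjoint_family_on_def V_def) (metis linorder_neqE_nat)+
  have sub: "?E \<subseteq> (\<Union>j<N. V j)"
  proof safe
    fix \<omega> k assume w: "\<omega> \<in> space M" "k \<in> K" "\<bar>\<Sum>x\<in>{x\<in>X. \<forall>i<Suc d. \<phi> x i \<le> k i}. Z x \<omega>\<bar> > 2 ^ Suc d * l"
    have "{x\<in>X. \<forall>i<Suc d. \<phi> x i \<le> k i} = {x\<in>Xl (k d). \<forall>i<d. \<phi> x i \<le> k i}"
      by (auto simp: Xl_def less_Suc_eq)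
    then have U: "U (k d) \<omega>" using w by (auto simp: U_def S_def L_def mult_ac)
    define j where "j = (LEAST j. U j \<omega>)"
    have "U j \<omega>" "j \<le> k d"
      unfolding j_def using U by (rule LeastI, rule Least_le)
    moreover have "\<forall>i<j. \<not> U i \<omega>" unfolding j_def using not_less_Least by blast
    ultimately have "\<omega> \<in> V j" "j < N" using w N[of k] by (auto simp: V_def)
    then show "\<omega> \<in> (\<Union>j<N. V j)" by blast
  qed
  \<comment> \<open>If \<open>q \<le> 1 / 2\<close>, the remainder stays within \<open>L\<close>
    with probability at least one half whatever the passage level, so the disjoint events
    \<open>V j - W j\<close> inside \<open>F\<close> carry at least half of the passage probability.
    If \<open>q > 1 / 2\<close>, the bound exceeds one.\<close>
  have "prob ?E \<le> 2 * q"
  proof (cases "q \<le> 1 / 2")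
    case True
    have "prob (V j) \<le> 2 * prob (V j - W j)" for j
    proof -
      have "prob (V j - W j) = prob (V j) - prob (V j \<inter> W j)"
        by (rule finite_measure_Diff') auto
      also have "\<dots> = prob (V j) * (1 - prob (W j))" by (simp add: VW algebra_simps)
      also have "\<dots> \<ge> prob (V j) * (1 / 2)"
        using IH'[of "X - Xl j"] True by (intro mult_left_mono) (auto simp: W_def)
      finally show ?thesis by simp
    qed
    then have "(\<Sum>j<N. prob (V j)) \<le> (\<Sum>j<N. 2 * prob (V j - W j))" by (intro sum_mono)
    also have "\<dots> = 2 * prob (\<Union>j<N. V j - W j)"
      unfolding sum_distrib_left[symmetric]
      by (subst finite_measure_finite_Union[OF _ _ disj(1)]) auto
    also have "\<dots> \<le> 2 * prob F" using VWF by (intro mult_left_mono finite_measure_mono) auto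
    also have "\<dots> \<le> 2 * q" using IH'[of X] by (simp add: F_def)
    finally have "prob (\<Union>j<N. V j) \<le> 2 * q"
      by (subst finite_measure_finite_Union[OF _ _ disj(2)]) auto
    moreover have "prob ?E \<le> prob (\<Union>j<N. V j)"
      using sub by (intro finite_measure_mono) auto
    ultimately show ?thesis by simp
  next
    case False
    then show ?thesis using prob_le_1 by (intro order_trans[OF prob_le_1]) auto
  qed
  then show ?case by (simp add: q_def v_def)
qed

end

section \<open>Compensated sums over a Poisson random set\<close>

text \<open>If infinitely many points fall into \<open>W\<close>, the sum is \<open>0\<close> by
  convention. The measurability proof takes this value into account, and the maximal inequalities
  are stated over sets of finite measure, where it almost surely does not occur.\<close>

definition compensated_sum ::
    "'b measure \<Rightarrow> ('w \<Rightarrow> 'b set) \<Rightarrow> ('b \<Rightarrow> real) \<Rightarrow> 'b set \<Rightarrow> 'w \<Rightarrow> real" where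
  "compensated_sum \<mu> \<Xi> g W \<omega> = (\<Sum>x\<in>\<Xi> \<omega> \<inter> W. g x) - (LINT x:W|\<mu>. g x)"

lemma point_count_finite: "finite (\<Xi> \<omega> \<inter> D) \<Longrightarrow> point_count \<Xi> D \<omega> = of_nat (card (\<Xi> \<omega> \<inter> D))"
  unfolding point_count_def by (simp add: emeasure_count_space_finite)

lemma point_count_less_top_iff: "point_count \<Xi> D \<omega> < \<infinity> \<longleftrightarrow> finite (\<Xi> \<omega> \<inter> D)"
  unfolding point_count_def by (simp add: emeasure_count_space of_nat_less_top)

text \<open>Grouping the points by the value of \<open>h\<close> turns the sum into a linear
  combination of point counts, the functionals of the random set whose joint law is
  prescribed.\<close>

lemma sum_points_simple:
  assumes fin: "finite (\<Xi> \<omega> \<inter> W)" and X: "finite X" "h ` (\<Xi> \<omega> \<inter> W) \<subseteq> X"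
    and F: "\<And>x. x \<in> \<Xi> \<omega> \<inter> W \<Longrightarrow> F x = c (h x)"
  shows "(\<Sum>x\<in>\<Xi> \<omega> \<inter> W. F x) = (\<Sum>y\<in>X. c y * enn2real (point_count \<Xi> {x\<in>W. h x = y} \<omega>))"
proof -
  have "(\<Sum>x\<in>\<Xi> \<omega> \<inter> W. F x) = (\<Sum>y\<in>X. \<Sum>x\<in>{x\<in>\<Xi> \<omega> \<inter> W. h x = y}. F x)"
    using fin X by (intro sum.group[symmetric])
  also have "\<dots> = (\<Sum>y\<in>X. c y * enn2real (point_count \<Xi> {x\<in>W. h x = y} \<omega>))"
  proof (rule sum.cong[OF refl])
    fix y
    have eq: "{x\<in>\<Xi> \<omega> \<inter> W. h x = y} = \<Xi> \<omega> \<inter> {x\<in>W. h x = y}" by auto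
    have "finite (\<Xi> \<omega> \<inter> {x\<in>W. h x = y})" using fin by (rule rev_finite_subset) auto
    then have "enn2real (point_count \<Xi> {x\<in>W. h x = y} \<omega>) = card (\<Xi> \<omega> \<inter> {x\<in>W. h x = y})"
      by (simp add: point_count_finite)
    moreover have "(\<Sum>x\<in>\<Xi> \<omega> \<inter> {x\<in>W. h x = y}. F x) = (\<Sum>x\<in>\<Xi> \<omega> \<inter> {x\<in>W. h x = y}. c y)"
      using F by (intro sum.cong) auto
    ultimately show "(\<Sum>x\<in>{x\<in>\<Xi> \<omega> \<inter> W. h x = y}. F x) = c y * enn2real (point_count \<Xi> {x\<in>W. h x = y} \<omega>)"
      unfolding eq by simp
  qed
  finally show ?thesis .
qed

lemma simple_function_approximation:
  fixes g :: "'b \<Rightarrow> real"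
  assumes g: "g \<in> borel_measurable \<mu>"
  obtains F where "\<And>n. simple_function \<mu> (F n)" "\<And>x. x \<in> space \<mu> \<Longrightarrow> (\<lambda>n. F n x) \<longlonglongrightarrow> g x"
    "\<And>n x. x \<in> space \<mu> \<Longrightarrow> \<bar>F n x\<bar> \<le> 2 * \<bar>g x\<bar>"
proof -
  obtain F where "\<forall>n. simple_function \<mu> (F n)" "\<forall>x\<in>space \<mu>. (\<lambda>n. F n x) \<longlonglongrightarrow> g x"
    "\<forall>n. \<forall>x\<in>space \<mu>. dist (F n x) 0 \<le> 2 * dist (g x) 0"
    using borel_measurable_implies_sequence_metric[OF g, of 0] by blast
  then show ?thesis using that[of F] by (simp add: dist_real_def)
qed

text \<open>For a simple function the sum is a combination of counts, and a pointwise limit of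
  integrands passes through a finite sum. The value \<open>0\<close> in the definition of
  \<open>G\<close> matches the convention for infinite sums. The measure space \<open>N\<close> is
  arbitrary so that it may also be the completed \<sigma>-algebra of the counts.\<close>

lemma measurable_point_sum:
  fixes g :: "'b \<Rightarrow> real"
  assumes N: "\<And>D. D \<in> sets \<mu> \<Longrightarrow> point_count \<Xi> D \<in> borel_measurable N"
    and \<Xi>: "\<And>\<omega>. \<omega> \<in> space N \<Longrightarrow> \<Xi> \<omega> \<subseteq> space \<mu>"
    and g[measurable]: "g \<in> borel_measurable \<mu>" and W[measurable]: "W \<in> sets \<mu>"
  shows "(\<lambda>\<omega>. \<Sum>x\<in>\<Xi> \<omega> \<inter> W. g x) \<in> borel_measurable N"
proof -
  obtain F where F: "\<And>i. simple_function \<mu> (F i)" "\<And>x. x \<in> space \<mu> \<Longrightarrow> (\<lambda>i. F i x) \<longlonglongrightarrow> g x"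
    using borel_measurable_implies_sequence_metric[OF g, of 0] by auto
  have cells: "{x \<in> W. F i x = c} \<in> sets \<mu>" for i c
  proof -
    have "{x \<in> W. F i x = c} = W \<inter> {x \<in> space \<mu>. F i x = c}"
      using sets.sets_into_space[OF W] by auto
    then show ?thesis using borel_measurable_simple_function[OF F(1)[of i]] by simp
  qed
  define G where "G i \<omega> = (if point_count \<Xi> W \<omega> < \<infinity>
     then \<Sum>c\<in>F i ` space \<mu>. c * enn2real (point_count \<Xi> {x\<in>W. F i x = c} \<omega>) else 0)" for i \<omega>
  note [measurable] = N[OF W] N[OF cells]
  have Gm: "G i \<in> borel_measurable N" for i
    unfolding G_def by measurable
  show ?thesis
  proof (rule borel_measurable_LIMSEQ_real[OF _ Gm])
    fix \<omega> assume w: "\<omega> \<in> space N"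
    show "(\<lambda>i. G i \<omega>) \<longlonglongrightarrow> (\<Sum>x\<in>\<Xi> \<omega> \<inter> W. g x)"
    proof (cases "finite (\<Xi> \<omega> \<inter> W)")
      case True
      have "G i \<omega> = (\<Sum>x\<in>\<Xi> \<omega> \<inter> W. F i x)" for i
        using True point_count_less_top_iff[of \<Xi> W \<omega>] simple_functionD(1)[OF F(1)[of i]] \<Xi>[OF w]
        unfolding G_def by (subst sum_points_simple[where h = "F i" and c = "\<lambda>c. c"]) auto
      then show ?thesis using \<Xi>[OF w] by (auto intro!: tendsto_sum F(2))
    next
      case False
      then have "G i \<omega> = 0" for i
        using point_count_less_top_iff[of \<Xi> W \<omega>] unfolding G_def by auto
      then show ?thesis using False by simp
    qed
  qed
qed

text \<open>Constants are integrable on a set of finite measure, and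
  \<open>\<bar>y\<bar> \<le> 1 + y\<^sup>2\<close>. Applied to \<open>m\<close>, to \<nu> on tails
  and to the product measure, it makes compensators exist as soon as variances do.\<close>

lemma set_square_integrable_imp_integrable:
  fixes g :: "'b \<Rightarrow> real"
  assumes [measurable]: "g \<in> borel_measurable \<mu>" "E \<in> sets \<mu>" and f: "emeasure \<mu> E < \<infinity>"
    and sq: "set_integrable \<mu> E (\<lambda>x. (g x)\<^sup>2)"
  shows "set_integrable \<mu> E g"
  unfolding set_integrable_def
proof (rule Bochner_Integration.integrable_bound)
  show "integrable \<mu> (\<lambda>x. indicator E x + indicator E x *\<^sub>R (g x)\<^sup>2)"
    using sq f by (intro Bochner_Integration.integrable_add) (auto simp: set_integrable_def)
  show "AE x in \<mu>. norm (indicator E x *\<^sub>R g x) \<le> norm (indicator E x + indicator E x *\<^sub>R (g x)\<^sup>2)"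
  proof (rule AE_I2)
    fix x
    have "\<bar>g x\<bar> \<le> 1 + (g x)\<^sup>2"
      using zero_le_power2[of "\<bar>g x\<bar> - 1"] by (simp add: power2_diff)
    then show "norm (indicator E x *\<^sub>R g x) \<le> norm (indicator E x + indicator E x *\<^sub>R (g x)\<^sup>2)"
      by (auto simp: indicator_def)
  qed
qed simp

section \<open>Independence of point counts and the maximal inequality for compensated sums\<close>

context prob_space
begin

lemma poisson_random_setD:
  assumes "poisson_random_set M \<mu> \<Xi>"
  shows "D \<in> sets \<mu> \<Longrightarrow> poisson_var M (point_count \<Xi> D) (emeasure \<mu> D)"
    and "\<omega> \<in> space M \<Longrightarrow> \<Xi> \<omega> \<subseteq> space \<mu>"
    and "D \<in> sets \<mu> \<Longrightarrow> point_count \<Xi> D \<in> borel_measurable M"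
  using assms by (auto simp: poisson_random_set_def poisson_var_def)

lemma poisson_AE_finite:
  assumes "poisson_random_set M \<mu> \<Xi>" "D \<in> sets \<mu>" "emeasure \<mu> D < \<infinity>"
  shows "AE \<omega> in M. finite (\<Xi> \<omega> \<inter> D)"
  using poisson_var_AE_nat[OF poisson_random_setD(1)[OF assms(1,2)] assms(3)]
  by eventually_elim (auto simp: point_count_less_top_iff[symmetric] of_nat_less_top)

text \<open>The definition of a Poisson random set asserts independence for families indexed by an
  initial segment of the integers. An enumeration of \<open>X\<close> carries it over to an
  arbitrary finite index set, here the labels of a partition.\<close>

lemma poisson_random_set_indep:
  assumes p: "poisson_random_set M \<mu> \<Xi>" and fin: "finite X"
    and D: "\<And>y. y \<in> X \<Longrightarrow> D y \<in> sets \<mu>" "disjoint_family_on D X"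
  shows "indep_vars (\<lambda>_. borel) (\<lambda>y. point_count \<Xi> (D y)) X"
proof -
  obtain e n where e: "bij_betw e {..<n::nat} X"
    using ex_bij_betw_nat_finite[OF fin] by (metis atLeast0LessThan)
  define e' where "e' = inv_into {..<n} e"
  have e': "bij_betw e' X {..<n}" unfolding e'_def by (rule bij_betw_inv_into[OF e])
  have ee': "e (e' y) = y" if "y \<in> X" for y
    unfolding e'_def using that e by (simp add: bij_betw_inv_into_right)
  have eX: "e i \<in> X" if "i < n" for i using e that by (auto simp: bij_betw_def)
  have "disjoint_family_on (\<lambda>i. D (e i)) {..<n}"
    using D(2) e eX by (fastforce simp: disjoint_family_on_def bij_betw_def inj_on_def)
  then have ind: "indep_vars (\<lambda>_. borel) (\<lambda>i. point_count \<Xi> (D (e i))) {..<n}"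
    using p D(1) eX unfolding poisson_random_set_def
    by (elim conjE allE[where x = n] allE[where x = "\<lambda>i. D (e i)"] mp) auto
  then have iset: "indep_sets (\<lambda>i. {point_count \<Xi> (D (e i)) -` A \<inter> space M | A. A \<in> sets borel}) {..<n}"
    unfolding indep_vars_def2 by auto
  show ?thesis unfolding indep_vars_def2
  proof (intro conjI ballI)
    show "random_variable borel (point_count \<Xi> (D y))" if "y \<in> X" for y
      using poisson_random_setD(3)[OF p D(1)[OF that]] .
    show "indep_sets (\<lambda>y. {point_count \<Xi> (D y) -` A \<inter> space M | A. A \<in> sets borel}) X"
    proof (rule indep_setsI)
      fix y assume "y \<in> X" then show "{point_count \<Xi> (D y) -` A \<inter> space M | A. A \<in> sets borel} \<subseteq> events"
        using poisson_random_setD(3)[OF p D(1)] by (auto intro: measurable_sets)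
    next
      fix A J assume J: "J \<noteq> {}" "J \<subseteq> X" "finite J"
        and A: "\<forall>j\<in>J. A j \<in> {point_count \<Xi> (D j) -` A \<inter> space M | A. A \<in> sets borel}"
      have inj: "inj_on e' J" using e' J by (auto simp: bij_betw_def intro: inj_on_subset)
      have "prob (\<Inter>i\<in>e' ` J. A (e i)) = (\<Prod>i\<in>e' ` J. prob (A (e i)))"
        by (rule indep_setsD[OF iset]) (use J A ee' bij_betwE[OF e'] in auto)
      moreover have "(\<Inter>i\<in>e' ` J. A (e i)) = (\<Inter>j\<in>J. A j)"
        unfolding image_image using J ee' by (intro INF_cong) auto
      moreover have "(\<Prod>i\<in>e' ` J. prob (A (e i))) = (\<Prod>j\<in>J. prob (A j))"
        using J ee' by (subst prod.reindex[OF inj]) (auto intro!: prod.cong)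
      ultimately show "prob (\<Inter>j\<in>J. A j) = (\<Prod>j\<in>J. prob (A j))" by simp
    qed
  qed
qed

lemma compensated_sum_measurable:
  assumes p: "poisson_random_set M \<mu> \<Xi>" and g: "g \<in> borel_measurable \<mu>" "W \<in> sets \<mu>"
  shows "compensated_sum \<mu> \<Xi> g W \<in> borel_measurable M"
  unfolding compensated_sum_def
  by (intro borel_measurable_diff measurable_point_sum[where \<mu> = \<mu>])
     (use p g in \<open>auto dest: poisson_random_setD\<close>)

text \<open>The atoms of the partition of \<open>E\<close> generated by \<open>\<W>\<close> and the simple function \<open>F\<close> carry
  independent compensated counts.\<close>

lemma compensated_sum_maximal_simple:
  fixes F :: "'b \<Rightarrow> real" and \<phi> :: "'b \<Rightarrow> nat \<Rightarrow> nat"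
  assumes p: "poisson_random_set M \<mu> \<Xi>" and E[measurable]: "E \<in> sets \<mu>" and Efin: "emeasure \<mu> E < \<infinity>"
    and F: "simple_function \<mu> F" and fin: "finite \<W>"
    and \<W>: "\<And>W. W \<in> \<W> \<Longrightarrow> W \<in> sets \<mu>" "\<And>W. W \<in> \<W> \<Longrightarrow> W \<subseteq> E"
    and dim: "\<And>W x. W \<in> \<W> \<Longrightarrow> x \<in> E \<Longrightarrow> x \<in> W \<longleftrightarrow> (\<forall>i<d. \<phi> x i \<le> \<kappa> W i)"
    and l: "l > (0::real)"
  shows "prob {\<omega> \<in> space M. \<exists>W\<in>\<W>. \<bar>compensated_sum \<mu> \<Xi> F W \<omega>\<bar> > 2 ^ d * l}
    \<le> 2 ^ d * (LINT x:E|\<mu>. (F x)\<^sup>2) / l\<^sup>2"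
proof -
  \<comment> \<open>The label of a point records the value of \<open>F\<close> and the members of
    \<open>\<W>\<close> that contain it. On a cell of constant label, \<open>F\<close> contributes a
    fixed multiple of a compensated count.\<close>
  define h where "h x = (F x, {W\<in>\<W>. x \<in> W})" for x
  define X where "X = h ` E"
  define cell where "cell y = {x\<in>E. h x = y}" for y
  define Z where "Z y \<omega> = fst y * (enn2real (point_count \<Xi> (cell y) \<omega>) - measure \<mu> (cell y))" for y \<omega>
  have Esp: "E \<subseteq> space \<mu>" by (rule sets.sets_into_space[OF E])
  have X: "finite X"
  proof (rule finite_subset)
    show "X \<subseteq> F ` space \<mu> \<times> Pow \<W>" using Esp by (auto simp: X_def h_def)
    show "finite (F ` space \<mu> \<times> Pow \<W>)" using simple_functionD(1)[OF F] fin by auto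
  qed
  have cell[measurable]: "cell y \<in> sets \<mu>" for y
  proof -
    \<comment> \<open>A cell is a Boolean combination: the prescribed value of \<open>F\<close>,
      outside the members not listed in \<open>snd y\<close> and inside the listed ones. A label
      listing a set that is not in \<open>\<W>\<close> has an empty cell.\<close>
    have "cell y = (if snd y \<subseteq> \<W>
        then (E \<inter> (F -` {fst y} \<inter> space \<mu>)) - \<Union>(\<W> - snd y) - (\<Union>W\<in>\<W> \<inter> snd y. E - W) else {})"
      using Esp by (cases y) (auto simp: cell_def h_def)
    moreover have "\<Union>(\<W> - snd y) \<in> sets \<mu>"
      using fin \<W>(1) by (intro sets.finite_Union) auto
    moreover have "(\<Union>W\<in>\<W> \<inter> snd y. E - W) \<in> sets \<mu>"
      by (intro sets.finite_UN sets.Diff E) (use fin \<W>(1) in auto)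
    moreover have "F -` {fst y} \<inter> space \<mu> \<in> sets \<mu>" by (rule simple_functionD(2)[OF F])
    ultimately show ?thesis by simp
  qed
  have cellfin: "emeasure \<mu> (cell y) < \<infinity>" for y
    using Efin by (intro le_less_trans[OF emeasure_mono[of "cell y" E]]) (auto simp: cell_def)
  have pv: "poisson_var M (point_count \<Xi> (cell y)) (emeasure \<mu> (cell y))" for y
    by (rule poisson_random_setD(1)[OF p cell])
  note mom = poisson_var_moments[OF pv cellfin, folded measure_def]
  have indc: "indep_vars (\<lambda>_. borel) (\<lambda>y. point_count \<Xi> (cell y)) X"
    by (rule poisson_random_set_indep[OF p X cell]) (auto simp: disjoint_family_on_def cell_def)
  have ind: "indep_vars (\<lambda>_. borel) Z X"
    using indep_vars_compose2[OF indc, of "\<lambda>y c. fst y * (enn2real c - measure \<mu> (cell y))" "\<lambda>_. borel"]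
    by (simp add: Z_def[abs_def])
  have sqeq: "(Z y \<omega>)\<^sup>2 = (fst y)\<^sup>2 * (enn2real (point_count \<Xi> (cell y) \<omega>) - measure \<mu> (cell y))\<^sup>2" for y \<omega>
    by (simp add: Z_def power_mult_distrib)
  have Zsq: "integrable M (\<lambda>\<omega>. (Z y \<omega>)\<^sup>2)" for y unfolding sqeq using mom(3)[of y] by simp
  have Zc: "expectation (Z y) = 0" for y unfolding Z_def[abs_def] using mom(2)[of y] by simp
  have Zv: "expectation (\<lambda>\<omega>. (Z y \<omega>)\<^sup>2) = (fst y)\<^sup>2 * measure \<mu> (cell y)" for y
    unfolding sqeq using mom(4)[of y] by simp
  \<comment> \<open>The coordinates \<phi> need not be constant on a cell, but their comparisons
    with \<open>\<kappa> W\<close> are, since these only express membership in \<open>W\<close>. Any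
    representative of the cell may therefore supply its coordinates.\<close>
  define \<psi> where "\<psi> y = \<phi> (SOME x. x \<in> E \<and> h x = y)" for y
  have \<psi>: "(\<forall>i<d. \<psi> y i \<le> \<kappa> W i) \<longleftrightarrow> W \<in> snd y" if y: "y \<in> X" and W: "W \<in> \<W>" for y W
  proof -
    obtain x where "x \<in> E \<and> h x = y" using y by (auto simp: X_def)
    then have s: "(SOME x. x \<in> E \<and> h x = y) \<in> E \<and> h (SOME x. x \<in> E \<and> h x = y) = y"
      by (rule someI)
    have "(\<forall>i<d. \<psi> y i \<le> \<kappa> W i) \<longleftrightarrow> (SOME x. x \<in> E \<and> h x = y) \<in> W"
      unfolding \<psi>_def using dim[OF W] s by blast
    also have "\<dots> \<longleftrightarrow> W \<in> snd (h (SOME x. x \<in> E \<and> h x = y))" using that by (simp add: h_def)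
    finally show ?thesis using s by simp
  qed
  have ic: "c * indicator (cell y) x = (if y = h x then if x \<in> E then c else 0 else 0)" for c :: real and x y
    by (auto simp: cell_def)
  have int: "(LINT x:W|\<mu>. G (F x)) = (\<Sum>y\<in>{y\<in>X. W \<in> snd y}. G (fst y) * measure \<mu> (cell y))"
    if W: "W \<in> \<W>" for W and G :: "real \<Rightarrow> real"
  proof -
    have "h x \<in> {y\<in>X. W \<in> snd y} \<longleftrightarrow> x \<in> W" if "x \<in> E" for x
      using W that by (auto simp: X_def h_def)
    then have "indicator W x *\<^sub>R G (F x) = (\<Sum>y\<in>{y\<in>X. W \<in> snd y}. G (fst y) * indicator (cell y) x)" for x
      unfolding ic using X \<W>(2)[OF W] by (cases "x \<in> E") (auto simp: sum.delta h_def indicator_def)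
    then show ?thesis unfolding set_lebesgue_integral_def
      using cellfin by (simp add: less_top[symmetric])
  qed
  have intE: "(LINT x:E|\<mu>. (F x)\<^sup>2) = (\<Sum>y\<in>X. (fst y)\<^sup>2 * measure \<mu> (cell y))"
  proof -
    have "h x \<in> X" if "x \<in> E" for x using that by (auto simp: X_def)
    then have "indicator E x *\<^sub>R (F x)\<^sup>2 = (\<Sum>y\<in>X. (fst y)\<^sup>2 * indicator (cell y) x)" for x
      unfolding ic using X by (cases "x \<in> E") (auto simp: sum.delta h_def)
    then show ?thesis unfolding set_lebesgue_integral_def
      using cellfin by (simp add: less_top[symmetric])
  qed
  \<comment> \<open>Grouping the points requires finitely many of them in \<open>E\<close>, so the
    identity is claimed only there; this is an almost sure event.\<close>
  have comp: "compensated_sum \<mu> \<Xi> F W \<omega> = (\<Sum>y\<in>{y\<in>X. \<forall>i<d. \<psi> y i \<le> \<kappa> W i}. Z y \<omega>)"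
    if W: "W \<in> \<W>" and f: "finite (\<Xi> \<omega> \<inter> E)" for W \<omega>
  proof -
    have "(\<Sum>x\<in>\<Xi> \<omega> \<inter> W. F x) = (\<Sum>y\<in>{y\<in>X. W \<in> snd y}. fst y * enn2real (point_count \<Xi> {x\<in>W. h x = y} \<omega>))"
      using X \<W>(2)[OF W] W f
      by (intro sum_points_simple) (auto simp: X_def h_def intro: rev_finite_subset[OF f])
    also have "\<dots> = (\<Sum>y\<in>{y\<in>X. W \<in> snd y}. fst y * enn2real (point_count \<Xi> (cell y) \<omega>))"
    proof (intro sum.cong refl arg_cong2[where f = "(*)"] arg_cong[where f = enn2real] arg_cong2[where f = "point_count \<Xi>"])
      fix y assume "y \<in> {y\<in>X. W \<in> snd y}"
      then show "{x\<in>W. h x = y} = cell y" using \<W>(2)[OF W] by (auto simp: cell_def h_def)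
    qed
    finally have "compensated_sum \<mu> \<Xi> F W \<omega> = (\<Sum>y\<in>{y\<in>X. W \<in> snd y}. Z y \<omega>)"
      unfolding compensated_sum_def int[OF W, of "\<lambda>x. x"] Z_def
      by (simp add: sum_subtractf right_diff_distrib)
    moreover have "{y\<in>X. W \<in> snd y} = {y\<in>X. \<forall>i<d. \<psi> y i \<le> \<kappa> W i}" using \<psi> W by auto
    ultimately show ?thesis by simp
  qed
  have Zm[measurable]: "Z y \<in> borel_measurable M" for y
    using poisson_random_setD(3)[OF p cell[of y]] unfolding Z_def[abs_def] by measurable
  have "prob {\<omega> \<in> space M. \<exists>W\<in>\<W>. \<bar>compensated_sum \<mu> \<Xi> F W \<omega>\<bar> > 2 ^ d * l}
    \<le> prob {\<omega> \<in> space M. \<exists>k\<in>\<kappa> ` \<W>. \<bar>\<Sum>y\<in>{y\<in>X. \<forall>i<d. \<psi> y i \<le> k i}. Z y \<omega>\<bar> > 2 ^ d * l}"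
  proof (rule finite_measure_mono_AE)
    show "AE \<omega> in M. \<omega> \<in> {\<omega> \<in> space M. \<exists>W\<in>\<W>. \<bar>compensated_sum \<mu> \<Xi> F W \<omega>\<bar> > 2 ^ d * l} \<longrightarrow>
       \<omega> \<in> {\<omega> \<in> space M. \<exists>k\<in>\<kappa> ` \<W>. \<bar>\<Sum>y\<in>{y\<in>X. \<forall>i<d. \<psi> y i \<le> k i}. Z y \<omega>\<bar> > 2 ^ d * l}"
      using poisson_AE_finite[OF p E Efin] by eventually_elim (auto simp: comp)
    show "{\<omega> \<in> space M. \<exists>k\<in>\<kappa> ` \<W>. \<bar>\<Sum>y\<in>{y\<in>X. \<forall>i<d. \<psi> y i \<le> k i}. Z y \<omega>\<bar> > 2 ^ d * l} \<in> events"
      using countable_finite[OF finite_imageI[OF fin, of \<kappa>]] by measurable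
  qed
  also have "\<dots> \<le> 2 ^ d * (\<Sum>y\<in>X. expectation (\<lambda>\<omega>. (Z y \<omega>)\<^sup>2)) / l\<^sup>2"
    by (rule ottaviani_multiparameter) (use X fin ind Zsq Zc l in auto)
  finally show ?thesis by (simp add: Zv intE)
qed

text \<open>The event is defined by a strict inequality, so a point of it lies in the corresponding
  events of all sufficiently late simple approximations. Their probabilities obey the bound for
  simple functions, and the squared integrals converge under the dominating function 4 times the
  square of \<open>g\<close>.\<close>

lemma compensated_sum_maximal:
  fixes g :: "'b \<Rightarrow> real" and \<phi> :: "'b \<Rightarrow> nat \<Rightarrow> nat"
  assumes p: "poisson_random_set M \<mu> \<Xi>" and E[measurable]: "E \<in> sets \<mu>" and Efin: "emeasure \<mu> E < \<infinity>"
    and g[measurable]: "g \<in> borel_measurable \<mu>" and sq: "set_integrable \<mu> E (\<lambda>x. (g x)\<^sup>2)"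
    and fin: "finite \<W>"
    and \<W>: "\<And>W. W \<in> \<W> \<Longrightarrow> W \<in> sets \<mu>" "\<And>W. W \<in> \<W> \<Longrightarrow> W \<subseteq> E"
    and dim: "\<And>W x. W \<in> \<W> \<Longrightarrow> x \<in> E \<Longrightarrow> x \<in> W \<longleftrightarrow> (\<forall>i<d. \<phi> x i \<le> \<kappa> W i)"
    and l: "l > (0::real)"
  shows "prob {\<omega> \<in> space M. \<exists>W\<in>\<W>. \<bar>compensated_sum \<mu> \<Xi> g W \<omega>\<bar> > 2 ^ d * l}
    \<le> 2 ^ d * (LINT x:E|\<mu>. (g x)\<^sup>2) / l\<^sup>2"
proof -
  let ?v = "2 ^ d * (LINT x:E|\<mu>. (g x)\<^sup>2) / l\<^sup>2"
  obtain F where F: "\<And>n. simple_function \<mu> (F n)" "\<And>x. x \<in> space \<mu> \<Longrightarrow> (\<lambda>n. F n x) \<longlonglongrightarrow> g x"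
    "\<And>n x. x \<in> space \<mu> \<Longrightarrow> \<bar>F n x\<bar> \<le> 2 * \<bar>g x\<bar>"
    by (rule simple_function_approximation[OF g that])
  note [measurable] = borel_measurable_simple_function[OF F(1)]
  have Esp: "E \<subseteq> space \<mu>" by (rule sets.sets_into_space[OF E])
  have gi: "set_integrable \<mu> E g" by (rule set_square_integrable_imp_integrable[OF g E Efin sq])
  define C where "C f = {\<omega> \<in> space M. \<exists>W\<in>\<W>. \<bar>compensated_sum \<mu> \<Xi> f W \<omega>\<bar> > 2 ^ d * l}" for f
  have C[measurable]: "C f \<in> events" if f: "f \<in> borel_measurable \<mu>" for f
  proof -
    have "C f = (\<Union>W\<in>\<W>. {\<omega> \<in> space M. \<bar>compensated_sum \<mu> \<Xi> f W \<omega>\<bar> > 2 ^ d * l})" by (auto simp: C_def)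
    moreover have "{\<omega> \<in> space M. \<bar>compensated_sum \<mu> \<Xi> f W \<omega>\<bar> > 2 ^ d * l} \<in> events" if "W \<in> \<W>" for W
      using compensated_sum_measurable[OF p f \<W>(1)[OF that]] by measurable
    ultimately show ?thesis using fin by auto
  qed
  define D where "D n = (\<Inter>k\<in>{n..}. C (F k))" for n
  have D: "D n \<in> events" for n unfolding D_def by (intro sets.countable_INT') auto
  have conv: "(\<lambda>n. compensated_sum \<mu> \<Xi> (F n) W \<omega>) \<longlonglongrightarrow> compensated_sum \<mu> \<Xi> g W \<omega>"
    if "W \<in> \<W>" "\<omega> \<in> space M" for W \<omega>
    unfolding compensated_sum_def
  proof (intro tendsto_diff tendsto_sum)
    show "(\<lambda>n. F n x) \<longlonglongrightarrow> g x" if "x \<in> \<Xi> \<omega> \<inter> W" for x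
      using F(2) poisson_random_setD(2)[OF p \<open>\<omega> \<in> space M\<close>] that by auto
    note [measurable] = \<W>(1)[OF \<open>W \<in> \<W>\<close>]
    show "(\<lambda>n. LINT x:W|\<mu>. F n x) \<longlonglongrightarrow> (LINT x:W|\<mu>. g x)"
      unfolding set_lebesgue_integral_def
    proof (rule integral_dominated_convergence)
      show "integrable \<mu> (\<lambda>x. 2 * norm (indicator E x *\<^sub>R g x))"
        using gi unfolding set_integrable_def by (intro integrable_mult_right integrable_norm)
      show "AE x in \<mu>. norm (indicator W x *\<^sub>R F n x) \<le> 2 * norm (indicator E x *\<^sub>R g x)" for n
        using F(3) \<W>(2)[OF \<open>W \<in> \<W>\<close>] by (intro AE_I2) (auto simp: indicator_def)
    qed (use F(2) in \<open>auto intro!: AE_I2 tendsto_intros\<close>)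
  qed
  have sub: "C g \<subseteq> (\<Union>n. D n)"
  proof
    fix \<omega> assume "\<omega> \<in> C g"
    then obtain W where W: "W \<in> \<W>" "\<omega> \<in> space M" "\<bar>compensated_sum \<mu> \<Xi> g W \<omega>\<bar> > 2 ^ d * l"
      by (auto simp: C_def)
    have "eventually (\<lambda>n. \<bar>compensated_sum \<mu> \<Xi> (F n) W \<omega>\<bar> > 2 ^ d * l) sequentially"
      by (rule order_tendstoD(1)[OF tendsto_rabs[OF conv[OF W(1,2)]] W(3)])
    then show "\<omega> \<in> (\<Union>n. D n)" using W by (auto simp: eventually_sequentially D_def C_def)
  qed
  have lim: "(\<lambda>n. 2 ^ d * (LINT x:E|\<mu>. (F n x)\<^sup>2) / l\<^sup>2) \<longlonglongrightarrow> ?v"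
    unfolding set_lebesgue_integral_def
  proof (intro tendsto_divide tendsto_mult tendsto_const integral_dominated_convergence[where w = "\<lambda>x. 4 * (indicator E x *\<^sub>R (g x)\<^sup>2)"])
    show "integrable \<mu> (\<lambda>x. 4 * (indicator E x *\<^sub>R (g x)\<^sup>2))"
      using sq unfolding set_integrable_def by (intro integrable_mult_right)
    show "AE x in \<mu>. norm (indicator E x *\<^sub>R (F n x)\<^sup>2) \<le> 4 * (indicator E x *\<^sub>R (g x)\<^sup>2)" for n
    proof (rule AE_I2)
      fix x assume "x \<in> space \<mu>"
      then have "\<bar>F n x\<bar>\<^sup>2 \<le> (2 * \<bar>g x\<bar>)\<^sup>2" by (intro power_mono F(3)) auto
      then show "norm (indicator E x *\<^sub>R (F n x)\<^sup>2) \<le> 4 * (indicator E x *\<^sub>R (g x)\<^sup>2)"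
        by (auto simp: indicator_def power_mult_distrib)
    qed
  qed (use l F(2) in \<open>auto intro!: AE_I2 tendsto_intros\<close>)
  have le: "prob (D n) \<le> ?v" for n
  proof (rule LIMSEQ_le_const[OF lim], intro exI allI impI)
    fix k assume "n \<le> k"
    then have "prob (D n) \<le> prob (C (F k))" by (intro finite_measure_mono) (auto simp: D_def)
    also have "\<dots> \<le> 2 ^ d * (LINT x:E|\<mu>. (F k x)\<^sup>2) / l\<^sup>2"
      unfolding C_def by (rule compensated_sum_maximal_simple[OF p E Efin F(1) fin \<W> dim l])
    finally show "prob (D n) \<le> 2 ^ d * (LINT x:E|\<mu>. (F k x)\<^sup>2) / l\<^sup>2" .
  qed
  have "(\<lambda>n. prob (D n)) \<longlonglongrightarrow> prob (\<Union>n. D n)"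
    by (rule finite_Lim_measure_incseq) (use D in \<open>auto simp: incseq_def D_def\<close>)
  then have "prob (\<Union>n. D n) \<le> ?v"
    by (rule LIMSEQ_le_const2) (use le in auto)
  moreover have "prob (C g) \<le> prob (\<Union>n. D n)"
    using sub D by (intro finite_measure_mono) auto
  ultimately show ?thesis unfolding C_def by simp
qed

end

section \<open>Coordinates on an indexing collection\<close>

lemma indexing_collectionD:
  assumes "indexing_collection T \<A> \<A>s"
  shows "\<A> \<subseteq> Pow T" "{} \<in> \<A>"
    and "finite (\<A>s n)" "\<A>s n \<subseteq> \<A>" "A \<in> \<A>s n \<Longrightarrow> A' \<in> \<A>s n \<Longrightarrow> A \<inter> A' \<in> \<A>s n"
    and "incseq \<A>s"
    and "A \<in> \<A> \<Longrightarrow> A = (\<Inter>n. outer_approx T (\<A>s n) A)"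
    and "t \<in> T \<Longrightarrow> tip_set T \<A>s t \<in> \<A>"
    and "A \<in> \<A> \<Longrightarrow> A' \<in> \<A> \<Longrightarrow> A \<inter> A' \<in> \<A>"
proof -
  note ic = assms[unfolded indexing_collection_def]
  show "\<A> \<subseteq> Pow T" "{} \<in> \<A>" "finite (\<A>s n)" "\<A>s n \<subseteq> \<A>" "incseq \<A>s"
    using ic by simp_all
  show "A \<in> \<A>s n \<Longrightarrow> A' \<in> \<A>s n \<Longrightarrow> A \<inter> A' \<in> \<A>s n"
    using ic by (elim conjE) meson
  show "A \<in> \<A> \<Longrightarrow> A = (\<Inter>n. outer_approx T (\<A>s n) A)"
    using ic by (elim conjE) (drule bspec, assumption+)
  have "tip_set T \<A>s ` T = \<A> - {{}}" using ic unfolding bij_betw_def by (elim conjE)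
  then show "t \<in> T \<Longrightarrow> tip_set T \<A>s t \<in> \<A>" by blast
  have cl: "range F \<subseteq> \<A> \<Longrightarrow> (\<Inter>k. F k) \<in> \<A>" for F :: "nat \<Rightarrow> 'a set"
    using ic by (elim conjE) (erule allE, erule mp)
  show "A \<inter> A' \<in> \<A>" if "A \<in> \<A>" "A' \<in> \<A>"
  proof -
    have "(\<Inter>k::nat. if k = 0 then A else A') \<in> \<A>" using that by (intro cl) auto
    moreover have "(\<Inter>k::nat. if k = 0 then A else A') = A \<inter> A'" by (auto split: if_splits)
    ultimately show ?thesis by simp
  qed
qed

lemma finite_Int_closed_Inter:
  assumes "finite F" "F \<noteq> {}" "F \<subseteq> S" "\<And>A B. A \<in> S \<Longrightarrow> B \<in> S \<Longrightarrow> A \<inter> B \<in> S"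
  shows "\<Inter>F \<in> S"
  using assms(1-3) by (induction F rule: finite_ne_induct) (auto intro: assms(4))

text \<open>Both approximations are intersections over a nonempty subfamily of
  \<open>insert T (\<A>s n)\<close>, which is finite and closed under intersections.\<close>

lemma
  assumes ic: "indexing_collection T \<A> \<A>s"
  shows tip_approx_mem: "t \<in> T \<Longrightarrow> tip_approx T (\<A>s n) t \<in> insert T (\<A>s n)"
    and outer_approx_mem: "A \<subseteq> T \<Longrightarrow> outer_approx T (\<A>s n) A \<in> insert T (\<A>s n)"
proof -
  have fin: "finite (insert T (\<A>s n))" using indexing_collectionD(3)[OF ic] by simp
  have T: "A \<subseteq> T" if "A \<in> \<A>s n" for A using indexing_collectionD(1,4)[OF ic] that by blast
  have cl: "A \<inter> B \<in> insert T (\<A>s n)" if "A \<in> insert T (\<A>s n)" "B \<in> insert T (\<A>s n)" for A B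
    using that indexing_collectionD(5)[OF ic, of A n B] T[of A] T[of B]
    by (auto simp: Int_absorb1 Int_absorb2)
  have *: "\<Inter>F \<in> insert T (\<A>s n)" if "F \<subseteq> insert T (\<A>s n)" "F \<noteq> {}" for F
    using finite_Int_closed_Inter[OF finite_subset[OF that(1) fin] that(2,1)] cl by blast
  show "tip_approx T (\<A>s n) t \<in> insert T (\<A>s n)" if "t \<in> T"
    unfolding tip_approx_def using that by (intro *) auto
  show "outer_approx T (\<A>s n) A \<in> insert T (\<A>s n)" if "A \<subseteq> T"
    unfolding outer_approx_def using that by (intro *) auto
qed

text \<open>The coordinates of a point are those of its tip \<open>tip_approx T (\<A>s n) t\<close>; when \<open>T\<close>
  is not in \<open>\<A>s n\<close> it is added as a largest element.\<close>

lemma finite_dimensional_coordinates: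
  assumes ic: "indexing_collection T \<A> \<A>s" and fd: "finite_dimensional \<A> \<A>s"
  obtains p where "\<And>n. \<exists>(\<phi> :: 'a \<Rightarrow> nat \<Rightarrow> nat) \<kappa>. \<forall>A\<in>insert T (\<A>s n). \<forall>t\<in>T.
    t \<in> A \<longleftrightarrow> (\<forall>i<p. \<phi> t i \<le> \<kappa> A i)"
proof -
  from fd obtain p where p: "p \<ge> 1" and emb: "\<And>n. \<exists>\<phi> :: 'a set \<Rightarrow> nat \<Rightarrow> nat.
     \<forall>A\<in>\<A>s n. \<forall>A'\<in>\<A>s n. A \<subseteq> A' \<longleftrightarrow> (\<forall>i<p. \<phi> A i \<le> \<phi> A' i)"
    unfolding finite_dimensional_def by (elim exE conjE) (erule that, erule spec)
  have "\<exists>(\<phi> :: 'a \<Rightarrow> nat \<Rightarrow> nat) \<kappa>. \<forall>A\<in>insert T (\<A>s n). \<forall>t\<in>T.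
    t \<in> A \<longleftrightarrow> (\<forall>i<p. \<phi> t i \<le> \<kappa> A i)" for n
  proof -
    from emb[of n] obtain \<phi> :: "'a set \<Rightarrow> nat \<Rightarrow> nat" where
      "\<forall>A\<in>\<A>s n. \<forall>A'\<in>\<A>s n. A \<subseteq> A' \<longleftrightarrow> (\<forall>i<p. \<phi> A i \<le> \<phi> A' i)"
      by (elim exE)
    then have \<phi>: "A \<subseteq> A' \<longleftrightarrow> (\<forall>i<p. \<phi> A i \<le> \<phi> A' i)" if "A \<in> \<A>s n" "A' \<in> \<A>s n" for A A'
      using that by (elim ballE) auto
    \<comment> \<open>\<open>N\<close> lies above every coordinate in use, so the constant
      \<open>N\<close> can serve as the position of \<open>T\<close>. Because
      \<open>p \<ge> 1\<close> there is a coordinate in which this position is strictly above that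
      of each member of \<open>\<A>s n\<close>.\<close>
    have "finite ((\<lambda>(A, i). \<phi> A i) ` (\<A>s n \<times> {..<p}))" using indexing_collectionD(3)[OF ic] by simp
    then obtain N where "\<forall>y\<in>(\<lambda>(A, i). \<phi> A i) ` (\<A>s n \<times> {..<p}). y < N"
      using finite_nat_set_iff_bounded by blast
    then have N: "\<phi> A i < N" if "A \<in> \<A>s n" "i < p" for A i using that by auto
    define \<kappa> where "\<kappa> A = (if A \<in> \<A>s n then \<phi> A else (\<lambda>_. N))" for A
    have "t \<in> A \<longleftrightarrow> (\<forall>i<p. \<kappa> (tip_approx T (\<A>s n) t) i \<le> \<kappa> A i)"
      if A: "A \<in> insert T (\<A>s n)" and t: "t \<in> T" for A t
    proof -
      let ?B = "tip_approx T (\<A>s n) t"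
      have B: "?B \<in> insert T (\<A>s n)" by (rule tip_approx_mem[OF ic t])
      have "t \<in> ?B" using t by (auto simp: tip_approx_def)
      \<comment> \<open>The tip is the smallest set of the level that contains \<open>t\<close>, so
        membership becomes inclusion, which the embedding expresses through coordinates.\<close>
      then have tA: "t \<in> A \<longleftrightarrow> ?B \<subseteq> A" using A by (auto simp: tip_approx_def)
      show ?thesis
      proof (cases "A \<in> \<A>s n")
        case An: True
        show ?thesis
        proof (cases "?B \<in> \<A>s n")
          case True
          then have "\<kappa> ?B = \<phi> ?B" "\<kappa> A = \<phi> A" using An by (simp_all only: \<kappa>_def if_True)
          then show ?thesis using trans[OF tA \<phi>[OF True An]] by (simp only:)
        next
          case False
          then have "?B = T" using B by simp
          moreover have "A \<subseteq> T" using An indexing_collectionD(1,4)[OF ic] by blast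
          ultimately have "t \<notin> A" using tA An False by (metis subset_antisym)
          moreover have "\<not> (\<forall>i<p. \<kappa> ?B i \<le> \<kappa> A i)"
          proof -
            have "\<kappa> ?B = (\<lambda>_. N)" "\<kappa> A = \<phi> A" using False An by (simp_all only: \<kappa>_def if_True if_False)
            moreover have "\<not> (\<forall>i<p. N \<le> \<phi> A i)" using N[OF An, of 0] p by (auto simp: Suc_le_eq)
            ultimately show ?thesis by (simp only: not_False_eq_True)
          qed
          ultimately show ?thesis by simp
        qed
      next
        case False
        then have "A = T" using A by simp
        moreover have "\<kappa> ?B i \<le> N" if "i < p" for i
          using N[OF _ that, of ?B] by (cases "?B \<in> \<A>s n") (simp_all only: \<kappa>_def if_True if_False less_imp_le order.refl)
        moreover have "\<kappa> A = (\<lambda>_. N)" using False by (simp only: \<kappa>_def if_False)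
        ultimately show ?thesis using t by (simp only:) blast
      qed
    qed
    then show ?thesis
      by (intro exI[of _ "\<lambda>t. \<kappa> (tip_approx T (\<A>s n) t)"] exI[of _ \<kappa>] ballI)
  qed
  then show ?thesis by (rule that)
qed

text \<open>The outer approximations decrease with \<open>n\<close> and have intersection
  \<open>A\<close>, so membership of a fixed point stabilises. This pointwise form is what finite
  sums and dominated convergence need.\<close>

lemma outer_approx_eventually:
  assumes ic: "indexing_collection T \<A> \<A>s" and A: "A \<in> \<A>"
  shows "\<forall>\<^sub>F n in sequentially. t \<in> outer_approx T (\<A>s n) A \<longleftrightarrow> t \<in> A"
proof (cases "t \<in> A")
  case True
  then show ?thesis by (intro always_eventually allI) (auto simp: outer_approx_def)
next
  case False
  then obtain n where n: "t \<notin> outer_approx T (\<A>s n) A"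
    using indexing_collectionD(7)[OF ic A] by auto
  have "outer_approx T (\<A>s k) A \<subseteq> outer_approx T (\<A>s n) A" if "n \<le> k" for k
    using incseqD[OF indexing_collectionD(6)[OF ic] that] by (auto simp: outer_approx_def)
  then have "t \<notin> outer_approx T (\<A>s k) A" if "n \<le> k" for k using n that by blast
  then show ?thesis using False by (auto simp: eventually_sequentially)
qed

text \<open>A point outside every set of every \<open>\<A>s n\<close> would have tip
  \<open>T\<close>, and tips belong to \<A>. So either \<open>T\<close> itself has finite measure,
  or the countably many sets of the approximating levels cover it.\<close>

lemma indexing_collection_sigma_finite:
  assumes ic: "indexing_collection T \<A> \<A>s" and m: "space m = T" "\<A> \<subseteq> sets m"
    and fin: "\<And>A. A \<in> \<A> \<Longrightarrow> emeasure m A < \<infinity>"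
  shows "sigma_finite_measure m"
proof
  show "\<exists>S. countable S \<and> S \<subseteq> sets m \<and> \<Union>S = space m \<and> (\<forall>a\<in>S. emeasure m a \<noteq> \<infinity>)"
  proof (cases "T \<in> \<A>")
    case True
    then show ?thesis using m fin[OF True] by (intro exI[of _ "{T}"]) auto
  next
    case False
    have sub: "(\<Union>n. \<A>s n) \<subseteq> \<A>" using indexing_collectionD(4)[OF ic] by blast
    have "\<Union>(\<Union>n. \<A>s n) = T"
    proof (intro equalityI subsetI)
      fix t assume t: "t \<in> T"
      show "t \<in> \<Union>(\<Union>n. \<A>s n)"
      proof (rule ccontr)
        assume "t \<notin> \<Union>(\<Union>n. \<A>s n)"
        then have "{A \<in> \<A>s n \<union> {T}. t \<in> A} = {T}" for n using t by auto
        then have "tip_set T \<A>s t = T" by (simp add: tip_set_def tip_approx_def)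
        then show False using indexing_collectionD(8)[OF ic t] False by simp
      qed
    qed (use sub indexing_collectionD(1)[OF ic] in blast)
    moreover have "countable (\<Union>n. \<A>s n)"
      using indexing_collectionD(3)[OF ic] by (auto intro: countable_finite)
    moreover have "emeasure m a \<noteq> \<infinity>" if "a \<in> (\<Union>n. \<A>s n)" for a
      using fin[OF subsetD[OF sub that]] by simp
    ultimately show ?thesis using m sub by (intro exI[of _ "\<Union>n. \<A>s n"] conjI ballI) auto
  qed
qed

section \<open>Product integrals and an induction principle for functions restricted to a set of the
  collection\<close>

lemma (in pair_sigma_finite)
  fixes u :: "'a \<Rightarrow> real" and v :: "'b \<Rightarrow> real"
  assumes u: "integrable M1 u" and v: "integrable M2 v"
  shows integrable_prod_mult: "integrable (M1 \<Otimes>\<^sub>M M2) (\<lambda>(t, x). u t * v x)"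
    and integral_prod_mult: "(LINT z|(M1 \<Otimes>\<^sub>M M2). (case z of (t, x) \<Rightarrow> u t * v x)) = (LINT t|M1. u t) * (LINT x|M2. v x)"
proof -
  have [measurable]: "u \<in> borel_measurable M1" "v \<in> borel_measurable M2" using u v by auto
  show i: "integrable (M1 \<Otimes>\<^sub>M M2) (\<lambda>(t, x). u t * v x)"
  proof (rule Fubini_integrable)
    show "integrable M1 (\<lambda>x. \<integral>y. norm (case (x, y) of (t, x) \<Rightarrow> u t * v x) \<partial>M2)"
      using u by (simp add: abs_mult)
    show "AE x in M1. integrable M2 (\<lambda>y. case (x, y) of (t, x) \<Rightarrow> u t * v x)"
      using v by simp
  qed measurable
  show "(LINT z|(M1 \<Otimes>\<^sub>M M2). (case z of (t, x) \<Rightarrow> u t * v x)) = (LINT t|M1. u t) * (LINT x|M2. v x)"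
    using integral_fst'[OF i] by simp
qed

text \<open>Convergence and domination hold everywhere on the space, as increasing indicators and
  simple approximations provide. Integrability of \<open>h\<close> is deliberately left out: it is
  supplied by membership in L(X) or in the square integrable functions, depending on the
  use.\<close>

definition dominated_limit ::
    "'a measure \<Rightarrow> (nat \<Rightarrow> 'a \<Rightarrow> real) \<Rightarrow> ('a \<Rightarrow> real) \<Rightarrow> ('a \<Rightarrow> real) \<Rightarrow> bool" where
  "dominated_limit m G g h \<longleftrightarrow> (\<forall>n. G n \<in> borel_measurable m) \<and> g \<in> borel_measurable m \<and>
    (\<forall>t\<in>space m. (\<lambda>n. G n t) \<longlonglongrightarrow> g t) \<and> (\<forall>n. \<forall>t\<in>space m. \<bar>G n t\<bar> \<le> h t)"

lemma dominated_limitD: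
  assumes "dominated_limit m G g h"
  shows "G n \<in> borel_measurable m" "g \<in> borel_measurable m"
    and "t \<in> space m \<Longrightarrow> (\<lambda>n. G n t) \<longlonglongrightarrow> g t" "t \<in> space m \<Longrightarrow> \<bar>G n t\<bar> \<le> h t"
    and "t \<in> space m \<Longrightarrow> \<bar>g t\<bar> \<le> h t"
proof -
  show "G n \<in> borel_measurable m" "g \<in> borel_measurable m"
    using assms by (auto simp: dominated_limit_def)
  assume t: "t \<in> space m"
  show lim: "(\<lambda>n. G n t) \<longlonglongrightarrow> g t" and le: "\<bar>G n t\<bar> \<le> h t" for n
    using assms t by (auto simp: dominated_limit_def)
  show "\<bar>g t\<bar> \<le> h t"
    by (rule LIMSEQ_le_const2[OF tendsto_rabs[OF lim]]) (use le in auto)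
qed

text \<open>A \<open>\<pi>\<close>-\<open>\<lambda>\<close> argument followed by approximation by simple functions.\<close>

lemma localized_function_induct:
  fixes Q :: "('a \<Rightarrow> real) \<Rightarrow> bool"
  assumes sets: "sets m = sigma_sets T \<A>" and sp: "space m = T"
    and Int: "\<And>A A'. A \<in> \<A> \<Longrightarrow> A' \<in> \<A> \<Longrightarrow> A \<inter> A' \<in> \<A>"
    and A: "A \<in> \<A>" and f[measurable]: "f \<in> borel_measurable m"
    and ind: "\<And>A'. A' \<in> \<A> \<Longrightarrow> A' \<subseteq> A \<Longrightarrow> Q (indicator A')"
    and lin: "\<And>g h c d. Q g \<Longrightarrow> Q h \<Longrightarrow> Q (\<lambda>t. c * g t + d * h t)"
    and lim: "\<And>g G h. \<lbrakk>\<And>n. Q (G n); dominated_limit m G g h;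
      h = indicator A \<or> h = (\<lambda>t. 2 * \<bar>f t * indicator A t\<bar>)\<rbrakk> \<Longrightarrow> Q g"
  shows "Q (\<lambda>t. f t * indicator A t)"
proof -
  have \<A>: "\<A> \<subseteq> Pow T"
    using sets sets.space_closed[of m] sp by (auto intro: sigma_sets.Basic)
  have Am[measurable]: "A \<in> sets m" unfolding sets using A by (rule sigma_sets.Basic)
  have Q0: "Q (\<lambda>t. 0)" using lin[OF ind[OF A] ind[OF A], of 0 0] by simp
  have indD: "Q (indicator (D \<inter> A))" if "D \<in> sets m" for D
  proof -
    have "Int_stable \<A>" using Int by (auto simp: Int_stable_def)
    then show ?thesis using \<A> that[unfolded sets]
    proof (induction rule: sigma_sets_induct_disjoint)
      case (basic D) then show ?case using Int[OF _ A] by (intro ind) auto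
    next
      case empty
      have "indicator ({} \<inter> A) = (\<lambda>t. 0 :: real)" by auto
      then show ?case using Q0 by simp
    next
      case (compl D)
      have "(\<lambda>t. 1 * indicator A t + (- 1) * indicator (D \<inter> A) t) = (indicator ((T - D) \<inter> A) :: _ \<Rightarrow> real)"
        using A \<A> by (auto simp: indicator_def fun_eq_iff)
      then show ?case using lin[OF ind[OF A] compl(2), of 1 "-1"] by simp
    next
      case (union D)
      have Dm: "D n \<in> sets m" for n using union by (auto simp: sets)
      define G where "G n = (\<lambda>t. \<Sum>i<n. indicator (D i \<inter> A) t :: real)" for n
      have G: "Q (G n)" for n
      proof (induction n)
        case 0 then show ?case using Q0 by (simp add: G_def)
      next
        case (Suc n)
        show ?case using lin[OF Suc union(3)[of n], of 1 1] by (simp add: G_def)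
      qed
      have Geq: "G n t = indicator ((\<Union>i<n. D i) \<inter> A) t" for n t
      proof -
        have "indicator (\<Union>i<n. D i \<inter> A) t = G n t"
          unfolding G_def using union(1)
          by (intro indicator_UN_disjoint) (auto simp: disjoint_family_on_def)
        moreover have "(\<Union>i<n. D i \<inter> A) = (\<Union>i<n. D i) \<inter> A" by auto
        ultimately show ?thesis by simp
      qed
      show ?case
      proof (rule lim[of G _ "indicator A"], rule G, unfold dominated_limit_def, intro conjI allI ballI)
        show "(\<lambda>n. G n t) \<longlonglongrightarrow> indicator ((\<Union>i. D i) \<inter> A) t" for t
        proof -
          have "(\<Union>n. (\<Union>i<n. D i) \<inter> A) = (\<Union>i. D i) \<inter> A" by (auto intro: lessI)
          moreover have "(\<lambda>n. indicator ((\<Union>i<n. D i) \<inter> A) t :: real) \<longlonglongrightarrow> indicator (\<Union>n. (\<Union>i<n. D i) \<inter> A) t"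
            by (rule LIMSEQ_indicator_incseq, rule incseq_SucI) (auto intro: less_SucI)
          ultimately show ?thesis unfolding Geq by simp
        qed
        show "G n \<in> borel_measurable m" for n unfolding G_def using Dm by measurable
        show "\<bar>G n t\<bar> \<le> indicator A t" for n t unfolding Geq by (auto simp: indicator_def)
        show "indicator ((\<Union>i. D i) \<inter> A) \<in> borel_measurable m" using Dm by measurable
      qed simp
    qed
  qed
  obtain F where F: "\<And>n. simple_function m (F n)" "\<And>x. x \<in> space m \<Longrightarrow> (\<lambda>n. F n x) \<longlonglongrightarrow> f x"
    "\<And>n x. x \<in> space m \<Longrightarrow> \<bar>F n x\<bar> \<le> 2 * \<bar>f x\<bar>"
    by (rule simple_function_approximation[OF f that])
  have QF: "Q (\<lambda>t. F n t * indicator A t)" for n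
  proof -
    have sum: "Q (\<lambda>t. \<Sum>y\<in>Y. y * indicator ((F n -` {y} \<inter> space m) \<inter> A) t)" if "finite Y" for Y
      using that
    proof (induction Y)
      case (insert y Y)
      have "F n -` {y} \<inter> space m \<in> sets m" using F(1) by (auto intro: simple_functionD)
      from lin[OF indD[OF this] insert.IH, of y 1] show ?case using insert.hyps by (simp del: sum_mult_indicator)
    qed (use Q0 in simp)
    have "F n t * indicator A t = (\<Sum>y\<in>F n ` space m. y * indicator ((F n -` {y} \<inter> space m) \<inter> A) t)" for t
    proof (cases "t \<in> A")
      case True
      then have "t \<in> space m" using sets.sets_into_space[OF Am] by auto
      then have "y * indicator ((F n -` {y} \<inter> space m) \<inter> A) t = (if y = F n t then y else 0)" for y
        using True by (auto simp: indicator_def)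
      then show ?thesis using True \<open>t \<in> space m\<close> simple_functionD(1)[OF F(1)[of n]]
        by (simp only:) (simp add: sum.delta)
    qed simp
    then show ?thesis using sum[OF simple_functionD(1)[OF F(1)[of n]]] by (simp only:)
  qed
  show ?thesis
  proof (rule lim[of "\<lambda>n t. F n t * indicator A t" _ "\<lambda>t. 2 * \<bar>f t * indicator A t\<bar>"], rule QF,
      unfold dominated_limit_def, intro conjI allI ballI)
    show "\<And>t. t \<in> space m \<Longrightarrow> (\<lambda>n. F n t * indicator A t) \<longlonglongrightarrow> f t * indicator A t"
      using F(2) by (intro tendsto_intros) auto
    show "(\<lambda>t. F n t * indicator A t) \<in> borel_measurable m" for n
      using borel_measurable_simple_function[OF F(1)[of n]] by measurable
    show "\<bar>F n t * indicator A t\<bar> \<le> 2 * \<bar>f t * indicator A t\<bar>" if "t \<in> space m" for n t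
      using F(3) that by (auto simp: indicator_def)
  qed simp_all
qed

section \<open>Small jumps\<close>

text \<open>Half-open at \<open>b\<close>, so that for \<open>a \<le> b\<close> the set
  \<open>tail a\<close> is the disjoint union of \<open>band a b\<close> and
  \<open>tail b\<close>.\<close>

definition band :: "real \<Rightarrow> real \<Rightarrow> real set" where
  "band a b = {x. a \<le> \<bar>x\<bar> \<and> \<bar>x\<bar> < b}"

definition tail :: "real \<Rightarrow> real set" where
  "tail a = {x. a \<le> \<bar>x\<bar>}"

definition weighted :: "('a \<Rightarrow> real) \<Rightarrow> 'a \<times> real \<Rightarrow> real" where
  "weighted f = (\<lambda>(t, x). f t * x)"

lemma set_integral_mult_indicator:
  fixes f :: "'b \<Rightarrow> real"
  shows "(LINT t:A|M. f t * indicator A t) = (LINT t:A|M. f t)"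
  unfolding set_lebesgue_integral_def
  by (intro Bochner_Integration.integral_cong refl) (auto simp: indicator_def)

lemma eventually_inverse_Suc_less: "0 < c \<Longrightarrow> \<forall>\<^sub>F n in sequentially. 1 / real (Suc n) < c"
  using order_tendstoD(2)[OF LIMSEQ_inverse_real_of_nat, of c] by (simp add: inverse_eq_divide)

lemma integrable_power2_sum:
  fixes f g :: "'b \<Rightarrow> real"
  assumes m: "f \<in> borel_measurable M" "g \<in> borel_measurable M"
    and i: "integrable M (\<lambda>x. (f x)\<^sup>2)" "integrable M (\<lambda>x. (g x)\<^sup>2)"
  shows "integrable M (\<lambda>x. (f x + g x)\<^sup>2)" "integrable M (\<lambda>x. (f x - g x)\<^sup>2)"
proof -
  have le: "(x + y)\<^sup>2 \<le> 2 * x\<^sup>2 + 2 * y\<^sup>2" "(x - y)\<^sup>2 \<le> 2 * x\<^sup>2 + 2 * y\<^sup>2" for x y :: real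
    using zero_le_power2[of "x - y"] zero_le_power2[of "x + y"]
    unfolding power2_sum power2_diff by linarith+
  have "integrable M (\<lambda>x. 2 * (f x)\<^sup>2 + 2 * (g x)\<^sup>2)" using i by simp
  then show "integrable M (\<lambda>x. (f x + g x)\<^sup>2)" "integrable M (\<lambda>x. (f x - g x)\<^sup>2)"
    using m le by (auto elim!: Bochner_Integration.integrable_bound simp: abs_of_nonneg)
qed

lemma band_tail_borel[measurable]: "band a b \<in> sets borel" "tail a \<in> sets borel"
  unfolding band_def tail_def by measurable

text \<open>Finite dimension enters as \<open>coords\<close>. The coordinate maps may change with
  \<open>n\<close>, but their number \<open>p\<close> does not, and \<open>p\<close> is all that the
  constant in the maximal inequality depends on.\<close>

locale levy_jumps = prob_space P for P :: "'w measure" +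
  fixes T :: "'a set" and \<A> :: "'a set set" and \<A>s :: "nat \<Rightarrow> 'a set set"
    and m :: "'a measure" and \<nu> :: "real measure" and \<Xi> :: "'w \<Rightarrow> ('a \<times> real) set" and p :: nat
  assumes ic: "indexing_collection T \<A> \<A>s"
    and coords: "\<And>n. \<exists>(\<phi> :: 'a \<Rightarrow> nat \<Rightarrow> nat) \<kappa>. \<forall>A\<in>insert T (\<A>s n). \<forall>t\<in>T.
      t \<in> A \<longleftrightarrow> (\<forall>i<p. \<phi> t i \<le> \<kappa> A i)"
    and space_m: "space m = T" and sets_m: "sets m = sigma_sets T \<A>"
    and fin_m: "\<And>A. A \<in> \<A> \<Longrightarrow> emeasure m A < \<infinity>"
    and sets_\<nu>[measurable_cong]: "sets \<nu> = sets borel" and \<nu>0: "emeasure \<nu> {0} = 0"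
    and sq_\<nu>: "integrable \<nu> (\<lambda>x. x\<^sup>2)"
    and poisson: "poisson_random_set P (m \<Otimes>\<^sub>M \<nu>) \<Xi>"
begin

abbreviation "\<mu> \<equiv> m \<Otimes>\<^sub>M \<nu>"
abbreviation "csum f \<equiv> compensated_sum \<mu> \<Xi> (weighted f)"
abbreviation "Jeps \<equiv> jump_integral_eps m \<nu> \<Xi>"
abbreviation "JI \<equiv> jump_integral m \<nu> \<Xi>"
abbreviation "sq_integrable A f \<equiv> set_integrable m A (\<lambda>t. (f t)\<^sup>2 :: real)"

lemma \<A>_sets[measurable]: "A \<in> \<A> \<Longrightarrow> A \<in> sets m"
  unfolding sets_m by (rule sigma_sets.Basic)

lemma space_\<nu>[simp]: "space \<nu> = UNIV"
  using sets_eq_imp_space_eq[OF sets_\<nu>] by simp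

lemma band_tail_sets[measurable]: "band a b \<in> sets \<nu>" "tail a \<in> sets \<nu>"
  using band_tail_borel sets_\<nu> by auto

lemma fin_tail: assumes "0 < a" shows "emeasure \<nu> (tail a) < \<infinity>"
proof -
  have "integrable \<nu> (indicator (tail a) :: real \<Rightarrow> real)"
  proof (rule Bochner_Integration.integrable_bound)
    show "integrable \<nu> (\<lambda>x. x\<^sup>2 / a\<^sup>2)" using sq_\<nu> by simp
    show "AE x in \<nu>. norm (indicator (tail a) x :: real) \<le> norm (x\<^sup>2 / a\<^sup>2)"
    proof (rule AE_I2)
      fix x
      have "a\<^sup>2 \<le> x\<^sup>2" if "a \<le> \<bar>x\<bar>" using power_mono[OF that, of 2] assms by simp
      then show "norm (indicator (tail a) x :: real) \<le> norm (x\<^sup>2 / a\<^sup>2)"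
        using assms by (auto simp: indicator_def tail_def)
    qed
  qed measurable
  then show ?thesis by (simp add: integrable_indicator_iff)
qed

lemma int_tail: assumes "0 < a" "C \<in> sets \<nu>" "C \<subseteq> tail a" shows "set_integrable \<nu> C (\<lambda>x. x)"
proof (rule set_square_integrable_imp_integrable)
  show "emeasure \<nu> C < \<infinity>"
    using emeasure_mono[OF assms(3)] fin_tail[OF assms(1)] by (meson band_tail_sets(2) le_less_trans)
  show "set_integrable \<nu> C (\<lambda>x. x\<^sup>2)"
    unfolding set_integrable_def using assms(2) sq_\<nu> by (intro integrable_mult_indicator)
qed (use assms in measurable)

sublocale M2: sigma_finite_measure \<nu>
proof
  \<comment> \<open>The tails have finite mass, but none of them contains 0, whence the additional
    null set \<open>{0}\<close>.\<close>
  let ?S = "insert {0} (range (\<lambda>n::nat. tail (1 / Suc n)))"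
  have "x \<in> \<Union>?S" for x
  proof (cases "x = 0")
    case False
    then obtain n where "1 / Suc n < \<bar>x\<bar>" using nat_approx_posE[of "\<bar>x\<bar>"] by auto
    then show ?thesis by (auto simp: tail_def intro: less_imp_le)
  qed simp
  then have "\<Union>?S = space \<nu>" by auto
  moreover have "{0} \<in> sets \<nu>" unfolding sets_\<nu> by simp
  then have "?S \<subseteq> sets \<nu>" using band_tail_sets(2) by blast
  moreover have "emeasure \<nu> a \<noteq> \<infinity>" if a: "a \<in> ?S" for a
  proof (cases "a = {0}")
    case False
    then obtain n :: nat where "a = tail (1 / Suc n)" using a by auto
    then show ?thesis using fin_tail[of "1 / Suc n"] by simp
  qed (simp add: \<nu>0)
  moreover have "countable ?S" by simp
  ultimately show "\<exists>S. countable S \<and> S \<subseteq> sets \<nu> \<and> \<Union>S = space \<nu> \<and> (\<forall>a\<in>S. emeasure \<nu> a \<noteq> \<infinity>)"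
    by (intro exI[of _ ?S] conjI ballI)
qed

sublocale M1: sigma_finite_measure m
  by (rule indexing_collection_sigma_finite[OF ic space_m _ fin_m]) auto

sublocale pair_sigma_finite m \<nu> ..

lemma fin_prod: "A \<in> \<A> \<Longrightarrow> 0 < a \<Longrightarrow> emeasure \<mu> (A \<times> tail a) < \<infinity>"
  using fin_m[of A] fin_tail[of a] by (simp add: M2.emeasure_pair_measure_Times ennreal_mult_less_top)

lemma set_prod:
  fixes u :: "'a \<Rightarrow> real" and v :: "real \<Rightarrow> real"
  assumes "set_integrable m A u" "set_integrable \<nu> C v"
  shows set_integrable_prod: "set_integrable \<mu> (A \<times> C) (\<lambda>(t, x). u t * v x)"
    and set_integral_prod: "(LINT z:A \<times> C|\<mu>. (case z of (t, x) \<Rightarrow> u t * v x))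
      = (LINT t:A|m. u t) * (LINT x:C|\<nu>. v x)"
proof -
  have eq: "indicator (A \<times> C) z *\<^sub>R (case z of (t, x) \<Rightarrow> u t * v x)
     = (case z of (t, x) \<Rightarrow> (indicator A t *\<^sub>R u t) * (indicator C x *\<^sub>R v x))" for z
    by (cases z) (auto simp: indicator_def)
  show "set_integrable \<mu> (A \<times> C) (\<lambda>(t, x). u t * v x)"
    "(LINT z:A \<times> C|\<mu>. (case z of (t, x) \<Rightarrow> u t * v x)) = (LINT t:A|m. u t) * (LINT x:C|\<nu>. v x)"
    using integrable_prod_mult[OF assms[unfolded set_integrable_def]]
      integral_prod_mult[OF assms[unfolded set_integrable_def]]
    unfolding set_integrable_def set_lebesgue_integral_def eq by auto
qed

lemma sq_int_\<nu>: "C \<in> sets \<nu> \<Longrightarrow> set_integrable \<nu> C (\<lambda>x. x\<^sup>2)"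
  unfolding set_integrable_def by (intro integrable_mult_indicator sq_\<nu>)

lemma weighted_sq: "(weighted f z)\<^sup>2 = (case z of (t, x) \<Rightarrow> (f t)\<^sup>2 * x\<^sup>2)"
  by (auto simp: weighted_def power_mult_distrib split: prod.split)

lemma weighted_measurable[measurable]:
  assumes f[measurable]: "f \<in> borel_measurable m" shows "weighted f \<in> borel_measurable \<mu>"
proof -
  have "snd \<in> measurable \<mu> \<nu>" by simp
  then have [measurable]: "snd \<in> borel_measurable \<mu>" using measurable_cong_sets[OF refl sets_\<nu>] by blast
  have [measurable]: "(\<lambda>z. f (fst z)) \<in> borel_measurable \<mu>"
    by (rule measurable_compose[OF measurable_fst f])
  show ?thesis unfolding weighted_def split_beta by (intro borel_measurable_times) fact+
qed

lemma weighted_sq_integral: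
  assumes "sq_integrable A f" "C \<in> sets \<nu>"
  shows "set_integrable \<mu> (A \<times> C) (\<lambda>z. (weighted f z)\<^sup>2)"
    and "(LINT z:A \<times> C|\<mu>. (weighted f z)\<^sup>2) = (LINT t:A|m. (f t)\<^sup>2) * (LINT x:C|\<nu>. x\<^sup>2)"
  using set_prod[OF assms(1) sq_int_\<nu>[OF assms(2)]] unfolding weighted_sq by auto

lemma f_integrable:
  fixes f :: "'a \<Rightarrow> real"
  assumes "A \<in> \<A>" "f \<in> borel_measurable m" "sq_integrable A f"
  shows "set_integrable m A f"
  by (rule set_square_integrable_imp_integrable[OF assms(2) \<A>_sets[OF assms(1)] fin_m[OF assms(1)] assms(3)])

section \<open>Truncated jump integrals as compensated sums\<close>

lemma jumps_set_eq: "{(t, J) \<in> \<Xi> \<omega>. t \<in> A \<and> a \<le> \<bar>J\<bar>} = \<Xi> \<omega> \<inter> A \<times> tail a"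
  by (auto simp: tail_def)

lemma band_subset_tail: "band a b \<subseteq> tail a"
  by (auto simp: band_def tail_def)

lemma weighted_integral:
  assumes "set_integrable m A f" "0 < a" "C \<in> sets \<nu>" "C \<subseteq> tail a"
  shows "(LINT z:A \<times> C|\<mu>. weighted f z) = (LINT t:A|m. f t) * (LINT x:C|\<nu>. x)"
  unfolding weighted_def by (intro set_integral_prod int_tail[of a] assms)

text \<open>As \<open>b \<le> 1\<close>, sizes in the band lie wholly in the range that the
  definition compensates, so lowering the truncation adds a centred sum.\<close>

lemma jump_integral_eps_diff:
  assumes fin: "finite (\<Xi> \<omega> \<inter> A \<times> tail a)" and ab: "0 < a" "a \<le> b" "b \<le> 1"
    and f: "set_integrable m A f"
  shows "Jeps f a A \<omega> - Jeps f b A \<omega>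
    = csum f (A \<times> band a b) \<omega>"
proof -
  have fin': "finite (\<Xi> \<omega> \<inter> A \<times> tail b)" "finite (\<Xi> \<omega> \<inter> A \<times> band a b)"
    using ab by (auto intro!: finite_subset[OF _ fin] simp: tail_def band_def)
  have "\<Xi> \<omega> \<inter> A \<times> tail a = (\<Xi> \<omega> \<inter> A \<times> tail b) \<union> (\<Xi> \<omega> \<inter> A \<times> band a b)"
    using ab by (auto simp: tail_def band_def)
  then have 1: "sum (weighted f) (\<Xi> \<omega> \<inter> A \<times> tail a)
      = sum (weighted f) (\<Xi> \<omega> \<inter> A \<times> tail b) + sum (weighted f) (\<Xi> \<omega> \<inter> A \<times> band a b)"
    using fin' by (simp only:) (rule sum.union_disjoint, auto simp: tail_def band_def)
  have "{x. a \<le> \<bar>x\<bar> \<and> \<bar>x\<bar> \<le> 1} = {x. b \<le> \<bar>x\<bar> \<and> \<bar>x\<bar> \<le> 1} \<union> band a b"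
    using ab by (auto simp: band_def)
  moreover have "set_integrable \<nu> {x. b \<le> \<bar>x\<bar> \<and> \<bar>x\<bar> \<le> 1} (\<lambda>x. x)" "set_integrable \<nu> (band a b) (\<lambda>x. x)"
    using ab by (auto intro!: int_tail[OF ab(1)] simp: band_def tail_def sets_\<nu>)
  moreover have "{x. b \<le> \<bar>x\<bar> \<and> \<bar>x\<bar> \<le> 1} \<inter> band a b = {}" by (auto simp: band_def)
  ultimately have 2: "(LINT x:{x. a \<le> \<bar>x\<bar> \<and> \<bar>x\<bar> \<le> 1}|\<nu>. x)
      = (LINT x:{x. b \<le> \<bar>x\<bar> \<and> \<bar>x\<bar> \<le> 1}|\<nu>. x) + (LINT x:band a b|\<nu>. x)"
    by (simp add: set_integral_Un)
  note 3 = weighted_integral[OF f ab(1) band_tail_sets(1) band_subset_tail]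
  show ?thesis
    unfolding jump_integral_eps_def jumps_set_eq compensated_sum_def 2 3
    unfolding weighted_def[symmetric] 1 by (simp add: algebra_simps)
qed

text \<open>Jumps of size greater than 1 are not compensated in the definition. Subtracting their
  mean leaves a sum compensated over the whole tail, to which second-moment bounds apply.\<close>

lemma jump_integral_eps_centered:
  assumes ab: "0 < a" "a \<le> 1" and f: "set_integrable m A f"
  shows "Jeps f a A \<omega> - (LINT t:A|m. f t) * (LINT x:{x. 1 < \<bar>x\<bar>}|\<nu>. x)
    = csum f (A \<times> tail a) \<omega>"
proof -
  have "tail a = {x. a \<le> \<bar>x\<bar> \<and> \<bar>x\<bar> \<le> 1} \<union> {x. 1 < \<bar>x\<bar>}"
    using ab by (auto simp: tail_def)
  moreover have "set_integrable \<nu> {x. a \<le> \<bar>x\<bar> \<and> \<bar>x\<bar> \<le> 1} (\<lambda>x. x)" "set_integrable \<nu> {x. 1 < \<bar>x\<bar>} (\<lambda>x. x)"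
    using ab by (auto intro!: int_tail[OF ab(1)] simp: tail_def sets_\<nu>)
  moreover have "{x::real. a \<le> \<bar>x\<bar> \<and> \<bar>x\<bar> \<le> 1} \<inter> {x. 1 < \<bar>x\<bar>} = {}" by auto
  ultimately have 2: "(LINT x:tail a|\<nu>. x)
      = (LINT x:{x. a \<le> \<bar>x\<bar> \<and> \<bar>x\<bar> \<le> 1}|\<nu>. x) + (LINT x:{x. 1 < \<bar>x\<bar>}|\<nu>. x)"
    by (simp add: set_integral_Un)
  note 3 = weighted_integral[OF f ab(1) band_tail_sets(2) order.refl]
  show ?thesis
    unfolding jump_integral_eps_def jumps_set_eq compensated_sum_def 2 3
    unfolding weighted_def[symmetric] by (simp add: algebra_simps)
qed

text \<open>Tails decrease in \<open>a\<close>, so the thresholds 1 / (n + 1) yield one null set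
  that serves every positive threshold.\<close>

lemma AE_finite_jumps:
  assumes A: "A \<in> \<A>" shows "AE \<omega> in P. \<forall>a>0. finite (\<Xi> \<omega> \<inter> A \<times> tail a)"
proof -
  have "AE \<omega> in P. \<forall>n::nat. finite (\<Xi> \<omega> \<inter> A \<times> tail (1 / Suc n))"
    unfolding AE_all_countable
    using A by (intro allI poisson_AE_finite[OF poisson _ fin_prod]) auto
  then show ?thesis
  proof eventually_elim
    case (elim \<omega>)
    show ?case
    proof (intro allI impI)
      fix a :: real assume "0 < a"
      then obtain n where "1 / Suc n < a" using nat_approx_posE by blast
      then have "\<Xi> \<omega> \<inter> A \<times> tail a \<subseteq> \<Xi> \<omega> \<inter> A \<times> tail (1 / Suc n)" by (auto simp: tail_def)
      then show "finite (\<Xi> \<omega> \<inter> A \<times> tail a)" using elim finite_subset by blast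
    qed
  qed
qed

section \<open>Maximal inequality for small jumps\<close>

lemma AT_sets: "A \<in> \<A> \<Longrightarrow> A' \<in> insert T (\<A>s n) \<Longrightarrow> A \<inter> A' \<in> \<A>"
  using indexing_collectionD(1,4,9)[OF ic] by (metis Int_absorb2 PowD insertE subsetD)

text \<open>The right side of the maximal inequality with \<open>Suc p\<close> orders and all sizes
  below \<delta>. Infinitely many jumps may have such sizes, but their squares are \<nu>-integrable,
  so one number bounds all bands with upper end \<delta>.\<close>

definition band_bound where
  "band_bound f A l \<delta> = 2 ^ Suc p * ((LINT t:A|m. (f t)\<^sup>2) * (LINT x:{x. \<bar>x\<bar> < \<delta>}|\<nu>. x\<^sup>2)) / l\<^sup>2"

definition band_event where
  "band_event f A n Q \<delta> l = {\<omega> \<in> space P. \<exists>A'\<in>insert T (\<A>s n). \<exists>q\<in>Q.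
      \<bar>csum f ((A \<inter> A') \<times> band q \<delta>) \<omega>\<bar> > l}"

text \<open>The jump threshold is one more coordinate, counted among the levels of \<open>Q\<close>.\<close>

lemma band_maximal_finite:
  assumes A: "A \<in> \<A>" and f[measurable]: "f \<in> borel_measurable m" and sq: "sq_integrable A f"
    and Q: "finite Q" "Q \<noteq> {}" "Q \<subseteq> {0<..<\<delta>}" and l: "l > 0"
  shows "prob (band_event f A n Q \<delta> (2 ^ Suc p * l))
    \<le> band_bound f A l \<delta>"
proof -
  \<comment> \<open>The maximal inequality needs a base set of finite measure, so the band starts at
    the smallest threshold of \<open>Q\<close>.\<close>
  define q0 where "q0 = Min Q"
  have q0: "0 < q0" "\<And>q. q \<in> Q \<Longrightarrow> q0 \<le> q" using Q by (auto simp: q0_def)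
  define E where "E = A \<times> band q0 \<delta>"
  define \<W> where "\<W> = (\<lambda>(A', q). (A \<inter> A') \<times> band q \<delta>) ` (insert T (\<A>s n) \<times> Q)"
  obtain \<phi> :: "'a \<Rightarrow> nat \<Rightarrow> nat" and \<kappa> where "\<forall>A\<in>insert T (\<A>s n). \<forall>t\<in>T.
    t \<in> A \<longleftrightarrow> (\<forall>i<p. \<phi> t i \<le> \<kappa> A i)" using coords[of n] by (elim exE)
  then have \<phi>: "t \<in> A' \<longleftrightarrow> (\<forall>i<p. \<phi> t i \<le> \<kappa> A' i)" if "A' \<in> insert T (\<A>s n)" "t \<in> T" for A' t
    using that by (elim ballE) auto
  have AT: "A \<subseteq> T" using A indexing_collectionD(1)[OF ic] by blast
  \<comment> \<open>Larger jumps have fewer thresholds above them, so counting reverses the order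
    and makes \<open>q \<le> \<bar>x\<bar>\<close> an upper bound on the last coordinate. The strict
    comparison matters: if \<open>\<bar>x\<bar> < q\<close>, then \<open>q\<close> is counted for
    \<open>x\<close> but not for \<open>q\<close> itself.\<close>
  define \<phi>' where "\<phi>' z i = (if i < p then \<phi> (fst z) i else card {q\<in>Q. q > \<bar>snd z\<bar>})" for z :: "'a \<times> real" and i
  have "\<exists>k. \<forall>z\<in>E. z \<in> W \<longleftrightarrow> (\<forall>i<Suc p. \<phi>' z i \<le> k i)" if W: "W \<in> \<W>" for W
  proof -
    obtain A' q where A': "A' \<in> insert T (\<A>s n)" and q: "q \<in> Q" and Weq: "W = (A \<inter> A') \<times> band q \<delta>"
      using W by (auto simp: \<W>_def)
    define k where "k i = (if i < p then \<kappa> A' i else card {q'\<in>Q. q' > q})" for i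
    have card: "q \<le> r \<longleftrightarrow> card {q\<in>Q. q > r} \<le> card {q'\<in>Q. q' > q}" for r
    proof (cases "q \<le> r")
      case True
      then have "{q\<in>Q. q > r} \<subseteq> {q'\<in>Q. q' > q}" by (auto intro: le_less_trans)
      moreover have "finite {q'\<in>Q. q' > q}" using Q(1) by simp
      ultimately have "card {q\<in>Q. q > r} \<le> card {q'\<in>Q. q' > q}" by (intro card_mono)
      then show ?thesis using True by simp
    next
      case False
      then have r: "r < q" by simp
      have "{q'\<in>Q. q' > q} \<subset> {q\<in>Q. q > r}"
      proof (rule psubsetI)
        show "{q'\<in>Q. q' > q} \<subseteq> {q\<in>Q. q > r}" by (intro subsetI) (use r in force)
        show "{q'\<in>Q. q' > q} \<noteq> {q\<in>Q. q > r}" using r q by blast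
      qed
      moreover have "finite {q\<in>Q. q > r}" using Q(1) by simp
      ultimately have "card {q'\<in>Q. q' > q} < card {q\<in>Q. q > r}" by (intro psubset_card_mono)
      then show ?thesis using False by simp
    qed
    have "z \<in> W \<longleftrightarrow> (\<forall>i<Suc p. \<phi>' z i \<le> k i)" if z: "z \<in> E" for z
    proof -
      obtain t x where zeq: "z = (t, x)" by (cases z)
      have t: "t \<in> A" "t \<in> T" and x: "\<bar>x\<bar> < \<delta>" using z AT by (auto simp: zeq E_def band_def)
      have "z \<in> W \<longleftrightarrow> t \<in> A' \<and> q \<le> \<bar>x\<bar>" using t x by (auto simp: zeq Weq band_def)
      also have "\<dots> \<longleftrightarrow> (\<forall>i<p. \<phi> t i \<le> \<kappa> A' i) \<and> card {q\<in>Q. q > \<bar>x\<bar>} \<le> card {q'\<in>Q. q' > q}"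
        using \<phi>[OF A' t(2)] card[of "\<bar>x\<bar>"] by (simp only:)
      also have "\<dots> \<longleftrightarrow> (\<forall>i<Suc p. \<phi>' z i \<le> k i)"
        by (auto simp: \<phi>'_def k_def zeq less_Suc_eq)
      finally show ?thesis .
    qed
    then show ?thesis by (intro exI[of _ k] ballI)
  qed
  then have "\<forall>W\<in>\<W>. \<exists>k. \<forall>z\<in>E. z \<in> W \<longleftrightarrow> (\<forall>i<Suc p. \<phi>' z i \<le> k i)" by (intro ballI)
  then obtain K where "\<forall>W\<in>\<W>. \<forall>z\<in>E. z \<in> W \<longleftrightarrow> (\<forall>i<Suc p. \<phi>' z i \<le> K W i)"
    unfolding bchoice_iff by (elim exE)
  then have dim: "z \<in> W \<longleftrightarrow> (\<forall>i<Suc p. \<phi>' z i \<le> K W i)" if "W \<in> \<W>" "z \<in> E" for W z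
    using that by (elim ballE) auto
  have Em: "E \<in> sets \<mu>" unfolding E_def using A by measurable
  have Efin: "emeasure \<mu> E < \<infinity>"
  proof -
    have "E \<subseteq> A \<times> tail q0" by (auto simp: E_def band_def tail_def)
    from emeasure_mono[OF this, of \<mu>] show ?thesis
      using fin_prod[OF A q0(1)] A by (auto intro: le_less_trans)
  qed
  have "prob {\<omega> \<in> space P. \<exists>W\<in>\<W>. \<bar>csum f W \<omega>\<bar> > 2 ^ Suc p * l}
    \<le> 2 ^ Suc p * (LINT z:E|\<mu>. (weighted f z)\<^sup>2) / l\<^sup>2"
  proof (rule compensated_sum_maximal[OF poisson Em Efin _ _ _ _ _ dim l])
    show "weighted f \<in> borel_measurable \<mu>" by measurable
    show "set_integrable \<mu> E (\<lambda>x. (weighted f x)\<^sup>2)"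
      unfolding E_def by (rule weighted_sq_integral[OF sq]) measurable
    show "finite \<W>" unfolding \<W>_def using Q(1) indexing_collectionD(3)[OF ic] by simp
    show "W \<in> sets \<mu>" if "W \<in> \<W>" for W
    proof -
      obtain A' q where "A' \<in> insert T (\<A>s n)" "W = (A \<inter> A') \<times> band q \<delta>"
        using \<open>W \<in> \<W>\<close> unfolding \<W>_def by auto
      then show ?thesis using \<A>_sets[OF AT_sets[OF A]] by simp
    qed
    show "W \<subseteq> E" if "W \<in> \<W>" for W
      using that q0 unfolding \<W>_def E_def by (auto simp: band_def dest: order_trans)
  qed
  also have "(LINT z:E|\<mu>. (weighted f z)\<^sup>2) = (LINT t:A|m. (f t)\<^sup>2) * (LINT x:band q0 \<delta>|\<nu>. x\<^sup>2)"
    unfolding E_def by (rule weighted_sq_integral[OF sq]) measurable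
  \<comment> \<open>Enlarging the band to all sizes below \<delta> removes \<open>q0\<close>, so
    that the bound is the same for all finite sets of thresholds.\<close>
  also have "2 ^ Suc p * ((LINT t:A|m. (f t)\<^sup>2) * (LINT x:band q0 \<delta>|\<nu>. x\<^sup>2)) / l\<^sup>2
    \<le> band_bound f A l \<delta>"
    unfolding band_bound_def
  proof (intro divide_right_mono mult_left_mono)
    show "(LINT x:band q0 \<delta>|\<nu>. x\<^sup>2) \<le> (LINT x:{x. \<bar>x\<bar> < \<delta>}|\<nu>. x\<^sup>2)"
      unfolding set_lebesgue_integral_def
    proof (rule integral_mono)
      show "integrable \<nu> (\<lambda>x. indicator {x. \<bar>x\<bar> < \<delta>} x *\<^sub>R x\<^sup>2)"
        using sq_int_\<nu>[of "{x. \<bar>x\<bar> < \<delta>}"] by (simp add: set_integrable_def sets_\<nu>)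
      show "integrable \<nu> (\<lambda>x. indicator (band q0 \<delta>) x *\<^sub>R x\<^sup>2)"
        using sq_int_\<nu>[of "band q0 \<delta>"] by (simp add: set_integrable_def)
    qed (auto simp: band_def indicator_def)
    show "0 \<le> (LINT t:A|m. (f t)\<^sup>2)" unfolding set_lebesgue_integral_def by (rule Bochner_Integration.integral_nonneg) simp
  qed simp_all
  finally show ?thesis unfolding \<W>_def band_event_def band_bound_def by simp
qed

lemma band_event_measurable:
  assumes A: "A \<in> \<A>" and f[measurable]: "f \<in> borel_measurable m" and D: "countable D"
  shows "band_event f A n D \<delta> l \<in> events"
proof -
  have "band_event f A n D \<delta> l
    = (\<Union>(A', q)\<in>insert T (\<A>s n) \<times> D. {\<omega> \<in> space P. \<bar>csum f ((A \<inter> A') \<times> band q \<delta>) \<omega>\<bar> > l})"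
    by (auto simp: band_event_def)
  also have "\<dots> \<in> events"
  proof (rule sets.countable_UN'')
    show "countable (insert T (\<A>s n) \<times> D)"
      using D indexing_collectionD(3)[OF ic] by (intro countable_SIGMA) (auto intro: countable_finite)
    show "(case z of (A', q) \<Rightarrow> {\<omega> \<in> space P. \<bar>csum f ((A \<inter> A') \<times> band q \<delta>) \<omega>\<bar> > l}) \<in> events"
      if z: "z \<in> insert T (\<A>s n) \<times> D" for z
    proof -
      obtain A' q where zeq: "z = (A', q)" by (cases z)
      have "A \<inter> A' \<in> sets m" using AT_sets[OF A, of A' n] z by (intro \<A>_sets) (simp add: zeq)
      then have "(A \<inter> A') \<times> band q \<delta> \<in> sets \<mu>" by auto
      from compensated_sum_measurable[OF poisson weighted_measurable[OF f] this]
      show ?thesis unfolding zeq by simp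
    qed
  qed
  finally show ?thesis .
qed

text \<open>The level \<open>n\<close> and the number of enumerated rational thresholds grow
  together, which makes the events \<open>C n\<close> increase to \<open>B\<close>. The finite bound
  depends neither on the level nor on the thresholds, so it passes to the union.\<close>

lemma band_maximal:
  assumes A: "A \<in> \<A>" and f[measurable]: "f \<in> borel_measurable m" and sq: "sq_integrable A f"
    and \<delta>: "0 < \<delta>" and l: "l > 0"
  defines "B \<equiv> {\<omega> \<in> space P. \<exists>n. \<exists>A'\<in>insert T (\<A>s n). \<exists>q\<in>\<rat> \<inter> {0<..<\<delta>}.
      \<bar>csum f ((A \<inter> A') \<times> band q \<delta>) \<omega>\<bar> > 2 ^ Suc p * l}"
  shows "B \<in> events" and "prob B
    \<le> band_bound f A l \<delta>"
proof -
  let ?D = "\<rat> \<inter> {0<..<\<delta>} :: real set"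
  have cD: "countable ?D" using countable_rat by auto
  obtain r where "r \<in> \<rat>" "0 < r" "r < \<delta>" using Rats_dense_in_real[OF \<delta>] by blast
  then have D0: "?D \<noteq> {}" by auto
  define e where "e = from_nat_into ?D"
  have re: "range e = ?D" unfolding e_def by (rule range_from_nat_into[OF D0 cD])
  define C where "C n = band_event f A n (e ` {..n}) \<delta> (2 ^ Suc p * l)" for n
  have C: "C n \<in> events" for n unfolding C_def by (rule band_event_measurable[OF A f]) auto
  have inc: "incseq C"
  proof (rule incseq_SucI)
    fix n
    have "\<A>s n \<subseteq> \<A>s (Suc n)" using indexing_collectionD(6)[OF ic] by (simp add: incseq_SucD)
    then show "C n \<subseteq> C (Suc n)" unfolding C_def band_event_def by (auto simp: atMost_Suc)
  qed
  have BC: "B = (\<Union>n. C n)"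
  proof (intro equalityI subsetI)
    fix \<omega> assume "\<omega> \<in> B"
    then obtain n A' q where w: "\<omega> \<in> space P" "A' \<in> insert T (\<A>s n)" "q \<in> ?D"
      "\<bar>csum f ((A \<inter> A') \<times> band q \<delta>) \<omega>\<bar> > 2 ^ Suc p * l"
      unfolding B_def by blast
    obtain j where j: "q = e j" using w(3) re by (metis imageE)
    have "\<A>s n \<subseteq> \<A>s (max n j)" using incseqD[OF indexing_collectionD(6)[OF ic]] by simp
    then have "\<omega> \<in> C (max n j)" unfolding C_def band_event_def using w j by auto
    then show "\<omega> \<in> (\<Union>n. C n)" by blast
  next
    fix \<omega> assume "\<omega> \<in> (\<Union>n. C n)"
    then obtain n A' i where "\<omega> \<in> space P" "A' \<in> insert T (\<A>s n)"
      "\<bar>csum f ((A \<inter> A') \<times> band (e i) \<delta>) \<omega>\<bar> > 2 ^ Suc p * l"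
      unfolding C_def band_event_def by auto
    moreover have "e i \<in> ?D" unfolding re[symmetric] by simp
    ultimately show "\<omega> \<in> B" unfolding B_def by (auto simp del: power_Suc)
  qed
  show "B \<in> events" unfolding BC using C by auto
  have "prob (C n) \<le> band_bound f A l \<delta>" for n
    unfolding C_def using re by (intro band_maximal_finite[OF A f sq _ _ _ l]) auto
  moreover have "(\<lambda>n. prob (C n)) \<longlonglongrightarrow> prob B"
    unfolding BC using C inc by (intro finite_Lim_measure_incseq) auto
  ultimately show "prob B \<le> band_bound f A l \<delta>"
    by (intro LIMSEQ_le_const2) auto
qed

lemma small_jumps_variance: "(\<lambda>k. LINT x:{x. \<bar>x\<bar> < 1 / Suc k}|\<nu>. x\<^sup>2) \<longlonglongrightarrow> 0"
proof -
  have "(\<lambda>k. LINT x|\<nu>. indicator {x. \<bar>x\<bar> < 1 / Suc k} x *\<^sub>R x\<^sup>2) \<longlonglongrightarrow> (LINT x|\<nu>. 0)"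
  proof (rule integral_dominated_convergence[where w = "\<lambda>x. x\<^sup>2"])
    show "AE x in \<nu>. (\<lambda>k. indicator {x. \<bar>x\<bar> < 1 / Suc k} x *\<^sub>R x\<^sup>2) \<longlonglongrightarrow> 0"
    proof (rule AE_I2)
      fix x :: real
      show "(\<lambda>k. indicator {x. \<bar>x\<bar> < 1 / Suc k} x *\<^sub>R x\<^sup>2) \<longlonglongrightarrow> 0"
      proof (cases "x = 0")
        case False
        then have "\<forall>\<^sub>F k in sequentially. 1 / real (Suc k) < \<bar>x\<bar>"
          by (intro eventually_inverse_Suc_less) simp
        then have "\<forall>\<^sub>F k in sequentially. indicator {x. \<bar>x\<bar> < 1 / Suc k} x *\<^sub>R x\<^sup>2 = 0"
          by eventually_elim (simp add: indicator_def)
        then show ?thesis by (rule tendsto_eventually)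
      qed simp
    qed
    show "AE x in \<nu>. norm (indicator {x. \<bar>x\<bar> < 1 / real (Suc k)} x *\<^sub>R x\<^sup>2) \<le> x\<^sup>2" for k
      by (intro AE_I2) (auto simp: indicator_def)
  qed (use sq_\<nu> in auto)
  then show ?thesis by (simp add: set_lebesgue_integral_def)
qed

text \<open>For a given tolerance only some \<delta> is sought, so the exceptional set is an
  intersection over \<delta> = 1 / (k + 1). Its probability is below every bound in a sequence
  tending to zero, because the variance of jumps below \<delta> vanishes with \<delta>.\<close>

lemma AE_small_jumps:
  assumes A: "A \<in> \<A>" and f[measurable]: "f \<in> borel_measurable m" and sq: "sq_integrable A f"
  shows "AE \<omega> in P. \<forall>c>0. \<exists>\<delta>. 0 < \<delta> \<and> \<delta> \<le> 1 \<and> (\<forall>n. \<forall>A'\<in>insert T (\<A>s n). \<forall>q\<in>\<rat> \<inter> {0<..<\<delta>}.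
      \<bar>csum f ((A \<inter> A') \<times> band q \<delta>) \<omega>\<bar> \<le> c)"
    (is "AE \<omega> in P. \<forall>c>0. ?Q \<omega> c")
proof -
  define B where "B l \<delta> = {\<omega> \<in> space P. \<exists>n. \<exists>A'\<in>insert T (\<A>s n). \<exists>q\<in>\<rat> \<inter> {0<..<\<delta>}.
      \<bar>csum f ((A \<inter> A') \<times> band q \<delta>) \<omega>\<bar> > 2 ^ Suc p * l}" for l \<delta> :: real
  have Bm: "B l \<delta> \<in> events" if "0 < \<delta>" "0 < l" for l \<delta>
    unfolding B_def by (rule band_maximal(1)[OF A f sq that])
  define N where "N l = (\<Inter>k::nat. B l (1 / Suc k))" for l
  have N: "AE \<omega> in P. \<omega> \<notin> N l" if l: "0 < l" for l
  proof -
    have Nm: "N l \<in> events" unfolding N_def using Bm l by auto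
    have lim: "(\<lambda>k. band_bound f A l (1 / Suc k)) \<longlonglongrightarrow>
      2 ^ Suc p * ((LINT t:A|m. (f t)\<^sup>2) * 0) / l\<^sup>2"
      unfolding band_bound_def using l by (intro tendsto_intros small_jumps_variance) auto
    have "prob (N l) \<le> band_bound f A l (1 / Suc k)" for k
    proof -
      have "prob (N l) \<le> prob (B l (1 / Suc k))" using Bm l by (intro finite_measure_mono) (auto simp: N_def)
      also have "\<dots> \<le> band_bound f A l (1 / Suc k)"
        unfolding B_def by (rule band_maximal(2)[OF A f sq _ l]) simp
      finally show ?thesis .
    qed
    then have "prob (N l) \<le> 0" using LIMSEQ_le_const[OF lim] by auto
    then have "prob (N l) = 0" by (simp add: measure_le_0_iff)
    then show ?thesis using Nm by (intro AE_not_in) (auto simp: null_sets_def emeasure_eq_measure)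
  qed
  have "AE \<omega> in P. \<forall>j::nat. \<omega> \<notin> N (1 / Suc j)"
    unfolding AE_all_countable by (intro allI N) simp
  then show ?thesis using AE_space
  proof eventually_elim
    case (elim \<omega>)
    show ?case
    proof (intro allI impI)
      fix c :: real assume "0 < c"
      \<comment> \<open>The maximal inequality concerns the threshold \<open>2 ^ Suc p * l\<close>,
        so the level \<open>l\<close> is chosen below \<open>c / 2 ^ Suc p\<close>.\<close>
      then have "0 < c / 2 ^ Suc p" by simp
      then obtain j where j: "1 / Suc j < c / 2 ^ Suc p" using nat_approx_posE by blast
      have le: "2 ^ Suc p * (1 / Suc j) \<le> c" using j by (simp add: field_simps)
      obtain k :: nat where k: "\<omega> \<notin> B (1 / Suc j) (1 / Suc k)" using elim by (auto simp: N_def)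
      show "?Q \<omega> c"
      proof (intro exI[of _ "1 / Suc k"] conjI allI ballI)
        fix n A' q assume "A' \<in> insert T (\<A>s n)" "q \<in> \<rat> \<inter> {0<..<1 / real (Suc k)}"
        then have "\<not> \<bar>csum f ((A \<inter> A') \<times> band q (1 / Suc k)) \<omega>\<bar> > 2 ^ Suc p * (1 / Suc j)"
          using k elim unfolding B_def by blast
        then show "\<bar>csum f ((A \<inter> A') \<times> band q (1 / Suc k)) \<omega>\<bar> \<le> c"
          using le by linarith
      qed simp_all
    qed
  qed
qed

end

section \<open>Uniform convergence of the jump integrals\<close>

text \<open>Comparison with one reference level \<delta> is a uniform Cauchy condition. The sequence
  1 / (n + 1) produces a pointwise limit, the comparison passes to it uniformly in \<open>x\<close>,
  and the limit is then identified with \<open>Lim\<close>, whose value is meaningful only once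
  convergence is known.\<close>

lemma uniform_limit_at_right_Lim:
  fixes H :: "real \<Rightarrow> 'c \<Rightarrow> real"
  assumes C: "\<And>c. 0 < c \<Longrightarrow> \<exists>\<delta>>0. \<forall>\<epsilon>. 0 < \<epsilon> \<longrightarrow> \<epsilon> < \<delta> \<longrightarrow> (\<forall>x\<in>S. \<bar>H \<epsilon> x - H \<delta> x\<bar> \<le> c)"
  shows "uniform_limit S H (\<lambda>x. Lim (at_right 0) (\<lambda>\<epsilon>. H \<epsilon> x)) (at_right 0)"
proof -
  note ev = eventually_inverse_Suc_less
  define L where "L x = lim (\<lambda>n. H (1 / Suc n) x)" for x
  have conv: "(\<lambda>n. H (1 / Suc n) x) \<longlonglongrightarrow> L x" if x: "x \<in> S" for x
  proof -
    have "Cauchy (\<lambda>n. H (1 / Suc n) x)"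
    proof (rule metric_CauchyI)
      fix c :: real assume "0 < c"
      then obtain \<delta> where d: "\<delta> > 0" "\<And>\<epsilon>. 0 < \<epsilon> \<Longrightarrow> \<epsilon> < \<delta> \<Longrightarrow> \<bar>H \<epsilon> x - H \<delta> x\<bar> \<le> c / 3"
        using C[of "c / 3"] x by auto
      obtain M where M: "\<And>n. n \<ge> M \<Longrightarrow> 1 / real (Suc n) < \<delta>"
        using ev[OF d(1)] unfolding eventually_sequentially by blast
      have "dist (H (1 / Suc i) x) (H (1 / Suc j) x) < c" if "i \<ge> M" "j \<ge> M" for i j
      proof -
        have "0 < 1 / real (Suc i)" "0 < 1 / real (Suc j)" by simp_all
        then show ?thesis
          using d(2)[OF _ M[OF that(1)]] d(2)[OF _ M[OF that(2)]] \<open>0 < c\<close> unfolding dist_real_def by linarith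
      qed
      then show "\<exists>M. \<forall>m\<ge>M. \<forall>n\<ge>M. dist (H (1 / Suc m) x) (H (1 / Suc n) x) < c" by blast
    qed
    then show ?thesis unfolding L_def by (simp add: Cauchy_convergent_iff convergent_LIMSEQ_iff)
  qed
  have lim: "\<exists>\<delta>>0. \<forall>\<epsilon>. 0 < \<epsilon> \<longrightarrow> \<epsilon> < \<delta> \<longrightarrow> (\<forall>x\<in>S. \<bar>H \<epsilon> x - L x\<bar> < c)" if "0 < c" for c
  proof -
    have "0 < c / 3" using that by simp
    from C[OF this] obtain \<delta> where d: "\<delta> > 0"
      and d': "\<forall>\<epsilon>. 0 < \<epsilon> \<longrightarrow> \<epsilon> < \<delta> \<longrightarrow> (\<forall>x\<in>S. \<bar>H \<epsilon> x - H \<delta> x\<bar> \<le> c / 3)"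
      by blast
    have Lx: "\<bar>L x - H \<delta> x\<bar> \<le> c / 3" if x: "x \<in> S" for x
    proof (rule tendsto_upperbound)
      show "(\<lambda>n. \<bar>H (1 / Suc n) x - H \<delta> x\<bar>) \<longlonglongrightarrow> \<bar>L x - H \<delta> x\<bar>"
        by (intro tendsto_intros conv x)
      show "\<forall>\<^sub>F n in sequentially. \<bar>H (1 / Suc n) x - H \<delta> x\<bar> \<le> c / 3"
        using ev[OF d] by eventually_elim (use d' x in auto)
    qed simp
    have "\<bar>H \<epsilon> x - L x\<bar> < c" if "0 < \<epsilon>" "\<epsilon> < \<delta>" "x \<in> S" for \<epsilon> x
    proof -
      have "\<bar>H \<epsilon> x - H \<delta> x\<bar> \<le> c / 3" using d' that by blast
      then show ?thesis using Lx[OF that(3)] \<open>0 < c\<close> by linarith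
    qed
    then show ?thesis using d by blast
  qed
  have u: "uniform_limit S H L (at_right 0)"
  proof (rule uniform_limitI)
    fix c :: real assume "0 < c"
    from lim[OF this] obtain \<delta> where "\<delta> > 0" "\<forall>\<epsilon>. 0 < \<epsilon> \<longrightarrow> \<epsilon> < \<delta> \<longrightarrow> (\<forall>x\<in>S. \<bar>H \<epsilon> x - L x\<bar> < c)"
      by blast
    then show "\<forall>\<^sub>F \<epsilon> in at_right 0. \<forall>x\<in>S. dist (H \<epsilon> x) (L x) < c"
      unfolding eventually_at_right_field dist_real_def by blast
  qed
  have "Lim (at_right 0) (\<lambda>\<epsilon>. H \<epsilon> x) = L x" if "x \<in> S" for x
    by (rule tendsto_Lim[OF _ tendsto_uniform_limitI[OF u that]]) simp
  then show ?thesis using u by (subst uniform_limit_cong'[where g = H and i = L]) auto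
qed

text \<open>Covers the complete measure space itself as well as the completions of the
  \<sigma>-algebras generated by \<open>B\<close> and by the point counts. One measurability proof
  for a general \<open>N\<close> then serves both the random variables on \<open>P\<close> and the
  independence statement.\<close>

definition ae_closed :: "'w measure \<Rightarrow> 'w measure \<Rightarrow> bool" where
  "ae_closed P N \<longleftrightarrow> space N = space P \<and> sets N \<subseteq> sets P \<and>
     (\<forall>S\<in>sets N. \<forall>S'\<subseteq>space P. (AE \<omega> in P. \<omega> \<in> S \<longleftrightarrow> \<omega> \<in> S') \<longrightarrow> S' \<in> sets N)"

lemma ae_closed_self: "complete_measure P \<Longrightarrow> ae_closed P P"
  unfolding ae_closed_def by (auto intro: complete_measure.in_sets_AE)

lemma ae_closed_cong:
  fixes Z Z' :: "'w \<Rightarrow> real"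
  assumes N: "ae_closed P N" and Z: "Z \<in> borel_measurable N" and eq: "AE \<omega> in P. Z \<omega> = Z' \<omega>"
  shows "Z' \<in> borel_measurable N"
proof (rule measurableI)
  fix B :: "real set" assume "B \<in> sets borel"
  then have "Z -` B \<inter> space N \<in> sets N" using Z by simp
  moreover have "AE \<omega> in P. \<omega> \<in> Z -` B \<inter> space N \<longleftrightarrow> \<omega> \<in> Z' -` B \<inter> space N"
    using eq by eventually_elim auto
  ultimately show "Z' -` B \<inter> space N \<in> sets N"
    using N unfolding ae_closed_def by (metis Int_lower2)
qed simp

lemma ae_closed_lim:
  fixes Z :: "nat \<Rightarrow> 'w \<Rightarrow> real"
  assumes N: "ae_closed P N" and Z: "\<And>n. Z n \<in> borel_measurable N"
    and lim: "AE \<omega> in P. (\<lambda>n. Z n \<omega>) \<longlonglongrightarrow> L \<omega>"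
  shows "L \<in> borel_measurable N"
proof (rule ae_closed_cong[OF N])
  show "(\<lambda>\<omega>. lim (\<lambda>n. Z n \<omega>)) \<in> borel_measurable N" using Z by (rule borel_measurable_lim_metric)
  show "AE \<omega> in P. lim (\<lambda>n. Z n \<omega>) = L \<omega>" using lim by eventually_elim (rule limI)
qed

section \<open>Convergence in probability\<close>

context prob_space
begin

abbreviation deviates :: "('a \<Rightarrow> real) \<Rightarrow> ('a \<Rightarrow> real) \<Rightarrow> real \<Rightarrow> 'a set" where
  "deviates U V l \<equiv> {\<omega> \<in> space M. \<bar>U \<omega> - V \<omega>\<bar> > l}"

text \<open>The mode of convergence common to both sides of the decomposition: stochastic integrals
  converge in the square mean, whereas the jump integral is controlled through tail probabilities
  only.\<close>

definition conv_prob :: "(nat \<Rightarrow> 'a \<Rightarrow> real) \<Rightarrow> ('a \<Rightarrow> real) \<Rightarrow> bool" where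
  "conv_prob Z L \<longleftrightarrow> (\<forall>n. Z n \<in> borel_measurable M) \<and> L \<in> borel_measurable M \<and>
     (\<forall>l>0. (\<lambda>n. prob (deviates (Z n) L l)) \<longlonglongrightarrow> 0)"

lemma conv_probI:
  assumes "\<And>n. Z n \<in> borel_measurable M" "L \<in> borel_measurable M"
    and "\<And>l n. l > 0 \<Longrightarrow> prob (deviates (Z n) L l) \<le> e l n"
    and "\<And>l. l > 0 \<Longrightarrow> e l \<longlonglongrightarrow> 0"
  shows "conv_prob Z L"
  unfolding conv_prob_def
proof (intro conjI allI impI)
  fix l :: real assume l: "l > 0"
  show "(\<lambda>n. prob (deviates (Z n) L l)) \<longlonglongrightarrow> 0"
    by (rule tendsto_sandwich[OF _ _ tendsto_const assms(4)[OF l]]) (use assms(3)[OF l] in auto)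
qed (use assms in auto)

lemma conv_prob_L2:
  assumes Z[measurable]: "\<And>n. Z n \<in> borel_measurable M" "L \<in> borel_measurable M"
    and i: "\<And>n. integrable M (\<lambda>\<omega>. (Z n \<omega>)\<^sup>2)" "integrable M (\<lambda>\<omega>. (L \<omega>)\<^sup>2)"
    and lim: "(\<lambda>n. LINT \<omega>|M. (Z n \<omega> - L \<omega>)\<^sup>2) \<longlonglongrightarrow> 0"
  shows "conv_prob Z L"
proof (rule conv_probI)
  fix l :: real and n assume l: "l > 0"
  have sq: "integrable M (\<lambda>\<omega>. (Z n \<omega> - L \<omega>)\<^sup>2)"
    by (intro integrable_power2_sum Z i)
  have "prob (deviates (Z n) L l) \<le> prob {\<omega> \<in> space M. l\<^sup>2 \<le> (Z n \<omega> - L \<omega>)\<^sup>2}"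
    using l by (intro finite_measure_mono) (auto simp: abs_le_square_iff[symmetric])
  also have "\<dots> \<le> (LINT \<omega>|M. (Z n \<omega> - L \<omega>)\<^sup>2) / l\<^sup>2"
    using sq l by (intro integral_Markov_inequality_measure[where A = "space M"]) auto
  finally show "prob (deviates (Z n) L l) \<le> (LINT \<omega>|M. (Z n \<omega> - L \<omega>)\<^sup>2) / l\<^sup>2" .
next
  fix l :: real assume "l > 0"
  then show "(\<lambda>n. (LINT \<omega>|M. (Z n \<omega> - L \<omega>)\<^sup>2) / l\<^sup>2) \<longlonglongrightarrow> 0"
    using tendsto_divide[OF lim tendsto_const, of "l\<^sup>2"] by simp
qed (use Z in auto)

lemma conv_prob_real: "z \<longlonglongrightarrow> a \<Longrightarrow> conv_prob (\<lambda>n _. z n) (\<lambda>_. a)"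
  unfolding conv_prob_def
proof (intro conjI allI impI)
  fix l :: real assume "z \<longlonglongrightarrow> a" "0 < l"
  then have "\<forall>\<^sub>F n in sequentially. \<bar>z n - a\<bar> < l" by (simp add: tendsto_iff dist_real_def)
  then have "\<forall>\<^sub>F n in sequentially. prob {\<omega> \<in> space M. \<bar>z n - a\<bar> > l} = 0" by eventually_elim auto
  then show "(\<lambda>n. prob {\<omega> \<in> space M. \<bar>z n - a\<bar> > l}) \<longlonglongrightarrow> 0" by (rule tendsto_eventually)
qed auto

lemma conv_prob_const: "L \<in> borel_measurable M \<Longrightarrow> conv_prob (\<lambda>_. L) L"
  by (rule conv_probI[where e = "\<lambda>_ _. 0"]) auto

lemma conv_prob_add:
  assumes 1: "conv_prob Z L" and 2: "conv_prob Z' L'"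
  shows "conv_prob (\<lambda>n \<omega>. Z n \<omega> + Z' n \<omega>) (\<lambda>\<omega>. L \<omega> + L' \<omega>)"
proof (rule conv_probI)
  have [measurable]: "Z n \<in> borel_measurable M" "Z' n \<in> borel_measurable M"
    "L \<in> borel_measurable M" "L' \<in> borel_measurable M" for n
    using 1 2 by (auto simp: conv_prob_def)
  show "(\<lambda>\<omega>. Z n \<omega> + Z' n \<omega>) \<in> borel_measurable M" "(\<lambda>\<omega>. L \<omega> + L' \<omega>) \<in> borel_measurable M" for n
    by measurable
  fix l :: real assume l: "l > 0"
  show "prob {\<omega> \<in> space M. \<bar>Z n \<omega> + Z' n \<omega> - (L \<omega> + L' \<omega>)\<bar> > l}
    \<le> prob (deviates (Z n) L (l / 2)) + prob (deviates (Z' n) L' (l / 2))" for n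
  proof (rule order_trans[OF finite_measure_mono measure_Un_le])
    show "{\<omega> \<in> space M. \<bar>Z n \<omega> + Z' n \<omega> - (L \<omega> + L' \<omega>)\<bar> > l}
      \<subseteq> deviates (Z n) L (l / 2) \<union> deviates (Z' n) L' (l / 2)"
    proof
      fix \<omega> assume w: "\<omega> \<in> {\<omega> \<in> space M. \<bar>Z n \<omega> + Z' n \<omega> - (L \<omega> + L' \<omega>)\<bar> > l}"
      then have "\<bar>Z n \<omega> - L \<omega>\<bar> > l / 2 \<or> \<bar>Z' n \<omega> - L' \<omega>\<bar> > l / 2"
        unfolding mem_Collect_eq by linarith
      then show "\<omega> \<in> deviates (Z n) L (l / 2) \<union> deviates (Z' n) L' (l / 2)"
        using w by blast
    qed
  qed auto
  show "(\<lambda>n. prob (deviates (Z n) L (l / 2)) + prob (deviates (Z' n) L' (l / 2))) \<longlonglongrightarrow> 0"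
    using 1 2 l by (intro tendsto_add_zero) (auto simp: conv_prob_def simp del: less_divide_eq_numeral1 divide_less_eq_numeral1)
qed

lemma conv_prob_cmult:
  assumes 1: "conv_prob Z L" shows "conv_prob (\<lambda>n \<omega>. c * Z n \<omega>) (\<lambda>\<omega>. c * L \<omega>)"
proof (cases "c = 0")
  case True
  then show ?thesis using conv_prob_real[of "\<lambda>_. 0" 0] by simp
next
  case False
  have "\<bar>c * Z n \<omega> - c * L \<omega>\<bar> > l \<longleftrightarrow> \<bar>Z n \<omega> - L \<omega>\<bar> > l / \<bar>c\<bar>" for l n \<omega>
    using False by (simp add: right_diff_distrib[symmetric] abs_mult divide_less_eq mult.commute)
  then show ?thesis using 1 False unfolding conv_prob_def by (auto intro: borel_measurable_times)
qed

lemma conv_prob_AE_cong: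
  assumes 1: "conv_prob Z L" and eq: "\<And>n. AE \<omega> in M. Z n \<omega> = Z' n \<omega>"
    and m: "\<And>n. Z' n \<in> borel_measurable M"
  shows "conv_prob Z' L"
proof -
  have [measurable]: "Z n \<in> borel_measurable M" "Z' n \<in> borel_measurable M" "L \<in> borel_measurable M" for n
    using 1 m by (auto simp: conv_prob_def)
  have "prob (deviates (Z n) L l) = prob (deviates (Z' n) L l)" for n l
    by (rule finite_measure_eq_AE) (use eq[of n] in \<open>auto elim!: eventually_mono\<close>)
  then show ?thesis using 1 m unfolding conv_prob_def by auto
qed

text \<open>The sequence \<open>Z n - Z n\<close> converges to \<open>L - L'\<close> in probability.
  Being identically zero, it turns the probabilities in question into a constant sequence with limit
  zero.\<close>

lemma conv_prob_unique:
  assumes 1: "conv_prob Z L" and 2: "conv_prob Z L'"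
  shows "AE \<omega> in M. L \<omega> = L' \<omega>"
proof -
  have [measurable]: "L \<in> borel_measurable M" "L' \<in> borel_measurable M"
    using 1 2 by (auto simp: conv_prob_def)
  have "conv_prob (\<lambda>n \<omega>. Z n \<omega> + (-1) * Z n \<omega>) (\<lambda>\<omega>. L \<omega> + (-1) * L' \<omega>)"
    by (intro conv_prob_add conv_prob_cmult 1 2)
  then have c: "(\<lambda>n::nat. prob (deviates L L' l)) \<longlonglongrightarrow> 0" if "l > 0" for l
    using that by (auto simp: conv_prob_def abs_minus_commute)
  have "AE \<omega> in M. \<forall>n::nat. \<bar>L \<omega> - L' \<omega>\<bar> \<le> 1 / Suc n"
    unfolding AE_all_countable
  proof
    fix n :: nat
    have "prob (deviates L L' (1 / Suc n)) = 0"
      using c[of "1 / Suc n"] by (simp add: LIMSEQ_const_iff)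
    then have "AE \<omega> in M. \<omega> \<notin> deviates L L' (1 / Suc n)"
      by (intro AE_not_in) (auto simp: null_sets_def emeasure_eq_measure)
    then show "AE \<omega> in M. \<bar>L \<omega> - L' \<omega>\<bar> \<le> 1 / Suc n"
      using AE_space by eventually_elim auto
  qed
  then show ?thesis
  proof eventually_elim
    case (elim \<omega>)
    show ?case
    proof (rule ccontr)
      assume "L \<omega> \<noteq> L' \<omega>"
      then obtain n where "1 / real (Suc n) < \<bar>L \<omega> - L' \<omega>\<bar>" using nat_approx_posE[of "\<bar>L \<omega> - L' \<omega>\<bar>"] by auto
      then show False using elim by (meson not_less)
    qed
  qed
qed

text \<open>A strict inequality for the limit holds for all late terms, so almost surely the event
  is covered by the increasing events \<open>D n\<close>, each of which is contained in an event of
  probability at most \<open>v\<close>.\<close>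

lemma prob_AE_limit_le:
  assumes Z: "\<And>n. Z n \<in> borel_measurable M" and L: "L \<in> borel_measurable M"
    and lim: "AE \<omega> in M. (\<lambda>n. Z n \<omega>) \<longlonglongrightarrow> L \<omega>" and le: "\<And>n. prob {\<omega> \<in> space M. \<bar>Z n \<omega>\<bar> > l} \<le> v"
  shows "prob {\<omega> \<in> space M. \<bar>L \<omega>\<bar> > (l::real)} \<le> v"
proof -
  note [measurable] = Z L
  define D where "D n = {\<omega> \<in> space M. \<forall>k\<ge>n. \<bar>Z k \<omega>\<bar> > l}" for n
  have D[measurable]: "D n \<in> events" for n unfolding D_def by measurable
  have "prob {\<omega> \<in> space M. \<bar>L \<omega>\<bar> > l} \<le> prob (\<Union>n. D n)"
  proof (rule finite_measure_mono_AE)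
    show "AE \<omega> in M. \<omega> \<in> {\<omega> \<in> space M. \<bar>L \<omega>\<bar> > l} \<longrightarrow> \<omega> \<in> (\<Union>n. D n)"
      using lim
    proof eventually_elim
      case (elim \<omega>)
      show ?case
      proof
        assume w: "\<omega> \<in> {\<omega> \<in> space M. \<bar>L \<omega>\<bar> > l}"
        have "\<forall>\<^sub>F n in sequentially. \<bar>Z n \<omega>\<bar> > l"
          using order_tendstoD(1)[OF tendsto_rabs[OF elim], of l] w by simp
        then show "\<omega> \<in> (\<Union>n. D n)" using w by (auto simp: D_def eventually_sequentially)
      qed
    qed
  qed auto
  also have "\<dots> \<le> v"
  proof (rule LIMSEQ_le_const2)
    show "(\<lambda>n. prob (D n)) \<longlonglongrightarrow> prob (\<Union>n. D n)"
      by (rule finite_Lim_measure_incseq) (auto simp: incseq_def D_def)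
    have "prob (D n) \<le> v" for n
      by (rule order_trans[OF finite_measure_mono le[of n]]) (auto simp: D_def)
    then show "\<exists>N. \<forall>n\<ge>N. prob (D n) \<le> v" by auto
  qed
  finally show ?thesis .
qed

end

section \<open>Uniform Cauchy property of the truncated jump integrals\<close>

context levy_jumps
begin

text \<open>All sums run over the finitely many points in \<open>W0\<close>, where each term is
  eventually constant, and the compensators converge by domination on \<open>W0\<close>. This makes
  the passage to the limit possible for each good \<omega> separately, outside a null set that does
  not depend on the sets.\<close>

lemma compensated_sum_tendsto:
  assumes g: "set_integrable \<mu> W0 g" and fin: "finite (\<Xi> \<omega> \<inter> W0)"
    and W: "\<And>n. W n \<in> sets \<mu>" "\<And>n. W n \<subseteq> W0" and W': "W' \<in> sets \<mu>"
    and ev: "\<And>z. \<forall>\<^sub>F n in sequentially. z \<in> W n \<longleftrightarrow> z \<in> W'" and gm: "g \<in> borel_measurable \<mu>"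
  shows "(\<lambda>n. compensated_sum \<mu> \<Xi> g (W n) \<omega>) \<longlonglongrightarrow> compensated_sum \<mu> \<Xi> g W' \<omega>"
proof -
  have W'0: "W' \<subseteq> W0"
  proof
    fix z assume "z \<in> W'"
    have "\<exists>n. z \<in> W n \<longleftrightarrow> z \<in> W'" using eventually_happens[OF ev[of z]] by simp
    then show "z \<in> W0" using \<open>z \<in> W'\<close> W(2) by blast
  qed
  have ind: "(\<lambda>n. indicator (W n) z *\<^sub>R g z) \<longlonglongrightarrow> indicator W' z *\<^sub>R g z" for z
    using ev[of z] by (intro tendsto_eventually) (auto elim!: eventually_mono simp: indicator_def)
  have sum: "(\<Sum>z\<in>\<Xi> \<omega> \<inter> V. g z) = (\<Sum>z\<in>\<Xi> \<omega> \<inter> W0. indicator V z *\<^sub>R g z)" if "V \<subseteq> W0" for V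
    using that fin by (intro sum.mono_neutral_cong_left) (auto simp: indicator_def)
  show ?thesis
    unfolding compensated_sum_def set_lebesgue_integral_def sum[OF W(2)] sum[OF W'0]
  proof (intro tendsto_diff tendsto_sum ind integral_dominated_convergence[where w = "\<lambda>z. norm (indicator W0 z *\<^sub>R g z)"])
    show "integrable \<mu> (\<lambda>z. norm (indicator W0 z *\<^sub>R g z))"
      using g unfolding set_integrable_def by (rule integrable_norm)
    show "AE z in \<mu>. norm (indicator (W n) z *\<^sub>R g z) \<le> norm (indicator W0 z *\<^sub>R g z)" for n
      using W(2)[of n] by (intro AE_I2) (auto simp: indicator_def)
    show "AE z in \<mu>. (\<lambda>n. indicator (W n) z *\<^sub>R g z) \<longlonglongrightarrow> indicator W' z *\<^sub>R g z"
      by (intro AE_I2 ind)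
  qed (use W W' gm in auto)
qed

text \<open>The bound on rational thresholds and approximating sets holds for each \<omega> outside
  one null set. An arbitrary \<open>A'\<close> inside \<open>A\<close> is reached by
  \<open>A\<close> intersected with its outer approximations, and an arbitrary threshold by
  rationals.\<close>

lemma AE_jumps_uniformly_Cauchy:
  assumes A: "A \<in> \<A>" and f[measurable]: "f \<in> borel_measurable m" and sq: "sq_integrable A f"
  shows "AE \<omega> in P. \<forall>c>0. \<exists>\<delta>>0. \<forall>\<epsilon>. 0 < \<epsilon> \<longrightarrow> \<epsilon> < \<delta> \<longrightarrow> (\<forall>A'\<in>{A'\<in>\<A>. A' \<subseteq> A}.
      \<bar>Jeps f \<epsilon> A' \<omega> - Jeps f \<delta> A' \<omega>\<bar> \<le> c)"
    (is "AE \<omega> in P. \<forall>c>0. ?Q \<omega> c")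
  using AE_small_jumps[OF A f sq] AE_finite_jumps[OF A]
proof eventually_elim
  case (elim \<omega>)
  show ?case
  proof (intro allI impI)
    fix c :: real assume "0 < c"
    with elim(1) obtain \<delta> where \<delta>: "0 < \<delta>" "\<delta> \<le> 1" and "\<forall>n. \<forall>A'\<in>insert T (\<A>s n). \<forall>q\<in>\<rat> \<inter> {0<..<\<delta>}.
      \<bar>csum f ((A \<inter> A') \<times> band q \<delta>) \<omega>\<bar> \<le> c"
      by (elim allE[where x = c] impE exE conjE)
    then have le: "\<bar>csum f ((A \<inter> A') \<times> band q \<delta>) \<omega>\<bar> \<le> c"
      if "A' \<in> insert T (\<A>s n)" "q \<in> \<rat> \<inter> {0<..<\<delta>}" for n A' q using that by blast
    have "\<bar>Jeps f \<epsilon> A' \<omega> - Jeps f \<delta> A' \<omega>\<bar> \<le> c"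
      if \<epsilon>: "0 < \<epsilon>" "\<epsilon> < \<delta>" and A': "A' \<in> \<A>" "A' \<subseteq> A" for \<epsilon> A'
    proof -
      \<comment> \<open>The rationals approach \<epsilon> from below because the band contains its
        lower end: a jump of size exactly \<epsilon> must be counted throughout. Staying above
        \<epsilon> / 2 keeps all bands inside one tail, where only finitely many jumps
        occur.\<close>
      have "\<exists>q\<in>\<rat>. max (\<epsilon> / 2) (\<epsilon> - 1 / Suc n) < q \<and> q < \<epsilon>" for n :: nat
        by (rule Rats_dense_in_real) (use \<epsilon> in auto)
      then have "\<forall>n::nat. \<exists>q. q \<in> \<rat> \<and> max (\<epsilon> / 2) (\<epsilon> - 1 / Suc n) < q \<and> q < \<epsilon>" by blast
      then obtain r where "\<forall>n::nat. r n \<in> \<rat> \<and> max (\<epsilon> / 2) (\<epsilon> - 1 / Suc n) < r n \<and> r n < \<epsilon>"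
        unfolding choice_iff by (elim exE)
      then have r: "r n \<in> \<rat>" "max (\<epsilon> / 2) (\<epsilon> - 1 / Suc n) < r n" "r n < \<epsilon>" for n by auto
      define G where "G n = outer_approx T (\<A>s n) A'" for n
      have A'T: "A' \<subseteq> T" using A' indexing_collectionD(1)[OF ic] by blast
      have G: "G n \<in> insert T (\<A>s n)" for n unfolding G_def by (rule outer_approx_mem[OF ic A'T])
      have "(\<lambda>n. csum f ((A \<inter> G n) \<times> band (r n) \<delta>) \<omega>)
         \<longlonglongrightarrow> csum f (A' \<times> band \<epsilon> \<delta>) \<omega>"
      proof (rule compensated_sum_tendsto[where ?W0.0 = "A \<times> tail (\<epsilon> / 2)"])
        show "set_integrable \<mu> (A \<times> tail (\<epsilon> / 2)) (weighted f)"
          unfolding weighted_def using \<epsilon>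
          by (intro set_integrable_prod f_integrable[OF A f sq] int_tail[of "\<epsilon> / 2"]) auto
        show "finite (\<Xi> \<omega> \<inter> A \<times> tail (\<epsilon> / 2))" using elim(2) \<epsilon> by simp
        show "(A \<inter> G n) \<times> band (r n) \<delta> \<in> sets \<mu>" for n
          using \<A>_sets[OF AT_sets[OF A G]] by simp
        show "(A \<inter> G n) \<times> band (r n) \<delta> \<subseteq> A \<times> tail (\<epsilon> / 2)" for n
          using r(2)[of n] by (auto simp: band_def tail_def)
        show "A' \<times> band \<epsilon> \<delta> \<in> sets \<mu>" using \<A>_sets[OF A'(1)] by simp
        show "weighted f \<in> borel_measurable \<mu>" by measurable
        fix z :: "'a \<times> real"
        obtain t x where z: "z = (t, x)" by (cases z)
        have 1: "\<forall>\<^sub>F n in sequentially. t \<in> G n \<longleftrightarrow> t \<in> A'"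
          unfolding G_def by (rule outer_approx_eventually[OF ic A'(1)])
        have 2: "\<forall>\<^sub>F n in sequentially. r n \<le> \<bar>x\<bar> \<longleftrightarrow> \<epsilon> \<le> \<bar>x\<bar>"
        proof (cases "\<epsilon> \<le> \<bar>x\<bar>")
          case True
          have "r n \<le> \<bar>x\<bar>" for n using r(3)[of n] True by linarith
          then show ?thesis using True by simp
        next
          case False
          then have "\<forall>\<^sub>F n in sequentially. 1 / real (Suc n) < \<epsilon> - \<bar>x\<bar>"
            by (intro eventually_inverse_Suc_less) simp
          then show ?thesis
          proof eventually_elim
            case (elim n)
            then have "\<bar>x\<bar> < r n" using r(2)[of n] by simp
            then show ?case using False by simp
          qed
        qed
        show "\<forall>\<^sub>F n in sequentially. z \<in> (A \<inter> G n) \<times> band (r n) \<delta> \<longleftrightarrow> z \<in> A' \<times> band \<epsilon> \<delta>"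
          using 1 2 by eventually_elim (use A'(2) in \<open>auto simp: z band_def\<close>)
      qed
      then have "(\<lambda>n. \<bar>csum f ((A \<inter> G n) \<times> band (r n) \<delta>) \<omega>\<bar>)
         \<longlonglongrightarrow> \<bar>csum f (A' \<times> band \<epsilon> \<delta>) \<omega>\<bar>"
        by (rule tendsto_rabs)
      then have "\<bar>csum f (A' \<times> band \<epsilon> \<delta>) \<omega>\<bar> \<le> c"
      proof (rule LIMSEQ_le_const2, intro exI allI impI)
        fix n
        have "0 < r n" "r n < \<delta>" using r(2,3)[of n] \<epsilon> by auto
        then show "\<bar>csum f ((A \<inter> G n) \<times> band (r n) \<delta>) \<omega>\<bar> \<le> c"
          using r(1) by (intro le[OF G]) auto
      qed
      moreover have "finite (\<Xi> \<omega> \<inter> A' \<times> tail \<epsilon>)"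
        by (rule rev_finite_subset[of "\<Xi> \<omega> \<inter> A \<times> tail \<epsilon>"]) (use elim(2) \<epsilon> A'(2) in auto)
      moreover have "set_integrable m A' f"
        by (rule set_integrable_subset[OF f_integrable[OF A f sq] \<A>_sets[OF A'(1)] A'(2)])
      ultimately show ?thesis using \<epsilon> \<delta> by (simp add: jump_integral_eps_diff)
    qed
    then show "?Q \<omega> c"
      using \<delta>(1) by (intro exI[of _ \<delta>]) auto
  qed
qed

lemma AE_jump_integral_uniform_limit:
  assumes A: "A \<in> \<A>" and f: "f \<in> borel_measurable m" and sq: "sq_integrable A f"
  shows "AE \<omega> in P. uniform_limit {A'\<in>\<A>. A' \<subseteq> A}
    (\<lambda>\<epsilon> A'. Jeps f \<epsilon> A' \<omega>) (\<lambda>A'. JI f A' \<omega>) (at_right 0)"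
  using AE_jumps_uniformly_Cauchy[OF assms]
  unfolding jump_integral_def
  by eventually_elim (rule uniform_limit_at_right_Lim, blast)

end

section \<open>Independence and continuity of the jump integral\<close>

text \<open>Any two sets that agree almost surely are identified, so that almost sure limits of
  \<open>G\<close>-measurable variables stay measurable.\<close>

definition ae_completion :: "'w measure \<Rightarrow> 'w set set \<Rightarrow> 'w measure" where
  "ae_completion P G = sigma (space P) {S. S \<subseteq> space P \<and> (\<exists>S'\<in>G. AE \<omega> in P. \<omega> \<in> S \<longleftrightarrow> \<omega> \<in> S')}"

lemma sets_ae_completion:
  assumes "sigma_algebra (space P) G"
  shows "sets (ae_completion P G) = {S. S \<subseteq> space P \<and> (\<exists>S'\<in>G. AE \<omega> in P. \<omega> \<in> S \<longleftrightarrow> \<omega> \<in> S')}" (is "_ = ?C")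
proof -
  interpret G: sigma_algebra "space P" G by fact
  have "sigma_algebra (space P) ?C"
    unfolding sigma_algebra_iff2
  proof (intro conjI ballI allI impI)
    show "?C \<subseteq> Pow (space P)" by auto
    show "{} \<in> ?C" by auto
    fix S assume "S \<in> ?C"
    then obtain S' where S': "S' \<in> G" "AE \<omega> in P. \<omega> \<in> S \<longleftrightarrow> \<omega> \<in> S'" by auto
    have "AE \<omega> in P. \<omega> \<in> space P - S \<longleftrightarrow> \<omega> \<in> space P - S'"
      using S'(2) by eventually_elim auto
    moreover have "space P - S' \<in> G" using S'(1) by auto
    ultimately show "space P - S \<in> ?C" by blast
  next
    fix F :: "nat \<Rightarrow> _" assume F: "range F \<subseteq> ?C"
    then have "\<forall>n. \<exists>S'. S' \<in> G \<and> (AE \<omega> in P. \<omega> \<in> F n \<longleftrightarrow> \<omega> \<in> S')" by blast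
    then obtain F' where F': "\<forall>n. F' n \<in> G \<and> (AE \<omega> in P. \<omega> \<in> F n \<longleftrightarrow> \<omega> \<in> F' n)"
      unfolding choice_iff by (elim exE)
    have "AE \<omega> in P. \<forall>n. \<omega> \<in> F n \<longleftrightarrow> \<omega> \<in> F' n" unfolding AE_all_countable using F' by simp
    then have "AE \<omega> in P. \<omega> \<in> (\<Union>n. F n) \<longleftrightarrow> \<omega> \<in> (\<Union>n. F' n)" by eventually_elim auto
    moreover have "(\<Union>n. F' n) \<in> G" using F' by auto
    ultimately show "(\<Union>n. F n) \<in> ?C" using F by blast
  qed
  then show ?thesis unfolding ae_completion_def by (rule sigma_algebra.sets_measure_of_eq)
qed

lemma space_ae_completion[simp]: "space (ae_completion P G) = space P"
  unfolding ae_completion_def by (rule space_measure_of) auto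

lemma ae_closed_completion:
  assumes P: "complete_measure P" and G: "sigma_algebra (space P) G" "G \<subseteq> sets P"
  shows "ae_closed P (ae_completion P G)"
proof -
  let ?C = "{S. S \<subseteq> space P \<and> (\<exists>S'\<in>G. AE \<omega> in P. \<omega> \<in> S \<longleftrightarrow> \<omega> \<in> S')}"
  show ?thesis unfolding ae_closed_def sets_ae_completion[OF G(1)]
  proof (intro conjI ballI allI impI)
  show "?C \<subseteq> sets P"
  proof safe
    fix S S' assume S: "S \<subseteq> space P" "S' \<in> G" "AE \<omega> in P. \<omega> \<in> S \<longleftrightarrow> \<omega> \<in> S'"
    have "AE \<omega> in P. \<omega> \<in> S' \<longleftrightarrow> \<omega> \<in> S" using S(3) by eventually_elim auto
    then show "S \<in> sets P" using subsetD[OF G(2) S(2)] S(1) by (rule complete_measure.in_sets_AE[OF P])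
  qed
  fix S R assume S: "S \<in> ?C"
    and R: "R \<subseteq> space P" and eq: "AE \<omega> in P. \<omega> \<in> S \<longleftrightarrow> \<omega> \<in> R"
  obtain S' where S': "S' \<in> G" "AE \<omega> in P. \<omega> \<in> S \<longleftrightarrow> \<omega> \<in> S'" using S by auto
  have "AE \<omega> in P. \<omega> \<in> R \<longleftrightarrow> \<omega> \<in> S'" using S'(2) eq by eventually_elim auto
  then show "R \<in> ?C" using R S'(1) by blast
qed simp
qed

lemma sigma_algebra_process_sigma: "sigma_algebra (space P) (process_sigma P I Z)"
proof -
  have "space (vimage_algebra (space P) (\<lambda>\<omega>. \<lambda>i\<in>I. Z i \<omega>) (PiM I (\<lambda>_. borel))) = space P" by simp
  then show ?thesis unfolding process_sigma_def by (metis sets.sigma_algebra_axioms)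
qed

lemma process_sigma_measurable:
  fixes Z :: "'i \<Rightarrow> 'w \<Rightarrow> 'c::topological_space"
  assumes "i \<in> I"
  shows "Z i \<in> borel_measurable (ae_completion P (process_sigma P I Z))"
proof -
  let ?V = "vimage_algebra (space P) (\<lambda>\<omega>. \<lambda>i\<in>I. Z i \<omega>) (PiM I (\<lambda>_. borel))"
  have "(\<lambda>\<omega>. \<lambda>i\<in>I. Z i \<omega>) \<in> measurable ?V (PiM I (\<lambda>_. borel))"
    by (rule measurable_vimage_algebra1) (auto simp: space_PiM)
  from measurable_compose[OF this measurable_component_singleton[OF assms]]
  have Z: "Z i \<in> borel_measurable ?V" using assms by simp
  show ?thesis
  proof (rule measurableI)
    fix B :: "'c set" assume "B \<in> sets borel"
    with Z have "Z i -` B \<inter> space ?V \<in> sets ?V" by (rule measurable_sets)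
    then have "Z i -` B \<inter> space P \<in> process_sigma P I Z" by (simp add: process_sigma_def)
    then show "Z i -` B \<inter> space (ae_completion P (process_sigma P I Z))
       \<in> sets (ae_completion P (process_sigma P I Z))"
      unfolding sets_ae_completion[OF sigma_algebra_process_sigma] space_ae_completion
      by (intro CollectI conjI bexI[of _ "Z i -` B \<inter> space P"]) (rule Int_lower2, simp, assumption)
  qed simp
qed

section \<open>Independence of completed \<sigma>-algebras and of a triple with a constant
  entry\<close>

context prob_space
begin

text \<open>Each set of a completion agrees almost surely with one of the original \<sigma>-algebra,
  and the product formula only sees probabilities.\<close>

lemma indep_set_ae_completion:
  assumes P: "complete_measure M" and ind: "indep_set G H"
    and G: "sigma_algebra (space M) G" and H: "sigma_algebra (space M) H"
  shows "indep_set (sets (ae_completion M G)) (sets (ae_completion M H))"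
proof (rule indep_setI)
  note GH = indep_setD_ev1[OF ind] indep_setD_ev2[OF ind]
  note c = ae_closed_completion[OF P G GH(1)] ae_closed_completion[OF P H GH(2)]
  show "sets (ae_completion M G) \<subseteq> events" "sets (ae_completion M H) \<subseteq> events"
    using c by (auto simp: ae_closed_def)
  fix a b assume ab: "a \<in> sets (ae_completion M G)" "b \<in> sets (ae_completion M H)"
  then have ev: "a \<in> events" "b \<in> events" using c by (auto simp: ae_closed_def)
  obtain a' where a': "a' \<in> G" "AE \<omega> in M. \<omega> \<in> a \<longleftrightarrow> \<omega> \<in> a'"
    using ab(1) unfolding sets_ae_completion[OF G] by auto
  obtain b' where b': "b' \<in> H" "AE \<omega> in M. \<omega> \<in> b \<longleftrightarrow> \<omega> \<in> b'"
    using ab(2) unfolding sets_ae_completion[OF H] by auto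
  have ev': "a' \<in> events" "b' \<in> events" using a' b' GH by auto
  have "prob a = prob a'" "prob b = prob b'"
    using a' b' ev ev' by (auto intro: finite_measure_eq_AE)
  moreover have "prob (a \<inter> b) = prob (a' \<inter> b')"
  proof (rule finite_measure_eq_AE)
    show "AE \<omega> in M. \<omega> \<in> a \<inter> b \<longleftrightarrow> \<omega> \<in> a' \<inter> b'"
      using a'(2) b'(2) by eventually_elim auto
  qed (use ev ev' in auto)
  moreover have "prob (a' \<inter> b') = prob a' * prob b'" by (rule indep_setD[OF ind a'(1) b'(1)])
  ultimately show "prob (a \<inter> b) = prob a * prob b" by simp
qed

text \<open>Preimages under a constant are empty or the whole space, so independence of the triple
  reduces to that of the last two entries. The drift process is such a constant. Each family
  contains the whole space, so checking the product formula over all three indices is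
  enough.\<close>

lemma indep_vars_const_pair:
  assumes ind: "indep_set (sets N1) (sets N2)" and sp: "space N1 = space M" "space N2 = space M"
    and x: "x \<in> space L" and X: "X1 \<in> measurable N1 L" "X2 \<in> measurable N2 L"
  shows "indep_vars (\<lambda>_. L) (\<lambda>i \<omega>. [x, X1 \<omega>, X2 \<omega>] ! i) {..<3::nat}"
proof -
  note ev = indep_setD_ev1[OF ind] indep_setD_ev2[OF ind]
  have pre: "X1 -` A \<inter> space M \<in> sets N1" "X2 -` A \<inter> space M \<in> sets N2" if "A \<in> sets L" for A
    using measurable_sets[OF X(1) that] measurable_sets[OF X(2) that] sp by auto
  have XM: "X1 \<in> measurable M L" "X2 \<in> measurable M L"
    using X sp pre ev by (auto simp: measurable_def)
  have I: "{..<3::nat} = {0, 1, 2}" by auto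
  let ?F = "\<lambda>i. {(\<lambda>\<omega>. [x, X1 \<omega>, X2 \<omega>] ! i) -` A \<inter> space M | A. A \<in> sets L}"
  have rv: "(\<lambda>\<omega>. [x, X1 \<omega>, X2 \<omega>] ! i) \<in> measurable M L" if "i \<in> {..<3}" for i
    using that XM x unfolding I by auto
  have "indep_sets ?F {..<3}"
  proof (subst indep_sets_finite)
    show "{..<3::nat} \<noteq> {}" "finite {..<3::nat}" by (simp_all add: I)
    show "?F i \<subseteq> events" if "i \<in> {..<3}" for i
      using measurable_sets[OF rv[OF that]] by auto
    show "space M \<in> ?F i" if "i \<in> {..<3}" for i
      using measurable_space[OF rv[OF that]] by (auto intro!: exI[of _ "space L"])
    show "\<forall>A\<in>Pi {..<3} ?F. prob (\<Inter>j\<in>{..<3}. A j) = (\<Prod>j\<in>{..<3}. prob (A j))"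
    proof
      fix A assume A: "A \<in> Pi {..<3} ?F"
      have pre_ex: "\<exists>B. B \<in> sets L \<and> A i = (\<lambda>\<omega>. [x, X1 \<omega>, X2 \<omega>] ! i) -` B \<inter> space M" if "i < 3" for i
        using Pi_mem[OF A, of i] that by blast
      from pre_ex[of 0] obtain B0 where B0: "B0 \<in> sets L" "A 0 = (\<lambda>\<omega>. x) -` B0 \<inter> space M" by auto
      from pre_ex[of 1] obtain B1 where B1: "B1 \<in> sets L" "A 1 = X1 -` B1 \<inter> space M" by auto
      from pre_ex[of 2] obtain B2 where B2: "B2 \<in> sets L" "A 2 = X2 -` B2 \<inter> space M" by auto
      have 12: "prob (A 1 \<inter> A 2) = prob (A 1) * prob (A 2)"
        unfolding B1 B2 by (intro indep_setD[OF ind] pre B1 B2)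
      have "prob (A 0 \<inter> (A 1 \<inter> A 2)) = prob (A 0) * prob (A 1 \<inter> A 2)"
      proof (cases "x \<in> B0")
        case True
        then have "A 0 = space M" "A 0 \<inter> (A 1 \<inter> A 2) = A 1 \<inter> A 2" unfolding B0 B1 by auto
        then show ?thesis by (simp add: prob_space)
      next
        case False
        then have "A 0 = {}" using B0 by auto
        then show ?thesis by simp
      qed
      then show "prob (\<Inter>j\<in>{..<3}. A j) = (\<Prod>j\<in>{..<3}. prob (A j))"
        unfolding I using 12 by (simp add: Int_assoc mult.assoc)
    qed
  qed
  then show ?thesis unfolding indep_vars_def2 using rv by auto
qed

end

section \<open>Measurability, linearity and continuity of the jump integral\<close>

context levy_jumps
begin

text \<open>A sequence of truncation levels replaces the continuous parameter, since measurability
  and probability bounds pass to limits along sequences.\<close>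

lemma AE_jump_integral_tendsto:
  assumes A: "A \<in> \<A>" and f: "f \<in> borel_measurable m" and sq: "sq_integrable A f"
  shows "AE \<omega> in P. (\<lambda>n. Jeps f (1 / Suc n) A \<omega>) \<longlonglongrightarrow> JI f A \<omega>"
  using AE_jump_integral_uniform_limit[OF assms]
proof eventually_elim
  case (elim \<omega>)
  have "((\<lambda>\<epsilon>. Jeps f \<epsilon> A \<omega>) \<longlongrightarrow> JI f A \<omega>) (at_right 0)"
    by (rule tendsto_uniform_limitI[OF elim]) (use A in simp)
  moreover have "filterlim (\<lambda>n. 1 / real (Suc n)) (at_right 0) sequentially"
    using LIMSEQ_inverse_real_of_nat by (auto simp: filterlim_at inverse_eq_divide)
  ultimately show ?case by (rule filterlim_compose)
qed

lemma jump_integral_eps_measurable: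
  assumes N: "\<And>D. D \<in> sets \<mu> \<Longrightarrow> point_count \<Xi> D \<in> borel_measurable N" and sp: "space N = space P"
    and A: "A \<in> \<A>" and f: "f \<in> borel_measurable m"
  shows "Jeps f a A \<in> borel_measurable N"
proof -
  have "(\<lambda>\<omega>. \<Sum>z\<in>\<Xi> \<omega> \<inter> A \<times> tail a. weighted f z) \<in> borel_measurable N"
    by (rule measurable_point_sum[OF N _ weighted_measurable[OF f]])
       (use A sp poisson_random_setD(2)[OF poisson] in auto)
  then show ?thesis
    unfolding jump_integral_eps_def[abs_def] jumps_set_eq unfolding weighted_def by simp
qed

lemma jump_integral_measurable:
  assumes cl: "ae_closed P N" and N: "\<And>D. D \<in> sets \<mu> \<Longrightarrow> point_count \<Xi> D \<in> borel_measurable N"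
    and A: "A \<in> \<A>" and f: "f \<in> borel_measurable m" and sq: "sq_integrable A f"
  shows "JI f A \<in> borel_measurable N"
  by (rule ae_closed_lim[OF cl _ AE_jump_integral_tendsto[OF A f sq]])
     (use cl in \<open>auto intro!: jump_integral_eps_measurable N A f simp: ae_closed_def\<close>)

lemma jump_integral_eps_linear:
  assumes "set_integrable m A g" "set_integrable m A h"
  shows "Jeps (\<lambda>t. a * g t + c * h t) \<epsilon> A \<omega>
    = a * Jeps g \<epsilon> A \<omega> + c * Jeps h \<epsilon> A \<omega>"
proof -
  have "(LINT t:A|m. a * g t + c * h t) = a * (LINT t:A|m. g t) + c * (LINT t:A|m. h t)"
    using assms by (subst set_integral_add) auto
  moreover have "(\<Sum>(t, J)\<in>S. (a * g t + c * h t) * J) = a * (\<Sum>(t, J)\<in>S. g t * J) + c * (\<Sum>(t, J)\<in>S. h t * J)" for S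
    by (simp add: sum_distrib_left sum.distrib[symmetric] split_beta algebra_simps)
  moreover have "a * s1 + c * s2 - (a * i1 + c * i2) * k = a * (s1 - i1 * k) + c * (s2 - i2 * k)"
    for s1 s2 i1 i2 k :: real by (simp add: algebra_simps)
  ultimately show ?thesis unfolding jump_integral_eps_def by (simp only:)
qed

text \<open>Linearity is exact at each truncation level but only almost sure in the limit, because
  \<open>Lim\<close> is linear only where the limits exist. The null set depends on the
  functions.\<close>

lemma AE_jump_integral_linear:
  assumes A: "A \<in> \<A>" and g: "g \<in> borel_measurable m" "sq_integrable A g"
    and h: "h \<in> borel_measurable m" "sq_integrable A h"
    and gh: "set_integrable m A (\<lambda>t. (a * g t + c * h t)\<^sup>2)"
  shows "AE \<omega> in P. JI (\<lambda>t. a * g t + c * h t) A \<omega>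
    = a * JI g A \<omega> + c * JI h A \<omega>"
proof -
  have m: "(\<lambda>t. a * g t + c * h t) \<in> borel_measurable m" using g h by measurable
  show ?thesis
    using AE_jump_integral_tendsto[OF A m gh] AE_jump_integral_tendsto[OF A g] AE_jump_integral_tendsto[OF A h]
  proof eventually_elim
    case (elim \<omega>)
    have "(\<lambda>n. Jeps (\<lambda>t. a * g t + c * h t) (1 / Suc n) A \<omega>) \<longlonglongrightarrow>
      a * JI g A \<omega> + c * JI h A \<omega>"
      unfolding jump_integral_eps_linear[OF f_integrable[OF A g] f_integrable[OF A h]]
      by (intro tendsto_intros elim)
    then show ?case using elim(1) by (rule LIMSEQ_unique[rotated])
  qed
qed

lemma jump_integral_eps_cong:
  "(\<And>t. t \<in> A \<Longrightarrow> f t = g t) \<Longrightarrow> Jeps f \<epsilon> A \<omega> = Jeps g \<epsilon> A \<omega>"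
  unfolding jump_integral_eps_def
  by (intro arg_cong2[where f = "(-)"] arg_cong2[where f = "(*)"] sum.cong refl)
     (auto simp: set_lebesgue_integral_def intro!: Bochner_Integration.integral_cong split: split_indicator)

lemma jump_integral_mult_indicator:
  "JI (\<lambda>t. f t * indicator A t) A \<omega> = JI f A \<omega>"
  unfolding jump_integral_def by (simp cong: jump_integral_eps_cong)

text \<open>Finiteness of the jumps over \<open>A\<close> is essential: otherwise the sum over
  \<open>A\<close> would be \<open>0\<close> by convention while the sum over \<open>A'\<close>
  could still be finite and nonzero.\<close>

lemma AE_jump_integral_indicator:
  assumes A: "A \<in> \<A>" and A': "A' \<subseteq> A"
  shows "AE \<omega> in P. JI (indicator A') A \<omega> = JI (\<lambda>_. 1) A' \<omega>"
  using AE_finite_jumps[OF A]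
proof eventually_elim
  case (elim \<omega>)
  have eq: "Jeps (indicator A') \<epsilon> A \<omega> = Jeps (\<lambda>_. 1) \<epsilon> A' \<omega>"
    if "0 < \<epsilon>" for \<epsilon>
  proof -
    have "(\<Sum>(t, J)\<in>\<Xi> \<omega> \<inter> A \<times> tail \<epsilon>. indicator A' t * J) = (\<Sum>(t, J)\<in>\<Xi> \<omega> \<inter> A' \<times> tail \<epsilon>. 1 * J)"
      using elim that A' by (intro sum.mono_neutral_cong_right) (auto simp: indicator_def split: if_splits)
    moreover have "(LINT t:A|m. indicator A' t) = (LINT t:A'|m. (1::real))"
      unfolding set_lebesgue_integral_def
      by (intro Bochner_Integration.integral_cong refl) (use A' in \<open>auto simp: indicator_def\<close>)
    ultimately show ?thesis unfolding jump_integral_eps_def jumps_set_eq by (simp only:)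
  qed
  show ?case unfolding jump_integral_def
    by (rule Lim_cong) (use eq in \<open>auto intro!: eventually_at_right_less[THEN eventually_mono]\<close>)
qed

text \<open>At each truncation level this is the second-moment bound for a single compensated sum,
  made uniform by replacing the variance over the tail by the full second moment of \<nu>. The
  subtracted term is the mean contributed by jumps larger than 1.\<close>

lemma jump_integral_prob_bound:
  assumes A: "A \<in> \<A>" and f: "f \<in> borel_measurable m" and sq: "sq_integrable A f"
    and comp: "complete_measure P" and l: "l > 0"
  shows "prob {\<omega> \<in> space P. \<bar>JI f A \<omega> - (LINT t:A|m. f t) * (LINT x:{x. 1 < \<bar>x\<bar>}|\<nu>. x)\<bar> > l}
    \<le> (LINT t:A|m. (f t)\<^sup>2) * (LINT x|\<nu>. x\<^sup>2) / l\<^sup>2"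
proof (rule prob_AE_limit_le)
  let ?k = "(LINT t:A|m. f t) * (LINT x:{x. 1 < \<bar>x\<bar>}|\<nu>. x)"
  let ?Z = "\<lambda>n \<omega>. Jeps f (1 / real (Suc n)) A \<omega> - ?k"
  note pc = poisson_random_setD(3)[OF poisson]
  show "?Z n \<in> borel_measurable P" for n
    by (intro borel_measurable_diff jump_integral_eps_measurable pc A f) auto
  show "(\<lambda>\<omega>. JI f A \<omega> - ?k) \<in> borel_measurable P"
    by (intro borel_measurable_diff jump_integral_measurable[OF ae_closed_self[OF comp] pc A f sq]) auto
  show "AE \<omega> in P. (\<lambda>n. ?Z n \<omega>) \<longlonglongrightarrow> JI f A \<omega> - ?k"
    using AE_jump_integral_tendsto[OF A f sq] by eventually_elim (intro tendsto_intros)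
  show "prob {\<omega> \<in> space P. \<bar>?Z n \<omega>\<bar> > l} \<le> (LINT t:A|m. (f t)\<^sup>2) * (LINT x|\<nu>. x\<^sup>2) / l\<^sup>2" for n
  proof -
    let ?a = "1 / real (Suc n)"
    have a: "0 < ?a" "?a \<le> 1" by auto
    let ?E = "A \<times> tail ?a"
    have Em: "?E \<in> sets \<mu>" using A by auto
    note w = weighted_sq_integral[OF sq band_tail_sets(2)[of ?a]]
    \<comment> \<open>The maximal inequality with no orders and one set: the coordinate condition is
      vacuous and the factor \<open>2 ^ 0\<close> is one.\<close>
    have "prob {\<omega> \<in> space P. \<exists>W\<in>{?E}. \<bar>csum f W \<omega>\<bar> > 2 ^ 0 * l}
      \<le> 2 ^ 0 * (LINT z:?E|\<mu>. (weighted f z)\<^sup>2) / l\<^sup>2"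
      by (rule compensated_sum_maximal[OF poisson Em fin_prod[OF A a(1)] weighted_measurable[OF f] w(1) _ _ _ _ l,
          where \<phi> = "\<lambda>_ _. 0" and \<kappa> = "\<lambda>_ _. 0"]) (use Em in auto)
    moreover have "(LINT x:tail ?a|\<nu>. x\<^sup>2) \<le> (LINT x|\<nu>. x\<^sup>2)"
      unfolding set_lebesgue_integral_def
      using sq_int_\<nu>[OF band_tail_sets(2)[of ?a]] sq_\<nu>
      by (intro integral_mono) (auto simp: set_integrable_def indicator_def)
    then have "(LINT t:A|m. (f t)\<^sup>2) * (LINT x:tail ?a|\<nu>. x\<^sup>2) / l\<^sup>2 \<le> (LINT t:A|m. (f t)\<^sup>2) * (LINT x|\<nu>. x\<^sup>2) / l\<^sup>2"
      by (intro divide_right_mono mult_left_mono)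
         (auto simp: set_lebesgue_integral_def intro!: Bochner_Integration.integral_nonneg)
    ultimately show ?thesis
      unfolding jump_integral_eps_centered[OF a f_integrable[OF A f sq]] w(2) by simp
  qed
qed

text \<open>By linearity only the differences \<open>U n\<close> have to be considered. Their
  centred jump integrals tend to zero in probability because the square norms do, and the subtracted
  means because the integrals do.\<close>

lemma conv_prob_jump_integral:
  assumes A: "A \<in> \<A>" and comp: "complete_measure P"
    and G: "\<And>n. G n \<in> borel_measurable m" "\<And>n. set_integrable m A (\<lambda>t. (G n t)\<^sup>2)"
    and g: "g \<in> borel_measurable m" "sq_integrable A g"
    and u: "\<And>n. set_integrable m A (\<lambda>t. (G n t - g t)\<^sup>2)"
    and lim1: "(\<lambda>n. LINT t:A|m. G n t - g t) \<longlonglongrightarrow> 0"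
    and lim2: "(\<lambda>n. LINT t:A|m. (G n t - g t)\<^sup>2) \<longlonglongrightarrow> 0"
  shows "conv_prob (\<lambda>n. JI (G n) A) (JI g A)"
proof -
  define c where "c = (LINT x:{x. 1 < \<bar>x\<bar>}|\<nu>. x)"
  define U where "U n t = G n t - g t" for n t
  have Um: "U n \<in> borel_measurable m" for n unfolding U_def using G(1) g(1) by measurable
  have Us: "set_integrable m A (\<lambda>t. (U n t)\<^sup>2)" for n unfolding U_def by (rule u)
  have Jm: "JI h A \<in> borel_measurable P"
    if "h \<in> borel_measurable m" "sq_integrable A h" for h
    by (rule jump_integral_measurable[OF ae_closed_self[OF comp] poisson_random_setD(3)[OF poisson] A that])
  have "conv_prob (\<lambda>n \<omega>. JI (U n) A \<omega> - (LINT t:A|m. U n t) * c) (\<lambda>_. 0)"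
  proof (rule conv_probI)
    show "(\<lambda>\<omega>. JI (U n) A \<omega> - (LINT t:A|m. U n t) * c) \<in> borel_measurable P" for n
      using Jm[OF Um Us] by measurable
    show "prob {\<omega> \<in> space P. \<bar>JI (U n) A \<omega> - (LINT t:A|m. U n t) * c - 0\<bar> > l}
      \<le> (LINT t:A|m. (U n t)\<^sup>2) * (LINT x|\<nu>. x\<^sup>2) / l\<^sup>2" if "l > 0" for l n
      using jump_integral_prob_bound[OF A Um Us comp that] by (simp add: c_def)
    show "(\<lambda>n. (LINT t:A|m. (U n t)\<^sup>2) * (LINT x|\<nu>. x\<^sup>2) / l\<^sup>2) \<longlonglongrightarrow> 0" if "l > 0" for l
      using tendsto_divide[OF tendsto_mult[OF lim2 tendsto_const[of "LINT x|\<nu>. x\<^sup>2"]] tendsto_const[of "l\<^sup>2"]] that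
      by (simp add: U_def)
  qed simp
  moreover have "conv_prob (\<lambda>n _. (LINT t:A|m. U n t) * c) (\<lambda>_. 0)"
    using tendsto_mult[OF lim1 tendsto_const[of c]] by (intro conv_prob_real) (simp add: U_def)
  moreover have "conv_prob (\<lambda>_. JI g A) (JI g A)"
    by (rule conv_prob_const[OF Jm[OF g]])
  ultimately have "conv_prob (\<lambda>n \<omega>. (JI (U n) A \<omega> - (LINT t:A|m. U n t) * c)
      + (LINT t:A|m. U n t) * c + JI g A \<omega>) (\<lambda>\<omega>. 0 + 0 + JI g A \<omega>)"
    by (intro conv_prob_add)
  then have "conv_prob (\<lambda>n \<omega>. JI (U n) A \<omega> + JI g A \<omega>) (JI g A)"
    by simp
  then show ?thesis
  proof (rule conv_prob_AE_cong)
    show "AE \<omega> in P. JI (U n) A \<omega> + JI g A \<omega> = JI (G n) A \<omega>" for n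
    proof -
      have "U n = (\<lambda>t. G n t - g t)" by (simp add: fun_eq_iff U_def)
      then show ?thesis
        using AE_jump_integral_linear[OF A Um Us g, of 1 n 1] G(2)[of n] by (auto elim: eventually_mono)
    qed
    show "JI (G n) A \<in> borel_measurable P" for n by (rule Jm[OF G])
  qed
qed

end

section \<open>The stochastic integral\<close>

text \<open>In \<open>ennreal\<close> zero times infinity is zero, so a vanishing coefficient
  removes the corresponding integrability condition. The degenerate case of the decomposition has
  its origin here.\<close>

lemma LX_space_iff:
  "g \<in> LX_space m b \<sigma> \<nu> \<longleftrightarrow> g \<in> borel_measurable m \<and>
    (b + (LINT x:{x. \<bar>x\<bar> > 1}|\<nu>. x) = 0 \<or> (\<integral>\<^sup>+t. ennreal \<bar>g t\<bar> \<partial>m) < \<infinity>) \<and>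
    (\<sigma>\<^sup>2 + (LINT x|\<nu>. x\<^sup>2) = 0 \<or> (\<integral>\<^sup>+t. ennreal ((g t)\<^sup>2) \<partial>m) < \<infinity>)"
proof -
  have "0 \<le> \<sigma>\<^sup>2 + (LINT x|\<nu>. x\<^sup>2)"
    by (intro add_nonneg_nonneg Bochner_Integration.integral_nonneg) auto
  then have 1: "ennreal (\<sigma>\<^sup>2 + (LINT x|\<nu>. x\<^sup>2)) = 0 \<longleftrightarrow> \<sigma>\<^sup>2 + (LINT x|\<nu>. x\<^sup>2) = 0"
    by (simp only: ennreal_eq_0_iff) linarith
  have 2: "ennreal ((b + (LINT x:{x. \<bar>x\<bar> > 1}|\<nu>. x))\<^sup>2) = 0 \<longleftrightarrow> b + (LINT x:{x. \<bar>x\<bar> > 1}|\<nu>. x) = 0"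
    by simp
  show ?thesis
    unfolding LX_space_def LX_norm_sq_def mem_Collect_eq ennreal_add_less_top ennreal_mult_less_top
      infinity_ennreal_def power_less_top_ennreal 1 2
    by (auto simp: power2_eq_square ennreal_mult_less_top)
qed

text \<open>Dominated convergence in each of the two terms of the norm. A zero coefficient is
  treated apart, since the matching norm of \<open>h\<close> may then be infinite while the product
  is still zero.\<close>

lemma LX_norm_tendsto_0:
  assumes h: "h \<in> LX_space m b \<sigma> \<nu>" and dl: "dominated_limit m G g h"
  shows "\<And>n. G n \<in> LX_space m b \<sigma> \<nu>" and "g \<in> LX_space m b \<sigma> \<nu>"
    and "(\<lambda>n. LX_norm_sq m b \<sigma> \<nu> (\<lambda>t. G n t - g t)) \<longlonglongrightarrow> 0"
proof -
  note G[measurable] = dominated_limitD(1)[OF dl] and g[measurable] = dominated_limitD(2)[OF dl]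
    and lim = dominated_limitD(3)[OF dl] and le = dominated_limitD(4)[OF dl] and gle = dominated_limitD(5)[OF dl]
  have hm[measurable]: "h \<in> borel_measurable m" using h by (simp add: LX_space_iff)
  have dom: "u \<in> LX_space m b \<sigma> \<nu>" if u: "u \<in> borel_measurable m" and ul: "\<And>t. t \<in> space m \<Longrightarrow> \<bar>u t\<bar> \<le> h t" for u
  proof -
    have "(\<integral>\<^sup>+t. ennreal \<bar>u t\<bar> \<partial>m) \<le> (\<integral>\<^sup>+t. ennreal \<bar>h t\<bar> \<partial>m)"
      using ul by (intro nn_integral_mono ennreal_leI) (meson abs_ge_self order_trans)
    moreover have "(\<integral>\<^sup>+t. ennreal ((u t)\<^sup>2) \<partial>m) \<le> (\<integral>\<^sup>+t. ennreal ((h t)\<^sup>2) \<partial>m)"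
      using ul by (intro nn_integral_mono ennreal_leI) (simp add: abs_le_square_iff[symmetric], meson abs_ge_self order_trans)
    ultimately show ?thesis using h u unfolding LX_space_iff by (auto intro: le_less_trans)
  qed
  show "\<And>n. G n \<in> LX_space m b \<sigma> \<nu>" by (rule dom[OF G le])
  show "g \<in> LX_space m b \<sigma> \<nu>" by (rule dom[OF g gle])
  let ?\<alpha> = "b + (LINT x:{x. \<bar>x\<bar> > 1}|\<nu>. x)" and ?\<beta> = "\<sigma>\<^sup>2 + (LINT x|\<nu>. x\<^sup>2)"
  have diff: "\<bar>G n t - g t\<bar> \<le> 2 * \<bar>h t\<bar>" if "t \<in> space m" for n t
    using le[OF that, of n] gle[OF that] by linarith
  have 1: "(\<lambda>n. ennreal (?\<alpha>\<^sup>2) * (\<integral>\<^sup>+t. ennreal \<bar>G n t - g t\<bar> \<partial>m)\<^sup>2) \<longlonglongrightarrow> 0"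
  proof (cases "?\<alpha> = 0")
    case False
    then have fin: "(\<integral>\<^sup>+t. ennreal \<bar>h t\<bar> \<partial>m) < \<infinity>" using h by (auto simp: LX_space_iff)
    have "(\<lambda>n. \<integral>\<^sup>+t. ennreal \<bar>G n t - g t\<bar> \<partial>m) \<longlonglongrightarrow> (\<integral>\<^sup>+t. 0 \<partial>m)"
    proof (rule nn_integral_dominated_convergence[where w = "\<lambda>t. 2 * ennreal \<bar>h t\<bar>"])
      show "AE t in m. ennreal \<bar>G n t - g t\<bar> \<le> 2 * ennreal \<bar>h t\<bar>" for n
        using diff by (intro AE_I2) (simp add: ennreal_mult'[symmetric] ennreal_leI flip: ennreal_numeral)
      show "(\<integral>\<^sup>+t. 2 * ennreal \<bar>h t\<bar> \<partial>m) < \<infinity>"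
        using fin by (simp add: nn_integral_cmult ennreal_mult_less_top)
      show "AE t in m. (\<lambda>n. ennreal \<bar>G n t - g t\<bar>) \<longlonglongrightarrow> 0"
      proof (rule AE_I2)
        fix t assume "t \<in> space m"
        from tendsto_rabs[OF tendsto_diff[OF lim[OF this] tendsto_const[of "g t"]]]
        show "(\<lambda>n. ennreal \<bar>G n t - g t\<bar>) \<longlonglongrightarrow> 0" by (intro tendsto_ennrealI[where x = 0, simplified]) simp
      qed
    qed measurable
    then have "(\<lambda>n. \<integral>\<^sup>+t. ennreal \<bar>G n t - g t\<bar> \<partial>m) \<longlonglongrightarrow> 0" by simp
    from ennreal_tendsto_cmult[OF _ tendsto_mult_ennreal[OF this this], of "ennreal (?\<alpha>\<^sup>2)"]
    show ?thesis by (simp add: power2_eq_square)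
  qed simp
  have 2: "(\<lambda>n. ennreal ?\<beta> * (\<integral>\<^sup>+t. ennreal ((G n t - g t)\<^sup>2) \<partial>m)) \<longlonglongrightarrow> 0"
  proof (cases "?\<beta> = 0")
    case False
    then have fin: "(\<integral>\<^sup>+t. ennreal ((h t)\<^sup>2) \<partial>m) < \<infinity>" using h by (auto simp: LX_space_iff)
    have "(\<lambda>n. \<integral>\<^sup>+t. ennreal ((G n t - g t)\<^sup>2) \<partial>m) \<longlonglongrightarrow> (\<integral>\<^sup>+t. 0 \<partial>m)"
    proof (rule nn_integral_dominated_convergence[where w = "\<lambda>t. 4 * ennreal ((h t)\<^sup>2)"])
      show "AE t in m. ennreal ((G n t - g t)\<^sup>2) \<le> 4 * ennreal ((h t)\<^sup>2)" for n
      proof (rule AE_I2)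
        fix t assume "t \<in> space m"
        from power_mono[OF diff[OF this, of n], of 2] have "(G n t - g t)\<^sup>2 \<le> 4 * (h t)\<^sup>2"
          by (simp add: power_mult_distrib)
        then show "ennreal ((G n t - g t)\<^sup>2) \<le> 4 * ennreal ((h t)\<^sup>2)"
          by (simp add: ennreal_mult'[symmetric] ennreal_leI flip: ennreal_numeral)
      qed
      show "(\<integral>\<^sup>+t. 4 * ennreal ((h t)\<^sup>2) \<partial>m) < \<infinity>"
        using fin by (simp add: nn_integral_cmult ennreal_mult_less_top)
      show "AE t in m. (\<lambda>n. ennreal ((G n t - g t)\<^sup>2)) \<longlonglongrightarrow> 0"
      proof (rule AE_I2)
        fix t assume "t \<in> space m"
        from tendsto_power[OF tendsto_diff[OF lim[OF this] tendsto_const[of "g t"]], of 2]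
        show "(\<lambda>n. ennreal ((G n t - g t)\<^sup>2)) \<longlonglongrightarrow> 0" by (intro tendsto_ennrealI[where x = 0, simplified]) simp
      qed
    qed measurable
    then have "(\<lambda>n. \<integral>\<^sup>+t. ennreal ((G n t - g t)\<^sup>2) \<partial>m) \<longlonglongrightarrow> 0" by simp
    from ennreal_tendsto_cmult[OF _ this, of "ennreal ?\<beta>"] show ?thesis by simp
  qed simp
  show "(\<lambda>n. LX_norm_sq m b \<sigma> \<nu> (\<lambda>t. G n t - g t)) \<longlonglongrightarrow> 0"
    using tendsto_add[OF 1 2] unfolding LX_norm_sq_def by simp
qed

text \<open>Provides the dominating function that arises when a function of L(X) is approximated by
  simple functions.\<close>

lemma LX_space_mult_abs:
  assumes "g \<in> LX_space m b \<sigma> \<nu>" shows "(\<lambda>t. 2 * \<bar>g t\<bar>) \<in> LX_space m b \<sigma> \<nu>"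
proof -
  have [measurable]: "g \<in> borel_measurable m" using assms by (simp add: LX_space_iff)
  have "(\<integral>\<^sup>+t. ennreal \<bar>2 * \<bar>g t\<bar>\<bar> \<partial>m) = 2 * (\<integral>\<^sup>+t. ennreal \<bar>g t\<bar> \<partial>m)"
    by (subst nn_integral_cmult[symmetric]) (simp_all add: ennreal_mult' abs_mult)
  moreover have "(\<integral>\<^sup>+t. ennreal ((2 * \<bar>g t\<bar>)\<^sup>2) \<partial>m) = 4 * (\<integral>\<^sup>+t. ennreal ((g t)\<^sup>2) \<partial>m)"
    by (subst nn_integral_cmult[symmetric]) (simp_all add: ennreal_mult' power_mult_distrib)
  ultimately show ?thesis using assms by (auto simp: LX_space_iff ennreal_mult_less_top)
qed

section \<open>Consequences of the defining properties of the stochastic integral\<close>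

context
  fixes P :: "'w measure" and m :: "'a measure" and \<A> :: "'a set set" and b \<sigma> :: real and \<nu> :: "real measure"
    and X :: "'a set \<Rightarrow> 'w \<Rightarrow> real" and \<Phi> :: "('a \<Rightarrow> real) \<Rightarrow> 'w \<Rightarrow> real"
  assumes si: "stochastic_integral P m \<A> b \<sigma> \<nu> X \<Phi>"
begin

lemma stochastic_integralD:
  shows "g \<in> LX_space m b \<sigma> \<nu> \<Longrightarrow> \<Phi> g \<in> borel_measurable P"
    and "g \<in> LX_space m b \<sigma> \<nu> \<Longrightarrow> integrable P (\<lambda>\<omega>. (\<Phi> g \<omega>)\<^sup>2)"
    and "g \<in> LX_space m b \<sigma> \<nu> \<Longrightarrow> h \<in> LX_space m b \<sigma> \<nu> \<Longrightarrow>
      AE \<omega> in P. \<Phi> (\<lambda>t. a * g t + c * h t) \<omega> = a * \<Phi> g \<omega> + c * \<Phi> h \<omega>"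
    and "g \<in> LX_space m b \<sigma> \<nu> \<Longrightarrow> (\<And>n. G n \<in> LX_space m b \<sigma> \<nu>) \<Longrightarrow>
      (\<lambda>n. LX_norm_sq m b \<sigma> \<nu> (\<lambda>t. G n t - g t)) \<longlonglongrightarrow> 0 \<Longrightarrow>
      (\<lambda>n. LINT \<omega>|P. (\<Phi> (G n) \<omega> - \<Phi> g \<omega>)\<^sup>2) \<longlonglongrightarrow> 0"
    and "A \<in> \<A> \<Longrightarrow> AE \<omega> in P. \<Phi> (indicator A) \<omega> = X A \<omega>"
  using si unfolding stochastic_integral_def by (blast, blast, blast, blast, blast)

lemma stochastic_integral_L2_tendsto:
  assumes h: "h \<in> LX_space m b \<sigma> \<nu>" and dl: "dominated_limit m G g h"
  shows "(\<lambda>n. LINT \<omega>|P. (\<Phi> (G n) \<omega> - \<Phi> g \<omega>)\<^sup>2) \<longlonglongrightarrow> 0"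
  by (rule stochastic_integralD(4)[OF LX_norm_tendsto_0(2,1,3)[OF assms]])

lemma stochastic_integral_conv_prob:
  assumes P: "prob_space P" and h: "h \<in> LX_space m b \<sigma> \<nu>" and dl: "dominated_limit m G g h"
  shows "prob_space.conv_prob P (\<lambda>n. \<Phi> (G n)) (\<Phi> g)"
proof -
  interpret prob_space P by fact
  note LX = LX_norm_tendsto_0(1,2)[OF h dl]
  show ?thesis
    by (intro conv_prob_L2 stochastic_integralD LX stochastic_integral_L2_tendsto[OF h dl])
qed

lemma stochastic_integral_diff_integrable:
  assumes g: "g \<in> LX_space m b \<sigma> \<nu>" and h: "h \<in> LX_space m b \<sigma> \<nu>"
  shows "integrable P (\<lambda>\<omega>. (\<Phi> g \<omega> - \<Phi> h \<omega>)\<^sup>2)"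
  by (intro integrable_power2_sum stochastic_integralD g h)

text \<open>Square-mean convergence gives almost sure convergence along a subsequence, and almost
  sure limits of \<open>N\<close>-measurable variables are \<open>N\<close>-measurable.\<close>

lemma stochastic_integral_ae_closed:
  assumes cl: "ae_closed P N" and h: "h \<in> LX_space m b \<sigma> \<nu>" and dl: "dominated_limit m G g h"
    and GN: "\<And>n. \<Phi> (G n) \<in> borel_measurable N"
  shows "\<Phi> g \<in> borel_measurable N"
proof -
  note LX = LX_norm_tendsto_0(1,2)[OF h dl]
  have "(\<lambda>n. LINT \<omega>|P. (\<Phi> (G n) \<omega> - \<Phi> g \<omega>)\<^sup>2) \<longlonglongrightarrow> 0"
    by (rule stochastic_integral_L2_tendsto[OF h dl])
  then have "\<exists>r::nat \<Rightarrow> nat. strict_mono r \<and> (AE \<omega> in P. (\<lambda>n. (\<Phi> (G (r n)) \<omega> - \<Phi> g \<omega>)\<^sup>2) \<longlonglongrightarrow> 0)"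
    by (intro tendsto_L1_AE_subseq stochastic_integral_diff_integrable LX) simp_all
  then obtain r :: "nat \<Rightarrow> nat" where r: "AE \<omega> in P. (\<lambda>n. (\<Phi> (G (r n)) \<omega> - \<Phi> g \<omega>)\<^sup>2) \<longlonglongrightarrow> 0" by blast
  show ?thesis
  proof (rule ae_closed_lim[OF cl])
    show "\<Phi> (G (r n)) \<in> borel_measurable N" for n by (rule GN)
    show "AE \<omega> in P. (\<lambda>n. \<Phi> (G (r n)) \<omega>) \<longlonglongrightarrow> \<Phi> g \<omega>"
      using r
    proof eventually_elim
      case (elim \<omega>)
      have "(\<lambda>n. sqrt ((\<Phi> (G (r n)) \<omega> - \<Phi> g \<omega>)\<^sup>2)) \<longlonglongrightarrow> sqrt 0" by (intro tendsto_real_sqrt elim)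
      then have "(\<lambda>n. \<Phi> (G (r n)) \<omega> - \<Phi> g \<omega>) \<longlonglongrightarrow> 0" by (simp add: tendsto_rabs_zero_iff)
      then show ?case by (simp add: LIM_zero_iff)
    qed
  qed
qed

end

section \<open>The decomposition\<close>

context levy_jumps
begin

text \<open>These functions lie in every \<open>LX_space\<close>, since \<open>A\<close> has finite measure.\<close>

definition L2_on :: "'a set \<Rightarrow> ('a \<Rightarrow> real) set" where
  "L2_on A = {g \<in> borel_measurable m. integrable m (\<lambda>t. (g t)\<^sup>2) \<and> (\<forall>t\<in>T. t \<notin> A \<longrightarrow> g t = 0)}"

lemma L2_onD:
  assumes "g \<in> L2_on A" "A \<in> \<A>"
  shows "g \<in> borel_measurable m" "sq_integrable A g" "set_integrable m A g"
    "integrable m g" "integrable m (\<lambda>t. (g t)\<^sup>2)" "g \<in> LX_space m b' \<sigma>' \<nu>'"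
proof -
  show g: "g \<in> borel_measurable m" "integrable m (\<lambda>t. (g t)\<^sup>2)" using assms by (auto simp: L2_on_def)
  have supp: "g t = 0" if "t \<in> T" "t \<notin> A" for t using assms that by (auto simp: L2_on_def)
  show sq: "sq_integrable A g"
    unfolding set_integrable_def using g assms by (intro integrable_mult_indicator) auto
  show "set_integrable m A g" by (rule f_integrable[OF assms(2) g(1) sq])
  moreover have "indicator A t *\<^sub>R g t = g t" if "t \<in> space m" for t
    using supp that space_m by (cases "t \<in> A") auto
  ultimately show i: "integrable m g"
    by (simp only: set_integrable_def cong: Bochner_Integration.integrable_cong)
  have "(\<integral>\<^sup>+t. ennreal \<bar>g t\<bar> \<partial>m) < \<infinity>" using i unfolding integrable_iff_bounded by simp
  moreover have "(\<integral>\<^sup>+t. ennreal ((g t)\<^sup>2) \<partial>m) < \<infinity>" using g(2) unfolding integrable_iff_bounded by simp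
  ultimately show "g \<in> LX_space m b' \<sigma>' \<nu>'" using g(1) by (simp add: LX_space_iff)
qed

lemma L2_on_dominated:
  assumes h: "h \<in> L2_on A" and g: "g \<in> borel_measurable m" and le: "\<And>t. t \<in> T \<Longrightarrow> \<bar>g t\<bar> \<le> \<bar>h t\<bar>"
  shows "g \<in> L2_on A"
  unfolding L2_on_def
proof (intro CollectI conjI ballI impI g)
  show "integrable m (\<lambda>t. (g t)\<^sup>2)"
  proof (rule Bochner_Integration.integrable_bound)
    show "integrable m (\<lambda>t. (h t)\<^sup>2)" using h by (simp add: L2_on_def)
    show "AE t in m. norm ((g t)\<^sup>2) \<le> norm ((h t)\<^sup>2)"
      using le space_m by (intro AE_I2) (simp add: abs_le_square_iff)
  qed (use g in measurable)
  show "g t = 0" if "t \<in> T" "t \<notin> A" for t using le[OF that(1)] h that by (auto simp: L2_on_def)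
qed

lemma L2_on_linear:
  assumes g: "g \<in> L2_on A" and h: "h \<in> L2_on A" shows "(\<lambda>t. a * g t + c * h t) \<in> L2_on A"
proof -
  have "integrable m (\<lambda>t. (a * g t + c * h t)\<^sup>2)"
    by (rule integrable_power2_sum) (use g h in \<open>auto simp: L2_on_def power_mult_distrib\<close>)
  then show ?thesis using g h unfolding L2_on_def by auto
qed

lemma indicator_L2_on: "A \<in> \<A> \<Longrightarrow> A' \<in> \<A> \<Longrightarrow> A' \<subseteq> A \<Longrightarrow> indicator A' \<in> L2_on A"
proof -
  assume A: "A \<in> \<A>" "A' \<in> \<A>" "A' \<subseteq> A"
  have "(indicator A' t)\<^sup>2 = (indicator A' t :: real)" for t by (simp add: indicator_def)
  then show ?thesis using A fin_m[of A'] by (auto simp: L2_on_def indicator_eq_0_iff)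
qed

lemma L2_limit:
  assumes h: "h \<in> L2_on A" and A: "A \<in> \<A>" and dl: "dominated_limit m G g h"
  shows "\<And>n. G n \<in> L2_on A" and "g \<in> L2_on A" and "\<And>n. (\<lambda>t. G n t - g t) \<in> L2_on A"
    and "(\<lambda>n. LINT t:A|m. G n t - g t) \<longlonglongrightarrow> 0" and "(\<lambda>n. LINT t:A|m. (G n t - g t)\<^sup>2) \<longlonglongrightarrow> 0"
    and "(\<lambda>n. LINT t:A|m. G n t) \<longlonglongrightarrow> (LINT t:A|m. g t)"
proof -
  note G = dominated_limitD(1)[OF dl] and g = dominated_limitD(2)[OF dl] and lim = dominated_limitD(3)[OF dl]
    and le = dominated_limitD(4)[OF dl] and gle = dominated_limitD(5)[OF dl]
  show GL: "G n \<in> L2_on A" for n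
    by (rule L2_on_dominated[OF h G]) (use le space_m in \<open>auto intro: order_trans[OF _ abs_ge_self]\<close>)
  show gL: "g \<in> L2_on A"
    by (rule L2_on_dominated[OF h g]) (use gle space_m in \<open>auto intro: order_trans[OF _ abs_ge_self]\<close>)
  show uL: "(\<lambda>t. G n t - g t) \<in> L2_on A" for n using L2_on_linear[OF GL gL, of 1 n "-1"] by simp
  note [measurable] = G g \<A>_sets[OF A]
  have ule: "\<bar>G n t - g t\<bar> \<le> 2 * h t" if "t \<in> space m" for n t using le[OF that, of n] gle[OF that] by linarith
  have hm: "h \<in> borel_measurable m" using h by (simp add: L2_on_def)
  have u0: "(\<lambda>n. G n t - g t) \<longlonglongrightarrow> 0" if "t \<in> space m" for t
    using tendsto_diff[OF lim[OF that] tendsto_const[of "g t"]] by simp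
  show l1: "(\<lambda>n. LINT t:A|m. G n t - g t) \<longlonglongrightarrow> 0"
  proof -
    have "(\<lambda>n. LINT t|m. indicator A t *\<^sub>R (G n t - g t)) \<longlonglongrightarrow> (LINT t|m. 0)"
    proof (rule integral_dominated_convergence[where w = "\<lambda>t. 2 * h t"])
      show "integrable m (\<lambda>t. 2 * h t)" using L2_onD(4)[OF h A] by simp
      show "AE t in m. (\<lambda>n. indicator A t *\<^sub>R (G n t - g t)) \<longlonglongrightarrow> 0"
        using u0 by (intro AE_I2) (auto simp: indicator_def)
      show "AE t in m. norm (indicator A t *\<^sub>R (G n t - g t)) \<le> 2 * h t" for n
        using ule by (intro AE_I2) (fastforce simp: indicator_def intro: order_trans[OF abs_ge_zero])
    qed measurable
    then show ?thesis by (simp add: set_lebesgue_integral_def)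
  qed
  show "(\<lambda>n. LINT t:A|m. (G n t - g t)\<^sup>2) \<longlonglongrightarrow> 0"
  proof -
    have "(\<lambda>n. LINT t|m. indicator A t *\<^sub>R (G n t - g t)\<^sup>2) \<longlonglongrightarrow> (LINT t|m. 0)"
    proof (rule integral_dominated_convergence[where w = "\<lambda>t. 4 * (h t)\<^sup>2"])
      show "integrable m (\<lambda>t. 4 * (h t)\<^sup>2)" using L2_onD(5)[OF h A] by simp
      show "AE t in m. (\<lambda>n. indicator A t *\<^sub>R (G n t - g t)\<^sup>2) \<longlonglongrightarrow> 0"
      proof (rule AE_I2)
        fix t assume "t \<in> space m"
        from tendsto_mult[OF tendsto_const[of "indicator A t"] tendsto_power[OF u0[OF this], of 2]]
        show "(\<lambda>n. indicator A t *\<^sub>R (G n t - g t)\<^sup>2) \<longlonglongrightarrow> 0" by simp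
      qed
      show "AE t in m. norm (indicator A t *\<^sub>R (G n t - g t)\<^sup>2) \<le> 4 * (h t)\<^sup>2" for n
      proof (rule AE_I2)
        fix t assume "t \<in> space m"
        from power_mono[OF ule[OF this, of n], of 2] show "norm (indicator A t *\<^sub>R (G n t - g t)\<^sup>2) \<le> 4 * (h t)\<^sup>2"
          by (auto simp: indicator_def power_mult_distrib)
      qed
    qed measurable
    then show ?thesis by (simp add: set_lebesgue_integral_def)
  qed
  have eq: "(LINT t:A|m. G n t) = (LINT t:A|m. G n t - g t) + (LINT t:A|m. g t)" for n
    using set_integral_diff(2)[OF L2_onD(3)[OF GL A] L2_onD(3)[OF gL A], of n] by simp
  show "(\<lambda>n. LINT t:A|m. G n t) \<longlonglongrightarrow> (LINT t:A|m. g t)"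
    unfolding eq using tendsto_add[OF l1 tendsto_const] by simp
qed

text \<open>Membership in \<open>L2_on A\<close> is carried through the induction, so that the
  linear and limit steps for \<open>Q\<close> only meet functions on which both stochastic integrals
  and the jump integral are defined and continuous.\<close>

lemma L2_on_induct:
  fixes Q :: "('a \<Rightarrow> real) \<Rightarrow> bool"
  assumes A: "A \<in> \<A>" and f: "f \<in> borel_measurable m" and fA: "(\<lambda>t. f t * indicator A t) \<in> L2_on A"
    and ind: "\<And>A'. A' \<in> \<A> \<Longrightarrow> A' \<subseteq> A \<Longrightarrow> Q (indicator A')"
    and lin: "\<And>g h c d. g \<in> L2_on A \<Longrightarrow> h \<in> L2_on A \<Longrightarrow> Q g \<Longrightarrow> Q h \<Longrightarrow> Q (\<lambda>t. c * g t + d * h t)"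
    and lim: "\<And>g G h. \<lbrakk>\<And>n. Q (G n); h \<in> L2_on A; dominated_limit m G g h\<rbrakk> \<Longrightarrow> Q g"
  shows "Q (\<lambda>t. f t * indicator A t)"
proof -
  have "(\<lambda>t. f t * indicator A t) \<in> L2_on A \<and> Q (\<lambda>t. f t * indicator A t)"
  proof (rule localized_function_induct[where Q = "\<lambda>g. g \<in> L2_on A \<and> Q g", OF sets_m space_m indexing_collectionD(9)[OF ic] A f])
    show "indicator A' \<in> L2_on A \<and> Q (indicator A')" if "A' \<in> \<A>" "A' \<subseteq> A" for A'
      using ind indicator_L2_on A that by auto
    show "(\<lambda>t. c * g t + d * h t) \<in> L2_on A \<and> Q (\<lambda>t. c * g t + d * h t)"
      if "g \<in> L2_on A \<and> Q g" "h \<in> L2_on A \<and> Q h" for g h c d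
      using lin L2_on_linear that by auto
    fix g G h assume G: "\<And>n::nat. G n \<in> L2_on A \<and> Q (G n)" and dl: "dominated_limit m G g h"
      and h: "h = indicator A \<or> h = (\<lambda>t. 2 * \<bar>f t * indicator A t\<bar>)"
    have hL: "h \<in> L2_on A"
      using h
    proof
      assume h: "h = (\<lambda>t. 2 * \<bar>f t * indicator A t\<bar>)"
      have "(\<lambda>t. 2 * (f t * indicator A t) + 0 * (f t * indicator A t)) \<in> L2_on A" by (rule L2_on_linear[OF fA fA])
      then have "(\<lambda>t. 2 * (f t * indicator A t)) \<in> L2_on A" by simp
      then show ?thesis unfolding h
        by (rule L2_on_dominated) (use f \<A>_sets[OF A] in \<open>auto simp: abs_mult\<close>)
    qed (use indicator_L2_on[OF A A] in simp)
    show "g \<in> L2_on A \<and> Q g"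
      using L2_limit(2)[OF hL A dl] lim[OF _ hL dl] G by blast
  qed
  then show ?thesis by simp
qed

lemma decomposition_L2:
  assumes A: "A \<in> \<A>" and f: "f \<in> borel_measurable m" and fA: "(\<lambda>t. f t * indicator A t) \<in> L2_on A"
    and comp: "complete_measure P"
    and \<Phi>: "stochastic_integral P m \<A> b \<sigma> \<nu> (levy_process m b \<sigma> \<nu> B \<Xi>) \<Phi>"
    and \<Psi>: "stochastic_integral P m \<A> 0 1 (null_measure borel) B \<Psi>"
  shows "AE \<omega> in P. \<Phi> (\<lambda>t. f t * indicator A t) \<omega>
    = b * (LINT t:A|m. f t) + \<sigma> * \<Psi> (\<lambda>t. f t * indicator A t) \<omega> + JI f A \<omega>"
proof -
  define Q where "Q g \<longleftrightarrow> (AE \<omega> in P. \<Phi> g \<omega> = b * (LINT t:A|m. g t) + \<sigma> * \<Psi> g \<omega> + JI g A \<omega>)" for g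
  have "Q (\<lambda>t. f t * indicator A t)"
  proof (rule L2_on_induct[OF A f fA])
    \<comment> \<open>The jump integral of the indicator of \<open>A'\<close> over \<open>A\<close>
      becomes that of the constant 1 over \<open>A'\<close>. For indicators the claim is then the
      formula defining \<open>levy_process\<close>.\<close>
    fix A' assume A': "A' \<in> \<A>" "A' \<subseteq> A"
    have "(LINT t:A|m. indicator A' t) = measure m A'"
    proof -
      have "(LINT t:A|m. indicator A' t) = (LINT t|m. (indicator A' t :: real))"
        unfolding set_lebesgue_integral_def
        by (intro Bochner_Integration.integral_cong refl) (use A' in \<open>auto simp: indicator_def\<close>)
      also have "\<dots> = measure m A'" using A'(1) sets.sets_into_space[OF \<A>_sets[OF A'(1)]] by (simp add: Int_absorb2)
      finally show ?thesis .
    qed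
    then show "Q (indicator A')"
      unfolding Q_def
      using stochastic_integralD(5)[OF \<Phi> A'(1)] stochastic_integralD(5)[OF \<Psi> A'(1)] AE_jump_integral_indicator[OF A A'(2)]
      by (auto elim!: eventually_elim2 simp: levy_process_def) 
  next
    fix g h c d assume gh: "g \<in> L2_on A" "h \<in> L2_on A" and Q: "Q g" "Q h"
    have i: "(LINT t:A|m. c * g t + d * h t) = c * (LINT t:A|m. g t) + d * (LINT t:A|m. h t)"
      using L2_onD(3)[OF gh(1) A] L2_onD(3)[OF gh(2) A] by (subst set_integral_add) auto
    note L = L2_onD[OF gh(1) A] L2_onD[OF gh(2) A] L2_onD[OF L2_on_linear[OF gh] A]
    show "Q (\<lambda>t. c * g t + d * h t)"
      unfolding Q_def i
      using Q[unfolded Q_def] stochastic_integralD(3)[OF \<Phi> L(6) L(12), of c d]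
        stochastic_integralD(3)[OF \<Psi> L(6) L(12), of c d]
        AE_jump_integral_linear[OF A L(1,2) L(7,8) L(14), of c d]
      by eventually_elim (simp add: algebra_simps)
  next
    fix g G h assume Q: "\<And>n::nat. Q (G n)" and hL: "h \<in> L2_on A" and dl: "dominated_limit m G g h"
    note LL = L2_limit[OF hL A dl]
    note hX = L2_onD(6)[OF hL A]
    have cR: "conv_prob (\<lambda>n \<omega>. b * (LINT t:A|m. G n t) + \<sigma> * \<Psi> (G n) \<omega> + JI (G n) A \<omega>)
      (\<lambda>\<omega>. b * (LINT t:A|m. g t) + \<sigma> * \<Psi> g \<omega> + JI g A \<omega>)"
    proof (intro conv_prob_add conv_prob_cmult)
      show "conv_prob (\<lambda>n \<omega>. LINT t:A|m. G n t) (\<lambda>\<omega>. LINT t:A|m. g t)" by (rule conv_prob_real[OF LL(6)])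
      show "conv_prob (\<lambda>n. \<Psi> (G n)) (\<Psi> g)"
        by (rule stochastic_integral_conv_prob[OF \<Psi> prob_space_axioms hX dl])
      show "conv_prob (\<lambda>n. JI (G n) A) (JI g A)"
        by (rule conv_prob_jump_integral[OF A comp dominated_limitD(1)[OF dl] L2_onD(2)[OF LL(1) A] dominated_limitD(2)[OF dl] L2_onD(2)[OF LL(2) A] L2_onD(2)[OF LL(3) A] LL(4,5)])
    qed
    have c\<Phi>: "conv_prob (\<lambda>n. \<Phi> (G n)) (\<Phi> g)"
      by (rule stochastic_integral_conv_prob[OF \<Phi> prob_space_axioms hX dl])
    \<comment> \<open>By \<open>Q (G n)\<close> the two sides agree almost surely for each
      \<open>n\<close>, so a single sequence has both candidate limits, which must then coincide
      almost surely.\<close>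
    have "conv_prob (\<lambda>n \<omega>. b * (LINT t:A|m. G n t) + \<sigma> * \<Psi> (G n) \<omega> + JI (G n) A \<omega>) (\<Phi> g)"
      by (rule conv_prob_AE_cong[OF c\<Phi>]) (use Q cR in \<open>auto simp: Q_def conv_prob_def\<close>)
    from conv_prob_unique[OF this cR] show "Q g" unfolding Q_def .
  qed
  then show ?thesis by (simp only: Q_def jump_integral_mult_indicator set_integral_mult_indicator)
qed

lemma wiener_integral_measurable:
  assumes A: "A \<in> \<A>" and f: "f \<in> borel_measurable m" and fA: "(\<lambda>t. f t * indicator A t) \<in> L2_on A"
    and \<Psi>: "stochastic_integral P m \<A> 0 1 (null_measure borel) B \<Psi>"
    and cl: "ae_closed P N" and B: "\<And>A'. A' \<in> \<A> \<Longrightarrow> B A' \<in> borel_measurable N"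
  shows "\<Psi> (\<lambda>t. f t * indicator A t) \<in> borel_measurable N"
proof (rule L2_on_induct[OF A f fA])
  show "\<Psi> (indicator A') \<in> borel_measurable N" if "A' \<in> \<A>" "A' \<subseteq> A" for A'
    by (rule ae_closed_cong[OF cl B[OF that(1)]])
       (use stochastic_integralD(5)[OF \<Psi> that(1)] in \<open>auto elim: eventually_mono\<close>)
next
  fix g h c d assume gh: "g \<in> L2_on A" "h \<in> L2_on A" and m: "\<Psi> g \<in> borel_measurable N" "\<Psi> h \<in> borel_measurable N"
  show "\<Psi> (\<lambda>t. c * g t + d * h t) \<in> borel_measurable N"
  proof (rule ae_closed_cong[OF cl])
    show "(\<lambda>\<omega>. c * \<Psi> g \<omega> + d * \<Psi> h \<omega>) \<in> borel_measurable N" using m by measurable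
    show "AE \<omega> in P. c * \<Psi> g \<omega> + d * \<Psi> h \<omega> = \<Psi> (\<lambda>t. c * g t + d * h t) \<omega>"
      using stochastic_integralD(3)[OF \<Psi> L2_onD(6)[OF gh(1) A] L2_onD(6)[OF gh(2) A], of c d] by (auto elim: eventually_mono)
  qed
next
  fix g G h assume "\<And>n::nat. \<Psi> (G n) \<in> borel_measurable N" and hL: "h \<in> L2_on A"
    and dl: "dominated_limit m G g h"
  then show "\<Psi> g \<in> borel_measurable N"
    by (intro stochastic_integral_ae_closed[OF \<Psi> cl L2_onD(6)[OF hL A] dl])
qed

text \<open>A nonzero quadratic coefficient in the norm of L(X) forces square integrability. This
  places the function in the domain of the Wiener integral as well.\<close>

lemma nondegenerate_L2:
  assumes A: "A \<in> \<A>" and nd: "\<sigma>\<^sup>2 + (LINT x|\<nu>. x\<^sup>2) \<noteq> 0"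
    and X: "(\<lambda>t. f t * indicator A t) \<in> LX_space m b \<sigma> \<nu>"
  shows "(\<lambda>t. f t * indicator A t) \<in> L2_on A"
proof -
  have m[measurable]: "(\<lambda>t. f t * indicator A t) \<in> borel_measurable m"
    and fin: "(\<integral>\<^sup>+t. ennreal ((f t * indicator A t)\<^sup>2) \<partial>m) < \<infinity>"
    using X nd unfolding LX_space_iff by auto
  have "(\<lambda>t. (f t * indicator A t)\<^sup>2) \<in> borel_measurable m" by measurable
  then have "integrable m (\<lambda>t. (f t * indicator A t)\<^sup>2)"
    unfolding integrable_iff_bounded using fin by (simp only: real_norm_def abs_power2 simp_thms)
  then show ?thesis unfolding L2_on_def using m by simp
qed

text \<open>If \<open>\<sigma>\<close> and \<open>\<nu>\<close> vanish, local integrability of \<open>f\<close> no longer implies local square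
  integrability, so this case is treated separately.\<close>

lemma degenerate_jumps:
  assumes z: "(LINT x|\<nu>. x\<^sup>2) = 0"
  shows "(LINT x:C|\<nu>. x) = 0" and "AE \<omega> in P. \<Xi> \<omega> = {}"
proof -
  have AE0: "AE x in \<nu>. x\<^sup>2 = 0"
    using z sq_\<nu> by (subst (asm) integral_nonneg_eq_0_iff_AE) auto
  have "AE x in \<nu>. indicator C x *\<^sub>R x = 0" using AE0 by eventually_elim simp
  then show "(LINT x:C|\<nu>. x) = 0"
    unfolding set_lebesgue_integral_def by (rule integral_eq_zero_AE)
  \<comment> \<open>A vanishing second moment confines \<nu> to \<open>{0}\<close>, which has no
    mass, so \<nu> is the zero measure.\<close>
  have "{0} \<in> null_sets \<nu>" using \<nu>0 sets_\<nu> by (simp add: null_sets_def)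
  then have "AE x in \<nu>. x \<notin> {0}" by (rule AE_not_in)
  then have "AE x in \<nu>. False" using AE0 by eventually_elim simp
  then have "emeasure \<nu> UNIV = 0" using AE_iff_measurable[of UNIV \<nu> "\<lambda>_. False"] sets.top[of \<nu>] by simp
  then have 0: "emeasure \<mu> (T \<times> UNIV) = 0"
    using sets.top[of m] sets.top[of \<nu>] by (simp add: space_m M2.emeasure_pair_measure_Times)
  have D: "T \<times> UNIV \<in> sets \<mu>" using sets.top[of \<mu>] by (simp add: space_pair_measure space_m)
  have pv: "poisson_var P (point_count \<Xi> (T \<times> UNIV)) 0"
    using poisson_random_setD(1)[OF poisson D] 0 by simp
  then have [measurable]: "point_count \<Xi> (T \<times> UNIV) \<in> borel_measurable P" by (simp add: poisson_var_def)
  have "prob {\<omega> \<in> space P. point_count \<Xi> (T \<times> UNIV) \<omega> = of_nat k} = exp (- enn2real 0) * enn2real 0 ^ k / fact k" for k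
    using pv by (simp add: poisson_var_def del: enn2real_0)
  \<comment> \<open>With parameter zero the Poisson weight at \<open>k = 0\<close> is one: almost
    surely there is no point at all.\<close>
  from this[of 0] have "prob {\<omega> \<in> space P. point_count \<Xi> (T \<times> UNIV) \<omega> = 0} = 1" by simp
  then have "AE \<omega> in P. \<omega> \<in> {\<omega> \<in> space P. point_count \<Xi> (T \<times> UNIV) \<omega> = 0}"
    by (subst (asm) prob_eq_1) auto
  then show "AE \<omega> in P. \<Xi> \<omega> = {}"
    using AE_space
  proof eventually_elim
    case (elim \<omega>)
    have "\<Xi> \<omega> \<subseteq> T \<times> UNIV"
      using poisson_random_setD(2)[OF poisson elim(2)] by (simp add: space_pair_measure space_m)
    then have "emeasure (count_space UNIV) (\<Xi> \<omega>) = 0"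
      using elim(1) by (simp add: point_count_def Int_absorb2)
    then show ?case by (simp add: emeasure_count_space split: if_splits)
  qed
qed

text \<open>The null set is the event that some point exists. It serves all integrands, sets and
  truncation levels at once.\<close>

lemma degenerate_jump_integral:
  assumes z: "(LINT x|\<nu>. x\<^sup>2) = 0"
  shows "AE \<omega> in P. \<forall>f A. (\<forall>\<epsilon>. Jeps f \<epsilon> A \<omega> = 0) \<and> JI f A \<omega> = 0"
  using degenerate_jumps(2)[OF z]
proof eventually_elim
  case (elim \<omega>)
  have "Jeps f \<epsilon> A \<omega> = 0" for f \<epsilon> A
    using elim by (simp add: jump_integral_eps_def degenerate_jumps(1)[OF z])
  then show ?case by (simp add: jump_integral_def tendsto_Lim)
qed

text \<open>Here \<open>levy_process\<close> is almost surely \<open>b * measure m A\<close>, and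
  L(X) consists of the integrable functions or, if \<open>b = 0\<close>, of all measurable ones. The
  integral against X is then \<open>b\<close> times the integral against \<open>m\<close>, by the
  same induction with domination in L(X) itself.\<close>

lemma decomposition_degenerate:
  assumes A: "A \<in> \<A>" and z: "(LINT x|\<nu>. x\<^sup>2) = 0"
    and f: "f \<in> borel_measurable m" and fA: "(\<lambda>t. f t * indicator A t) \<in> LX_space m b 0 \<nu>"
    and \<Phi>: "stochastic_integral P m \<A> b 0 \<nu> (levy_process m b 0 \<nu> B \<Xi>) \<Phi>"
  shows "AE \<omega> in P. \<Phi> (\<lambda>t. f t * indicator A t) \<omega> = b * (LINT t|m. f t * indicator A t)"
proof -
  have LX: "g \<in> LX_space m b 0 \<nu> \<longleftrightarrow> g \<in> borel_measurable m \<and> (b = 0 \<or> integrable m g)" for g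
    unfolding LX_space_iff integrable_iff_bounded degenerate_jumps(1)[OF z] using z by auto
  define Q where "Q g \<longleftrightarrow> g \<in> LX_space m b 0 \<nu> \<and> (AE \<omega> in P. \<Phi> g \<omega> = b * (LINT t|m. g t))" for g
  have "Q (\<lambda>t. f t * indicator A t)"
  proof (rule localized_function_induct[OF sets_m space_m indexing_collectionD(9)[OF ic] A f])
    show "Q (indicator A')" if A': "A' \<in> \<A>" "A' \<subseteq> A" for A'
    proof -
      have "indicator A' \<in> LX_space m b 0 \<nu>" by (rule L2_onD(6)[OF indicator_L2_on[OF A A'] A])
      moreover have "(LINT t|m. indicator A' t) = measure m A'"
        using sets.sets_into_space[OF \<A>_sets[OF A'(1)]] by (simp add: Int_absorb2)
      ultimately show ?thesis
        unfolding Q_def using stochastic_integralD(5)[OF \<Phi> A'(1)] degenerate_jump_integral[OF z]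
        by (auto elim!: eventually_elim2 simp: levy_process_def)
    qed
  next
    fix g h c d assume Q: "Q g" "Q h"
    have L: "g \<in> LX_space m b 0 \<nu>" "h \<in> LX_space m b 0 \<nu>" using Q by (auto simp: Q_def)
    then have "(\<lambda>t. c * g t + d * h t) \<in> LX_space m b 0 \<nu>" by (auto simp: LX)
    \<comment> \<open>If \<open>b = 0\<close> the integrals may be those of non-integrable
      functions, but the factor \<open>b\<close> makes both sides zero.\<close>
    moreover have "b * (LINT t|m. c * g t + d * h t) = c * (b * (LINT t|m. g t)) + d * (b * (LINT t|m. h t))"
      using L by (auto simp: LX algebra_simps)
    ultimately show "Q (\<lambda>t. c * g t + d * h t)"
      unfolding Q_def using Q[unfolded Q_def] stochastic_integralD(3)[OF \<Phi> L, of c d]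
      by (auto elim: eventually_elim2)
  next
    fix g G h assume G: "\<And>n::nat. Q (G n)" and dl: "dominated_limit m G g h"
      and h: "h = indicator A \<or> h = (\<lambda>t. 2 * \<bar>f t * indicator A t\<bar>)"
    have hX: "h \<in> LX_space m b 0 \<nu>"
      using h L2_onD(6)[OF indicator_L2_on[OF A A order.refl] A] LX_space_mult_abs[OF fA] by auto
    have "(\<lambda>n. b * (LINT t|m. G n t)) \<longlonglongrightarrow> b * (LINT t|m. g t)"
    proof (cases "b = 0")
      case False
      then have "integrable m h" using hX by (simp add: LX)
      then have "(\<lambda>n. LINT t|m. G n t) \<longlonglongrightarrow> (LINT t|m. g t)"
        using dominated_limitD[OF dl] by (intro integral_dominated_convergence[where w = h]) auto
      then show ?thesis by (intro tendsto_intros)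
    qed simp
    then have cR: "conv_prob (\<lambda>n \<omega>. b * (LINT t|m. G n t)) (\<lambda>\<omega>. b * (LINT t|m. g t))" by (rule conv_prob_real)
    have "conv_prob (\<lambda>n \<omega>. b * (LINT t|m. G n t)) (\<Phi> g)"
      by (rule conv_prob_AE_cong[OF stochastic_integral_conv_prob[OF \<Phi> prob_space_axioms hX dl]])
         (use G in \<open>auto simp: Q_def\<close>)
    from conv_prob_unique[OF this cR] show "Q g"
      unfolding Q_def using LX_norm_tendsto_0(2)[OF hX dl] by simp
  qed
  then show ?thesis by (simp add: Q_def)
qed

end

theorem theorem2p12:
  fixes T :: "'a set" and \<A> :: "'a set set" and \<A>s :: "nat \<Rightarrow> 'a set set"
    and m :: "'a measure" and P :: "'w measure"
    and b \<sigma> :: real and \<nu> :: "real measure"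
    and B :: "'a set \<Rightarrow> 'w \<Rightarrow> real" and \<Xi> :: "'w \<Rightarrow> ('a \<times> real) set"
    and \<Phi> \<Psi> :: "('a \<Rightarrow> real) \<Rightarrow> 'w \<Rightarrow> real" and f :: "'a \<Rightarrow> real"
  assumes "indexing_collection T \<A> \<A>s"
    and "finite_dimensional \<A> \<A>s"
    and "reference_measure T \<A> \<A>s m"
    and "prob_space P" and "complete_measure P"
    and "\<sigma> \<ge> 0"
    and "sets \<nu> = sets borel" and "emeasure \<nu> {0} = 0" and "integrable \<nu> (\<lambda>x. x\<^sup>2)"
    and "centered_gaussian_process P \<A> B"
    and "\<forall>A\<^sub>1\<in>\<A>. \<forall>A\<^sub>2\<in>\<A>. (LINT \<omega>|P. B A\<^sub>1 \<omega> * B A\<^sub>2 \<omega>) = measure m (A\<^sub>1 \<inter> A\<^sub>2)"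
    and "poisson_random_set P (m \<Otimes>\<^sub>M \<nu>) \<Xi>"
    and "prob_space.indep_set P
           (process_sigma P \<A> B) (process_sigma P (sets (m \<Otimes>\<^sub>M \<nu>)) (point_count \<Xi>))"
    and "stochastic_integral P m \<A> b \<sigma> \<nu> (levy_process m b \<sigma> \<nu> B \<Xi>) \<Phi>"
    and "stochastic_integral P m \<A> 0 1 (null_measure borel) B \<Psi>"
    and "locally_integrable m \<A> b \<sigma> \<nu> f"
  shows "(\<forall>A\<in>\<A>. AE \<omega> in P.
            \<Phi> (\<lambda>t. f t * indicator A t) \<omega>
              = b * (LINT t:A|m. f t) + \<sigma> * \<Psi> (\<lambda>t. f t * indicator A t) \<omega>
                + jump_integral m \<nu> \<Xi> f A \<omega>)
       \<and> prob_space.indep_vars P (\<lambda>_. PiM \<A> (\<lambda>_. borel))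
            (\<lambda>i \<omega>. \<lambda>A\<in>\<A>.
               [b * (LINT t:A|m. f t),
                \<sigma> * \<Psi> (\<lambda>t. f t * indicator A t) \<omega>,
                jump_integral m \<nu> \<Xi> f A \<omega>] ! i)
            {..<3::nat}
       \<and> (\<forall>A\<in>\<A>. AE \<omega> in P.
            uniform_limit {A'\<in>\<A>. A' \<subseteq> A}
              (\<lambda>\<epsilon> A'. jump_integral_eps m \<nu> \<Xi> f \<epsilon> A' \<omega>)
              (\<lambda>A'. jump_integral m \<nu> \<Xi> f A' \<omega>)
              (at_right 0))"
proof -
  note ic = assms(1) and complete = assms(5) and \<Phi> = assms(14) and \<Psi> = assms(15)
  obtain p where "\<And>n. \<exists>(\<phi> :: 'a \<Rightarrow> nat \<Rightarrow> nat) \<kappa>. \<forall>A\<in>insert T (\<A>s n). \<forall>t\<in>T.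
    t \<in> A \<longleftrightarrow> (\<forall>i<p. \<phi> t i \<le> \<kappa> A i)"
    by (rule finite_dimensional_coordinates[OF ic assms(2) that])
  then interpret levy_jumps P T \<A> \<A>s m \<nu> \<Xi> p
    using assms unfolding reference_measure_def by (intro levy_jumps.intro levy_jumps_axioms.intro) auto
  \<comment> \<open>Local integrability speaks only of the products with indicators, so
    \<open>f\<close> as a whole need not be measurable. Everything is proved for \<open>fA A\<close>
    and carried back, since integrals over subsets of \<open>A\<close> read \<open>f\<close> on
    \<open>A\<close> only.\<close>
  define fA where "fA A t = f t * indicator A t" for A t
  have fX: "fA A \<in> LX_space m b \<sigma> \<nu>" if "A \<in> \<A>" for A
    using assms(16) that by (simp add: locally_integrable_def fA_def[abs_def])
  have fm: "fA A \<in> borel_measurable m" if "A \<in> \<A>" for A using fX[OF that] by (simp add: LX_space_iff)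
  have fA_idem: "(\<lambda>t. fA A t * indicator A t) = fA A" for A by (auto simp: fA_def fun_eq_iff indicator_def)
  have fA_eq: "fA A t = f t" if "t \<in> A" for A t using that by (simp add: fA_def)
  have eps_eq: "Jeps (fA A) \<epsilon> A' \<omega> = Jeps f \<epsilon> A' \<omega>" if "A' \<subseteq> A" for A A' \<epsilon> \<omega>
    using that by (intro jump_integral_eps_cong) (auto simp: fA_eq)
  then have J_eq: "JI (fA A) A' \<omega> = JI f A' \<omega>" if "A' \<subseteq> A" for A A' \<omega>
    using that by (simp add: jump_integral_def)
  have int_eq: "(LINT t:A|m. fA A t) = (LINT t:A|m. f t)" for A
    unfolding fA_def by (rule set_integral_mult_indicator)
  let ?N1 = "ae_completion P (process_sigma P \<A> B)"
  let ?N2 = "ae_completion P (process_sigma P (sets \<mu>) (point_count \<Xi>))"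
  note G = sigma_algebra_process_sigma[of P \<A> B] sigma_algebra_process_sigma[of P "sets \<mu>" "point_count \<Xi>"]
  note cl = ae_closed_completion[OF complete G(1) indep_setD_ev1[OF assms(13)]]
    ae_closed_completion[OF complete G(2) indep_setD_ev2[OF assms(13)]]
  \<comment> \<open>Measurability into the product over \<A> is coordinatewise, so every fact needed
    can be proved for one set \<open>A\<close> at a time.\<close>
  have main: "(AE \<omega> in P. \<Phi> (fA A) \<omega> = b * (LINT t:A|m. f t) + \<sigma> * \<Psi> (fA A) \<omega> + JI f A \<omega>)
    \<and> (\<lambda>\<omega>. \<sigma> * \<Psi> (fA A) \<omega>) \<in> borel_measurable ?N1
    \<and> JI f A \<in> borel_measurable ?N2
    \<and> (AE \<omega> in P. uniform_limit {A'\<in>\<A>. A' \<subseteq> A} (\<lambda>\<epsilon> A'. Jeps f \<epsilon> A' \<omega>)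
         (\<lambda>A'. JI f A' \<omega>) (at_right 0))" if A: "A \<in> \<A>" for A
  proof (cases "\<sigma>\<^sup>2 + (LINT x|\<nu>. x\<^sup>2) = 0")
    case False
    have L2: "(\<lambda>t. fA A t * indicator A t) \<in> L2_on A"
      by (rule nondegenerate_L2[OF A False]) (use fX[OF A] in \<open>simp only: fA_idem\<close>)
    then have sq: "set_integrable m A (\<lambda>t. (fA A t)\<^sup>2)" using L2_onD(2)[OF _ A] by (simp only: fA_idem)
    have "\<Psi> (fA A) \<in> borel_measurable ?N1"
      using wiener_integral_measurable[OF A fm[OF A] L2 \<Psi> cl(1) process_sigma_measurable] by (simp only: fA_idem)
    moreover have "JI (fA A) A \<in> borel_measurable ?N2"
      by (rule jump_integral_measurable[OF cl(2) process_sigma_measurable A fm[OF A] sq])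
    moreover have "JI (fA A) A = JI f A" using J_eq[of A A] by auto
    moreover have "AE \<omega> in P. uniform_limit {A'\<in>\<A>. A' \<subseteq> A} (\<lambda>\<epsilon> A'. Jeps f \<epsilon> A' \<omega>)
         (\<lambda>A'. JI f A' \<omega>) (at_right 0)"
      using AE_jump_integral_uniform_limit[OF A fm[OF A] sq]
    proof eventually_elim
      case (elim \<omega>)
      then show ?case by (rule uniform_limit_cong'[THEN iffD1, rotated 2]) (auto simp: eps_eq J_eq)
    qed
    ultimately show ?thesis
      using decomposition_L2[OF A fm[OF A] L2 complete \<Phi> \<Psi>, unfolded fA_idem int_eq] by (auto simp: J_eq)
  next
    case True
    have "0 \<le> (LINT x|\<nu>. x\<^sup>2)" by (rule Bochner_Integration.integral_nonneg) simp
    then have z: "(LINT x|\<nu>. x\<^sup>2) = 0" and \<sigma>0: "\<sigma> = 0"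
      using True zero_le_power2[of \<sigma>] by (linarith, simp add: add_nonneg_eq_0_iff)
    note J0 = degenerate_jump_integral[OF z]
    have "(LINT t|m. fA A t * indicator A t) = (LINT t:A|m. f t)"
      unfolding set_lebesgue_integral_def by (intro Bochner_Integration.integral_cong refl) (auto simp: fA_def indicator_def)
    moreover have "AE \<omega> in P. \<Phi> (\<lambda>t. fA A t * indicator A t) \<omega> = b * (LINT t|m. fA A t * indicator A t)"
      by (rule decomposition_degenerate[OF A z fm[OF A] _ \<Phi>[unfolded \<sigma>0]])
         (use fX[OF A] in \<open>simp only: fA_idem \<sigma>0\<close>)
    ultimately have "AE \<omega> in P. \<Phi> (fA A) \<omega> = b * (LINT t:A|m. f t)" by (simp only: fA_idem)
    then have 1: "AE \<omega> in P. \<Phi> (fA A) \<omega> = b * (LINT t:A|m. f t) + \<sigma> * \<Psi> (fA A) \<omega> + JI f A \<omega>"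
      using J0 by eventually_elim (simp add: \<sigma>0)
    have 2: "JI f A \<in> borel_measurable ?N2"
      by (rule ae_closed_cong[OF cl(2), of "\<lambda>_. 0"]) (use J0 in \<open>auto elim: eventually_mono\<close>)
    have 3: "AE \<omega> in P. uniform_limit {A'\<in>\<A>. A' \<subseteq> A} (\<lambda>\<epsilon> A'. Jeps f \<epsilon> A' \<omega>)
         (\<lambda>A'. JI f A' \<omega>) (at_right 0)"
      using J0 by eventually_elim (simp add: uniform_limit_const)
    \<comment> \<open>With \<sigma> = 0 the Wiener term is the zero function, whatever value \<Psi>
      takes at a function outside its domain.\<close>
    show ?thesis using 1 2 3 by (simp add: \<sigma>0)
  qed
  have "indep_vars (\<lambda>_. PiM \<A> (\<lambda>_. borel))
    (\<lambda>i \<omega>. [\<lambda>A\<in>\<A>. b * (LINT t:A|m. f t), \<lambda>A\<in>\<A>. \<sigma> * \<Psi> (fA A) \<omega>, \<lambda>A\<in>\<A>. JI f A \<omega>] ! i) {..<3::nat}"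
  proof (rule indep_vars_const_pair[OF indep_set_ae_completion[OF complete assms(13) G]])
    show "(\<lambda>A\<in>\<A>. b * (LINT t:A|m. f t)) \<in> space (PiM \<A> (\<lambda>_. borel))" by (simp add: space_PiM)
    show "(\<lambda>\<omega>. \<lambda>A\<in>\<A>. \<sigma> * \<Psi> (fA A) \<omega>) \<in> measurable ?N1 (PiM \<A> (\<lambda>_. borel))"
      "(\<lambda>\<omega>. \<lambda>A\<in>\<A>. JI f A \<omega>) \<in> measurable ?N2 (PiM \<A> (\<lambda>_. borel))"
      using main by (auto intro!: measurable_restrict)
  qed simp_all
  \<comment> \<open>Selecting an entry commutes with restriction to \<A> only for the three valid
    indices, so the two forms of the family are compared index by index.\<close>
  moreover have "(\<lambda>\<omega>. [\<lambda>A\<in>\<A>. b * (LINT t:A|m. f t), \<lambda>A\<in>\<A>. \<sigma> * \<Psi> (fA A) \<omega>, \<lambda>A\<in>\<A>. JI f A \<omega>] ! i)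
    = (\<lambda>\<omega>. \<lambda>A\<in>\<A>. [b * (LINT t:A|m. f t), \<sigma> * \<Psi> (fA A) \<omega>, JI f A \<omega>] ! i)"
    if "i \<in> {..<3}" for i
  proof -
    have "i = 0 \<or> i = 1 \<or> i = 2" using that by auto
    then show ?thesis by (elim disjE) simp_all
  qed
  ultimately have "indep_vars (\<lambda>_. PiM \<A> (\<lambda>_. borel))
    (\<lambda>i \<omega>. \<lambda>A\<in>\<A>. [b * (LINT t:A|m. f t), \<sigma> * \<Psi> (fA A) \<omega>, JI f A \<omega>] ! i) {..<3::nat}"
    by (rule indep_vars_cong[OF refl _ refl, THEN iffD1, rotated])
  then show ?thesis using main unfolding fA_def[abs_def] by blast
qed

end
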